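(* Let $f:\mathbb{R}^n\times\mathbb{R}^m\to\mathbb{R}^n$ be continuously differentiable with $f(0,0)=0$, and consider the delay-free control system $$\dot x(t)=f(x(t),u(t)),\quad x(t)\in\mathbb{R}^n,\ u(t)\in\mathbb{R}^m. \qquad (\mathrm{S})$$ Assume that: (A1) system (S) is forward complete; (A2) there exists a continuously differentiable function $k\in C^1(\mathbb{R}^n;\mathbb{R}^m)$ with $k(0)=0$ such that $0\in\mathbb{R}^n$ is a globally asymptotically stable and locally exponentially stable equilibrium point of the closed-loop system $\dot x(t)=f(x(t),k(x(t)))$. Then for every $\tau>0$ and $r>0$ there exist a locally bounded mapping $N:\mathbb{R}^n\times\mathbb{R}_+\to\{1,2,3,\dots\}$, a constant $\omega>0$ and a locally Lipschitz, non-decreasing function $C:\mathbb{R}_+\to\mathbb{R}_+$ with $C(0)=0$, such that for every partition $\{T_i\}_{i=0}^{\infty}$ of $\mathbb{R}_+$ with $\sup_{i\ge 0}(T_{i+1}-T_i)\le r$, every $x_0\in\mathbb{R}^n$ and every $u_0\in L^\infty([-\tau,0);\mathbb{R}^m)$, the solution $(x(t),u(t))\in\mathbb{R}^n\times\mathbb{R}^m$ of the closed-loop system consisting of $$\dot x(t)=f(x(t),u(t-\tau)),\quad t\ge 0,$$ together with, for each $i\in\{0,1,2,\dots\}$, $$\dot z(t)=f(z(t),k(z(t))),\quad u(t)=k(z(t)),\qquad t\in[T_i,T_{i+1}),\ z(t)\in\mathbb{R}^n,$$ $$z(T_i)=z_{N},$$ where $N:=N\big(x(T_i),\sup_{T_i-\tau\le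 s<T_i}|u(s)|\big)$, $h=\tau/N$, and $z_0,\dots,z_N\in\mathbb{R}^n$ are defined by $$z_0=x(T_i),\qquad z_{j+1}=z_j+\int_{jh}^{(j+1)h}f\big(z_j,u(T_i-\tau+s)\big)\,ds,\quad j=0,\dots,N-1,$$ with initial condition $x(0)=x_0$ and $u(s)=u_0(s)$ for $s\in[-\tau,0)$, satisfies for all $t\ge 0$: $$|x(t)|+\sup_{t-\tau\le s<t}|u(s)|\le \exp(-\omega t)\,C\Big(|x_0|+\sup_{-\tau\le s<0}|u_0(s)|\Big).$$
   Context: $\mathbb{R}_+=[0,+\infty)$; $|\cdot|$ is the Euclidean norm. A partition $\{T_i\}_{i=0}^\infty$ of $\mathbb{R}_+$ is an increasing sequence of times with $T_0=0$ and $T_i\to+\infty$. For an interval $I$, $L^\infty(I;\mathbb{R}^m)$ is the space of measurable and bounded functions on $I$ with values in $\mathbb{R}^m$; functions differing on a null set are not identified and $\sup$ denotes the actual supremum (not the essential supremum). Forward complete: for every initial condition and every measurable, locally essentially bounded input $u:\mathbb{R}_+\to\mathbb{R}^m$, the solution of $\dot x=f(x,u)$ exists for all $t\ge0$. Global asymptotic stability and local exponential stability have their standard meanings. A mapping is locally bounded if it is bounded on bounded sets. The solution of the closed-loop system is understood as follows: $x$ is absolutely continuous on bounded intervals and satisfies its differential equation almost everywhere; on each interval $[T_i,T_{i+1})$ the function $z$ is the solution of its differential equation started at the value $z(T_i)$ (so $z$ may jump at the times $T_i$), and $u(t)=k(z(t))$ for $t\geq 0$. The finite sequence $z_0,\dots,z_N$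 is recomputed at each sampling time $T_i$ and is not to be confused with the function $z(t)$. *)

theory Defs
  imports "HOL-Analysis.Analysis"
begin

definition continuously_differentiable ::
  "('a::euclidean_space \<Rightarrow> 'b::euclidean_space) \<Rightarrow> bool" where
  "continuously_differentiable g \<longleftrightarrow>
     (\<exists>g' :: 'a \<Rightarrow> 'a \<Rightarrow>\<^sub>L 'b.
        (\<forall>p. (g has_derivative blinfun_apply (g' p)) (at p)) \<and> continuous_on UNIV g')"

definition abs_continuous_on_interval ::
  "real \<Rightarrow> real \<Rightarrow> (real \<Rightarrow> 'a::euclidean_space) \<Rightarrow> bool" where
  "abs_continuous_on_interval a b g \<longleftrightarrow>
     (\<forall>\<epsilon>>0. \<exists>\<delta>>0. \<forall>(n::nat) (p::nat \<Rightarrow> real) (q::nat \<Rightarrow> real).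
        (\<forall>i<n. a \<le> p i \<and> p i \<le> q i \<and> q i \<le> b) \<and>
        disjoint_family_on (\<lambda>i. {p i<..<q i}) {..<n} \<and>
        (\<Sum>i<n. q i - p i) < \<delta>
        \<longrightarrow> (\<Sum>i<n. norm (g (q i) - g (p i))) < \<epsilon>)"

text \<open>Solutions of \<open>x'(t) = F t (x t)\<close> on the half-line, for a right-hand side that
  is only measurable in time.\<close>

definition caratheodory_solution ::
  "(real \<Rightarrow> 'a::euclidean_space \<Rightarrow> 'a) \<Rightarrow> (real \<Rightarrow> 'a) \<Rightarrow> bool" where
  "caratheodory_solution F x \<longleftrightarrow>
     (\<forall>b\<ge>0. abs_continuous_on_interval 0 b x) \<and>
     (AE t in lebesgue_on {0..}. (x has_vector_derivative F t (x t)) (at t within {0..}))"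

definition locally_ess_bounded :: "(real \<Rightarrow> 'b::euclidean_space) \<Rightarrow> bool" where
  "locally_ess_bounded u \<longleftrightarrow> (\<forall>b\<ge>0. \<exists>B. AE t in lebesgue_on {0..b}. norm (u t) \<le> B)"

definition forward_complete ::
  "('a::euclidean_space \<times> 'b::euclidean_space \<Rightarrow> 'a) \<Rightarrow> bool" where
  "forward_complete f \<longleftrightarrow>
     (\<forall>x0 u. u \<in> borel_measurable (lebesgue_on {0..}) \<and> locally_ess_bounded u
        \<longrightarrow> (\<exists>x. caratheodory_solution (\<lambda>t y. f (y, u t)) x \<and> x 0 = x0))"

text \<open>Stability of the origin for the autonomous system \<open>x' = g x\<close>.\<close>

definition autonomous_solution ::
  "('a::euclidean_space \<Rightarrow> 'a) \<Rightarrow> (real \<Rightarrow> 'a) \<Rightarrow> bool" where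
  "autonomous_solution g x \<longleftrightarrow>
     (\<forall>t\<ge>0. (x has_vector_derivative g (x t)) (at t within {0..}))"

text \<open>Global asymptotic stability includes that no solution escapes in finite time; since
  the other clauses speak about solutions on the whole half-line, this is stated separately.\<close>

definition globally_asymptotically_stable ::
  "('a::euclidean_space \<Rightarrow> 'a) \<Rightarrow> bool" where
  "globally_asymptotically_stable g \<longleftrightarrow>
     g 0 = 0 \<and>
     (\<forall>x0. \<exists>x. autonomous_solution g x \<and> x 0 = x0) \<and>
     (\<forall>\<epsilon>>0. \<exists>\<delta>>0. \<forall>x. autonomous_solution g x \<and> norm (x 0) < \<delta>
        \<longrightarrow> (\<forall>t\<ge>0. norm (x t) < \<epsilon>)) \<and>
     (\<forall>x. autonomous_solution g x \<longrightarrow> (x \<longlongrightarrow> 0) at_top)"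

definition locally_exponentially_stable ::
  "('a::euclidean_space \<Rightarrow> 'a) \<Rightarrow> bool" where
  "locally_exponentially_stable g \<longleftrightarrow>
     g 0 = 0 \<and>
     (\<exists>\<delta>>0. \<exists>M>0. \<exists>\<sigma>>0. \<forall>x. autonomous_solution g x \<and> norm (x 0) < \<delta>
        \<longrightarrow> (\<forall>t\<ge>0. norm (x t) \<le> M * exp (- \<sigma> * t) * norm (x 0)))"

definition time_partition :: "(nat \<Rightarrow> real) \<Rightarrow> bool" where
  "time_partition T \<longleftrightarrow> T 0 = 0 \<and> strict_mono T \<and> filterlim T at_top sequentially"

definition locally_bounded_on ::
  "'a::metric_space set \<Rightarrow> ('a \<Rightarrow> 'b::metric_space) \<Rightarrow> bool" where
  "locally_bounded_on D F \<longleftrightarrow> (\<forall>S\<subseteq>D. bounded S \<longrightarrow> bounded (F ` S))"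

definition sup_norm_on :: "real set \<Rightarrow> (real \<Rightarrow> 'b::real_normed_vector) \<Rightarrow> real" where
  "sup_norm_on I u = (SUP s\<in>I. norm (u s))"

text \<open>The sequence \<open>z\<^sub>j\<close> with step \<open>h\<close>, started at \<open>\<xi>\<close> and driven by \<open>v\<close>, which in the
  closed loop is the input history \<open>v s = u (T\<^sub>i - \<tau> + s)\<close>.\<close>

primrec predictor_seq ::
  "('a::euclidean_space \<times> 'b::euclidean_space \<Rightarrow> 'a) \<Rightarrow> (real \<Rightarrow> 'b) \<Rightarrow> real \<Rightarrow> 'a \<Rightarrow> nat \<Rightarrow> 'a"
where
  "predictor_seq f v h \<xi> 0 = \<xi>"
| "predictor_seq f v h \<xi> (Suc j) =
     predictor_seq f v h \<xi> j +
     integral {real j * h..real (Suc j) * h} (\<lambda>s. f (predictor_seq f v h \<xi> j, v s))"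

text \<open>The values of \<open>x\<close> and \<open>z\<close> at negative times, and of \<open>u\<close> before \<open>-\<tau>\<close>, are irrelevant.
  The derivative of \<open>z\<close> at \<open>T\<^sub>i\<close> is one-sided, so \<open>z\<close> may jump there.\<close>

definition closed_loop_solution ::
  "('a::euclidean_space \<times> 'b::euclidean_space \<Rightarrow> 'a) \<Rightarrow> ('a \<Rightarrow> 'b) \<Rightarrow> real \<Rightarrow>
   ('a \<times> real \<Rightarrow> nat) \<Rightarrow> (nat \<Rightarrow> real) \<Rightarrow> 'a \<Rightarrow> (real \<Rightarrow> 'b) \<Rightarrow>
   (real \<Rightarrow> 'a) \<Rightarrow> (real \<Rightarrow> 'a) \<Rightarrow> (real \<Rightarrow> 'b) \<Rightarrow> bool" where
  "closed_loop_solution f k \<tau> N T x0 u0 x z u \<longleftrightarrow>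
     x 0 = x0 \<and> (\<forall>s\<in>{-\<tau>..<0}. u s = u0 s) \<and>
     caratheodory_solution (\<lambda>t y. f (y, u (t - \<tau>))) x \<and>
     (\<forall>i. \<forall>t\<in>{T i..<T (Suc i)}.
        (z has_vector_derivative f (z t, k (z t))) (at t within {T i..<T (Suc i)}) \<and>
        u t = k (z t)) \<and>
     (\<forall>i. let n = N (x (T i), sup_norm_on {T i - \<tau>..<T i} u)
          in z (T i) = predictor_seq f (\<lambda>s. u (T i - \<tau> + s)) (\<tau> / real n) (x (T i)) n)"

end

theory Submission
  imports Defs
begin

text \<open>With \<open>P t = x (t + \<tau>)\<close> the closed loop reads \<open>P' = f (P, k z)\<close>, \<open>z' = f (z, k z)\<close>, where each reset
  puts \<open>z\<close> back to \<open>P\<close> up to the error of the Euler predictor. That error is at most \<open>\<epsilon>\<close> times the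
  size of the current state if the number of steps is large enough for this size, because the
  states reachable from bounded data under bounded inputs in time \<open>\<tau>\<close> are bounded. The resets
  prevent errors from accumulating, however often they occur, so over a fixed time horizon \<open>P\<close>
  stays close to the nominal trajectory starting at the same point. The latter decays
  exponentially, uniformly on balls, hence the size of the state is halved over a suitable
  horizon. From a large state finitely many halvings lead to the unit ball, where the
  horizon is fixed and iterated halving is exponential decay. No Lyapunov function is needed.\<close>

section \<open>Integral equations\<close>

text \<open>The uniform bound on reachable states is the deepest ingredient. Completeness speaks
  about one input at a time, and weak compactness of the set of inputs is of no help, because
  \<open>f\<close> is nonlinear in the input. Unbounded reachable sets therefore have to be
  converted into one single input whose solution blows up.

  Accuracy of the predictor and boundedness of the state depend on each other: the number of steps
  is chosen for the current size, while this size is under control only if earlier predictions were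
  good. The circle is cut in two ways: all errors are measured relative to the size, which is
  possible because \<open>f (0, 0) = 0\<close>, and the estimates are claimed only as long as the
  trajectories stay close to each other and then themselves keep them close.

  The constants of a halving depend on its scale. Only those of the unit ball enter
  \<open>\<omega>\<close>, all others go into \<open>C\<close>; hence the rate does not depend on
  the initial state.\<close>

lemma sum_norm_increments_less:
  fixes F :: "real \<Rightarrow> 'a::euclidean_space"
  assumes ac: "\<forall>(n::nat) (p::nat \<Rightarrow> real) (q::nat \<Rightarrow> real).
        (\<forall>i<n. a \<le> p i \<and> p i \<le> q i \<and> q i \<le> b) \<and>
        disjoint_family_on (\<lambda>i. {p i<..<q i}) {..<n} \<and>
        (\<Sum>i<n. q i - p i) < \<delta> \<longrightarrow> (\<Sum>i<n. norm (F (q i) - F (p i))) < \<epsilon>"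
    and P: "P tagged_partial_division_of {a..b}"
    and sub: "\<And>x K. (x, K) \<in> P \<Longrightarrow> K \<subseteq> U" and U: "U \<in> lmeasurable" "measure lebesgue U < \<delta>"
  shows "(\<Sum>(x,K)\<in>P. norm (F (Sup K) - F (Inf K))) < \<epsilon>"
proof -
  \<comment> \<open>Intervals of length zero contribute nothing to the sum. Without them,
    disjointness of interiors already makes the intervals pairwise different, so that lengths can be
    added over the set of intervals.\<close>
  define Q where "Q = {(x, K) \<in> P. measure lborel K \<noteq> 0}"
  have finP: "finite P" using P by (auto simp: tagged_partial_division_of_def)
  have QP: "Q \<subseteq> P" by (auto simp: Q_def)
  have Kint: "\<exists>c d. K = {c..d} \<and> c \<le> d \<and> a \<le> c \<and> d \<le> b" if "(x, K) \<in> P" for x K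
  proof -
    have "x \<in> K" "K \<subseteq> {a..b}" "\<exists>c d. K = cbox c d"
      using P that by (auto simp: tagged_partial_division_of_def)
    then obtain c d where "K = {c..d}" by auto
    moreover have "c \<le> d" using \<open>x \<in> K\<close> calculation by auto
    ultimately show ?thesis using \<open>K \<subseteq> {a..b}\<close> by auto
  qed
  have Kint': "\<exists>c d. K = {c..d} \<and> c < d \<and> a \<le> c \<and> d \<le> b" if "(x, K) \<in> Q" for x K
  proof -
    obtain c d where cd: "K = {c..d}" "c \<le> d" "a \<le> c" "d \<le> b" 
      using Kint[OF subsetD[OF QP \<open>(x, K) \<in> Q\<close>]] by blast
    with that have "c < d" by (auto simp: Q_def)
    with cd show ?thesis by blast
  qed
  have disj: "{Inf K<..<Sup K} \<inter> {Inf K'<..<Sup K'} = {}"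
    if "(x, K) \<in> Q" "(x', K') \<in> Q" "(x, K) \<noteq> (x', K')" for x K x' K'
  proof -
    have "interior K \<inter> interior K' = {}"
      using P that QP unfolding tagged_partial_division_of_def by blast
    then show ?thesis using Kint'[OF that(1)] Kint'[OF that(2)] by auto
  qed
  have injQ: "inj_on snd Q"
  proof (rule inj_onI, rule ccontr)
    fix y y' assume y: "y \<in> Q" "y' \<in> Q" "snd y = snd y'" "y \<noteq> y'"
    obtain x K x' where yy: "y = (x, K)" "y' = (x', K)" using y(3) by (metis prod.collapse)
    have "{Inf K<..<Sup K} = {}" using disj[of x K x' K] y yy by auto
    moreover obtain c d where "K = {c..d}" "c < d" using Kint' y(1) yy by blast
    ultimately show False by auto
  qed
  have finQ: "finite Q" using finP QP finite_subset by blast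
  have "(\<Sum>(x,K)\<in>Q. measure lborel K) = sum (measure lborel) (snd ` Q)"
    by (subst sum.reindex[OF injQ]) (auto intro: sum.cong)
  also have "\<dots> = measure lebesgue (\<Union>(snd ` Q))"
  proof -
    have "Q tagged_partial_division_of {a..b}"
      using P QP tagged_partial_division_subset by blast
    then have "snd ` Q division_of \<Union>(snd ` Q)"
      by (rule partial_division_of_tagged_division)
    then have "sum (measure lebesgue) (snd ` Q) = measure lebesgue (\<Union>(snd ` Q))"
      using content_division[of "snd ` Q"] by simp
    moreover have "measure lborel K = measure lebesgue K" if "K \<in> snd ` Q" for K
      using that Kint' by (fastforce simp: measure_completion)
    then have "sum (measure lborel) (snd ` Q) = sum (measure lebesgue) (snd ` Q)"
      by (rule sum.cong[OF refl])
    ultimately show ?thesis by simp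
  qed
  also have "\<dots> \<le> measure lebesgue U"
  proof (rule measure_mono_fmeasurable)
    show "\<Union>(snd ` Q) \<subseteq> U" using sub QP by fastforce
    show "\<Union>(snd ` Q) \<in> sets lebesgue"
    proof (rule sets.finite_Union)
      show "finite (snd ` Q)" using finQ by simp
      show "snd ` Q \<subseteq> sets lebesgue" using Kint' by fastforce
    qed
  qed (use U in auto)
  finally have small: "(\<Sum>(x,K)\<in>Q. measure lborel K) < \<delta>" using U by simp
  obtain h where h: "bij_betw h {..<card Q} Q"
    using ex_bij_betw_nat_finite[OF finQ] by (auto simp: atLeast0LessThan)
  define p q where "p i = Inf (snd (h i))" and "q i = Sup (snd (h i))" for i
  have hQ: "h i \<in> Q" if "i < card Q" for i using h that by (auto simp: bij_betw_def)
  have "(\<Sum>i<card Q. norm (F (q i) - F (p i))) < \<epsilon>"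
  proof (rule ac[rule_format], intro conjI)
    show "\<forall>i<card Q. a \<le> p i \<and> p i \<le> q i \<and> q i \<le> b"
      using Kint'[of "fst (h i)" "snd (h i)" for i] hQ unfolding p_def q_def by fastforce
    show "disjoint_family_on (\<lambda>i. {p i<..<q i}) {..<card Q}"
      unfolding disjoint_family_on_def
    proof (intro ballI impI)
      fix m n assume mn: "m \<in> {..<card Q}" "n \<in> {..<card Q}" "m \<noteq> n"
      then have "h m \<noteq> h n" using h by (metis bij_betw_def inj_on_def)
      with mn hQ disj[of "fst (h m)" "snd (h m)" "fst (h n)" "snd (h n)"]
      show "{p m<..<q m} \<inter> {p n<..<q n} = {}" by (auto simp: p_def q_def)
    qed
    have "(\<Sum>i<card Q. q i - p i) = (\<Sum>y\<in>Q. Sup (snd y) - Inf (snd y))"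
      unfolding p_def q_def by (rule sum.reindex_bij_betw[OF h])
    also have "\<dots> = (\<Sum>(x,K)\<in>Q. measure lborel K)"
      by (rule sum.cong) (use Kint' in fastforce)+
    finally show "(\<Sum>i<card Q. q i - p i) < \<delta>" using small by simp
  qed
  also have "(\<Sum>i<card Q. norm (F (q i) - F (p i))) = (\<Sum>y\<in>Q. norm (F (Sup (snd y)) - F (Inf (snd y))))"
    unfolding p_def q_def by (rule sum.reindex_bij_betw[OF h])
  also have "\<dots> = (\<Sum>y\<in>P. norm (F (Sup (snd y)) - F (Inf (snd y))))"
  proof (rule sum.mono_neutral_left[OF finP QP], intro ballI)
    fix y assume y: "y \<in> P - Q"
    obtain x K where yy: "y = (x, K)" by (cases y)
    obtain c d where "K = {c..d}" "c \<le> d" using Kint y yy by blast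
    moreover have "measure lborel K = 0" using y yy by (auto simp: Q_def)
    ultimately have "K = {c..c}" by auto
    then show "norm (F (Sup (snd y)) - F (Inf (snd y))) = 0" by (simp add: yy)
  qed
  finally show ?thesis by (simp add: case_prod_unfold)
qed

text \<open>The gauge does all the work: at a point of differentiability it enforces the straddle
  estimate, at a tag in \<open>N\<close> it traps the interval in an open set so small that absolute
  continuity bounds the total increment there. Integrability of \<open>g\<close> thus comes as part
  of the result.\<close>

lemma has_integral_abs_continuous:
  fixes F :: "real \<Rightarrow> 'a::euclidean_space"
  assumes "a \<le> b" and ac: "abs_continuous_on_interval a b F" and N: "negligible N"
    and D: "\<And>x. x \<in> {a..b} - N \<Longrightarrow> (F has_vector_derivative g x) (at x within {a..b})"
  shows "(g has_integral (F b - F a)) {a..b}"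
proof -
  \<comment> \<open>Zero on \<open>N\<close>: tags there then contribute increments of
    \<open>F\<close> only.\<close>
  define g' where "g' x = (if x \<in> N then 0 else g x)" for x
  have "(g' has_integral (F b - F a)) {a..b}"
    unfolding has_integral_real
  proof (intro allI impI)
    fix e :: real assume e: "e > 0"
    \<comment> \<open>The two halves of \<open>e\<close> belong to the tags outside and inside
      \<open>N\<close>; adding 1 in the denominator keeps it positive for
      \<open>a = b\<close>.\<close>
    define e1 where "e1 = e / (2 * (b - a + 1))"
    have e1: "e1 > 0" "e1 * (b - a) < e/2" using e \<open>a \<le> b\<close> by (auto simp: e1_def field_simps)
    have "\<exists>d>0. x \<in> {a..b} - N \<longrightarrow>
         (\<forall>y\<in>{a..b}. norm (y-x) < d \<longrightarrow> norm (F y - F x - (y-x) *\<^sub>R g x) \<le> e1 * norm (y-x))" for x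
    proof (cases "x \<in> {a..b} - N")
      case True
      then show ?thesis
        using D[of x, unfolded has_vector_derivative_def has_derivative_within_alt] e1(1) by blast
    qed (auto intro: exI[of _ 1])
    then obtain d1 where d1: "\<And>x. d1 x > 0"
      "\<And>x y. x \<in> {a..b} - N \<Longrightarrow> y \<in> {a..b} \<Longrightarrow> norm (y-x) < d1 x \<Longrightarrow>
         norm (F y - F x - (y-x) *\<^sub>R g x) \<le> e1 * norm (y-x)"
      by metis
    obtain \<delta> where \<delta>: "\<delta> > 0" and acd: "\<forall>(n::nat) (p::nat \<Rightarrow> real) (q::nat \<Rightarrow> real).
        (\<forall>i<n. a \<le> p i \<and> p i \<le> q i \<and> q i \<le> b) \<and>
        disjoint_family_on (\<lambda>i. {p i<..<q i}) {..<n} \<and>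
        (\<Sum>i<n. q i - p i) < \<delta> \<longrightarrow> (\<Sum>i<n. norm (F (q i) - F (p i))) < e/2"
      using ac[unfolded abs_continuous_on_interval_def, THEN spec, THEN mp, OF half_gt_zero[OF e]]
      by (elim exE conjE)
    obtain U where U: "open U" "N \<subseteq> U" "U \<in> lmeasurable" "measure lebesgue U < \<delta>"
    proof -
      have "N \<in> lmeasurable" "measure lebesgue N = 0" using N negligible_iff_measure by auto
      then obtain U where "open U" "N \<subseteq> U" "U - N \<in> lmeasurable" "emeasure lebesgue (U - N) < ennreal \<delta>"
        using sets_lebesgue_outer_open[of N \<delta>] \<delta> by blast
      moreover have "U \<in> lmeasurable"
        using \<open>U - N \<in> lmeasurable\<close> \<open>N \<in> lmeasurable\<close> \<open>N \<subseteq> U\<close>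
        by (metis Diff_partition Un_commute fmeasurable.Un)
      moreover have "measure lebesgue U = measure lebesgue (U - N)"
        using measure_Diff_null_set[of U lebesgue N] N \<open>U \<in> lmeasurable\<close>
        by (simp add: negligible_iff_null_sets fmeasurableD)
      moreover have "measure lebesgue (U - N) < \<delta>"
        using \<open>emeasure lebesgue (U - N) < ennreal \<delta>\<close> \<open>U - N \<in> lmeasurable\<close> \<delta>
        by (simp add: emeasure_eq_measure2 ennreal_less_iff)
      ultimately show ?thesis using that by metis
    qed
    have "\<exists>d>0. x \<in> N \<longrightarrow> ball x d \<subseteq> U" for x
    proof (cases "x \<in> N")
      case True
      then show ?thesis using U(1,2) openE by (metis subsetD)
    qed (auto intro: exI[of _ 1])
    then obtain d2 where d2: "\<And>x. d2 x > 0" "\<And>x. x \<in> N \<Longrightarrow> ball x (d2 x) \<subseteq> U" by metis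
    define \<gamma> where "\<gamma> x = ball x (min (d1 x) (d2 x))" for x
    have "gauge \<gamma>" unfolding \<gamma>_def by (rule gauge_ball_dependent) (use d1 d2 in auto)
    moreover have "norm ((\<Sum>(x,k)\<in>p. measure lborel k *\<^sub>R g' x) - (F b - F a)) < e"
      if p: "p tagged_division_of {a..b}" and fine: "\<gamma> fine p" for p
    proof -
      define A where "A = {(x,k) \<in> p. x \<in> N}"
      have fin: "finite p" using p by auto
      have Ap: "A \<subseteq> p" by (auto simp: A_def)
      have tpd: "p tagged_partial_division_of {a..b}" using p by (simp add: tagged_division_of_def)
      have kint: "\<exists>c d. k = {c..d} \<and> c \<le> d \<and> a \<le> c \<and> d \<le> b \<and> c \<le> x \<and> x \<le> d" if "(x, k) \<in> p" for x k
      proof -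
        have "x \<in> k" "k \<subseteq> {a..b}" "\<exists>c d. k = cbox c d" using tpd that
          by (auto simp: tagged_partial_division_of_def)
        then obtain c d where k: "k = {c..d}" by auto
        then show ?thesis using \<open>x \<in> k\<close> \<open>k \<subseteq> {a..b}\<close> by auto
      qed
      have tele: "(\<Sum>(x,k)\<in>p. F (Sup k) - F (Inf k)) = F b - F a"
        using additive_tagged_division_1[OF \<open>a \<le> b\<close> p] .
      have "norm ((\<Sum>(x,k)\<in>p. measure lborel k *\<^sub>R g' x) - (F b - F a)) =
            norm (\<Sum>y\<in>p. measure lborel (snd y) *\<^sub>R g' (fst y) - (F (Sup (snd y)) - F (Inf (snd y))))"
        by (simp add: tele[symmetric] sum_subtractf case_prod_unfold)
      also have "\<dots> \<le> (\<Sum>y\<in>p. norm (measure lborel (snd y) *\<^sub>R g' (fst y) - (F (Sup (snd y)) - F (Inf (snd y)))))"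
        by (rule norm_sum)
      also have "\<dots> = (\<Sum>y\<in>p - A. norm (measure lborel (snd y) *\<^sub>R g' (fst y) - (F (Sup (snd y)) - F (Inf (snd y))))) +
          (\<Sum>y\<in>A. norm (measure lborel (snd y) *\<^sub>R g' (fst y) - (F (Sup (snd y)) - F (Inf (snd y)))))"
        by (rule sum.subset_diff[OF Ap fin])
      also have "(\<Sum>y\<in>A. norm (measure lborel (snd y) *\<^sub>R g' (fst y) - (F (Sup (snd y)) - F (Inf (snd y)))))
          = (\<Sum>(x,k)\<in>A. norm (F (Sup k) - F (Inf k)))"
        by (rule sum.cong) (auto simp: A_def g'_def norm_minus_commute)
      also have "\<dots> < e/2"
      proof (rule sum_norm_increments_less[where \<delta> = \<delta>, OF acd])
        show "A tagged_partial_division_of {a..b}" using tpd Ap tagged_partial_division_subset by blast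
        show "k \<subseteq> U" if "(x,k) \<in> A" for x k
        proof -
          have "k \<subseteq> \<gamma> x" using fine that Ap by (auto simp: fine_def)
          also have "\<dots> \<subseteq> ball x (d2 x)" by (auto simp: \<gamma>_def)
          also have "\<dots> \<subseteq> U" using d2 that by (auto simp: A_def)
          finally show ?thesis .
        qed
      qed (use U in auto)
      also have "(\<Sum>y\<in>p - A. norm (measure lborel (snd y) *\<^sub>R g' (fst y) - (F (Sup (snd y)) - F (Inf (snd y)))))
           \<le> (\<Sum>y\<in>p - A. e1 * measure lborel (snd y))"
      proof (rule sum_mono)
        fix y assume y: "y \<in> p - A"
        obtain x k where yy: "y = (x, k)" by (cases y)
        have xN: "x \<notin> N" "(x, k) \<in> p" using y yy by (auto simp: A_def)
        obtain c d where k: "k = {c..d}" "c \<le> d" "a \<le> c" "d \<le> b" "c \<le> x" "x \<le> d"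
          using kint[OF xN(2)] by blast
        have "k \<subseteq> \<gamma> x" using fine xN by (auto simp: fine_def)
        then have "c \<in> \<gamma> x" "d \<in> \<gamma> x" using k by auto
        then have dd: "norm (c - x) < d1 x" "norm (d - x) < d1 x" by (auto simp: \<gamma>_def dist_real_def)
        have x: "x \<in> {a..b} - N" using xN k by auto
        have 1: "norm (F c - F x - (c - x) *\<^sub>R g x) \<le> e1 * (x - c)"
          using d1(2)[OF x _ dd(1)] k by auto
        have 2: "norm (F d - F x - (d - x) *\<^sub>R g x) \<le> e1 * (d - x)"
          using d1(2)[OF x _ dd(2)] k by auto
        have "measure lborel k *\<^sub>R g' x - (F (Sup k) - F (Inf k)) =
            (F c - F x - (c - x) *\<^sub>R g x) - (F d - F x - (d - x) *\<^sub>R g x)"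
          using k xN by (simp add: g'_def algebra_simps)
        also have "norm \<dots> \<le> e1 * (x - c) + e1 * (d - x)"
          by (rule order_trans[OF norm_triangle_ineq4 add_mono[OF 1 2]])
        also have "\<dots> = e1 * measure lborel k" using k by (simp add: algebra_simps)
        finally show "norm (measure lborel (snd y) *\<^sub>R g' (fst y) - (F (Sup (snd y)) - F (Inf (snd y)))) \<le> e1 * measure lborel (snd y)"
          by (simp add: yy)
      qed
      also have "\<dots> \<le> (\<Sum>y\<in>p. e1 * measure lborel (snd y))"
        by (rule sum_mono2) (use fin e1 in auto)
      also have "\<dots> = e1 * (b - a)"
      proof -
        have "(\<Sum>(x,k)\<in>p. measure lborel k) = b - a"
          using additive_content_tagged_division[of p a b] p \<open>a \<le> b\<close> by simp
        then show ?thesis by (simp add: sum_distrib_left[symmetric] case_prod_unfold)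
      qed
      finally show ?thesis using e1 by simp
    qed
    ultimately show "\<exists>\<gamma>. gauge \<gamma> \<and> (\<forall>\<D>. \<D> tagged_division_of {a..b} \<and> \<gamma> fine \<D> \<longrightarrow>
       norm ((\<Sum>(x,k)\<in>\<D>. measure lborel k *\<^sub>R g' x) - (F b - F a)) < e)"
      by (intro exI[of _ \<gamma>] conjI allI impI) (assumption, elim conjE)
  qed
  then show ?thesis
    using has_integral_spike[OF N, of "{a..b}" g g'] by (simp add: g'_def)
qed

text \<open>A common format for \<open>x\<close>, absolutely continuous with a measurable input, for
  \<open>z\<close> between two samples, and for nominal trajectories. It passes to subintervals and
  shifts, and it survives time reversal and changes of the right-hand side at a single time.\<close>

definition integral_solution ::
  "(real \<Rightarrow> 'a::euclidean_space \<Rightarrow> 'a) \<Rightarrow> (real \<Rightarrow> 'a) \<Rightarrow> real \<Rightarrow> real \<Rightarrow> bool" where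
  "integral_solution F x a b \<longleftrightarrow>
     (\<forall>t\<in>{a..b}. ((\<lambda>s. F s (x s)) has_integral (x t - x a)) {a..t})"

lemma integral_solution_has_integral:
  assumes "integral_solution F x a b" "a \<le> c" "c \<le> d" "d \<le> b"
  shows "((\<lambda>s. F s (x s)) has_integral (x d - x c)) {c..d}"
proof -
  have 1: "((\<lambda>s. F s (x s)) has_integral (x c - x a)) {a..c}"
    and 2: "((\<lambda>s. F s (x s)) has_integral (x d - x a)) {a..d}"
    using assms by (auto simp: integral_solution_def)
  have "(\<lambda>s. F s (x s)) integrable_on {c..d}"
    using has_integral_integrable[OF 2] by (rule integrable_subinterval_real) (use assms in auto)
  then have 3: "((\<lambda>s. F s (x s)) has_integral (integral {c..d} (\<lambda>s. F s (x s)))) {c..d}"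
    by (rule integrable_integral)
  have "((\<lambda>s. F s (x s)) has_integral (x c - x a + integral {c..d} (\<lambda>s. F s (x s)))) {a..d}"
    by (rule has_integral_combine[OF _ _ 1 3]) (use assms in auto)
  then have "x d - x a = x c - x a + integral {c..d} (\<lambda>s. F s (x s))"
    using 2 has_integral_unique by blast
  then show ?thesis using 3 by (simp add: algebra_simps)
qed

lemma integral_solution_subinterval:
  assumes "integral_solution F x a b" "a \<le> c" "d \<le> b"
  shows "integral_solution F x c d"
  using integral_solution_has_integral[OF assms(1)] assms(2,3) by (auto simp: integral_solution_def)

lemma integral_solution_continuous_on:
  assumes "integral_solution F x a b"
  shows "continuous_on {a..b} x"
proof (cases "a \<le> b")
  case True
  have *: "(\<lambda>s. F s (x s)) integrable_on {a..b}"
    using integral_solution_has_integral[OF assms order_refl True order_refl] by blast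
  have "continuous_on {a..b} (\<lambda>t. x a + integral {a..t} (\<lambda>s. F s (x s)))"
    by (intro continuous_intros indefinite_integral_continuous_1 *)
  moreover have "x a + integral {a..t} (\<lambda>s. F s (x s)) = x t" if "t \<in> {a..b}" for t
    using integral_solution_has_integral[OF assms, of a t] that by (simp add: integral_unique)
  ultimately show ?thesis using continuous_on_eq by fastforce
qed auto

text \<open>The strict \<open>t < b\<close> matters: at a sampling time the input already belongs to
  the next reset, and a single time is a null set.\<close>

lemma integral_solution_cong:
  assumes "integral_solution F x a b"
    and "\<And>t. a \<le> t \<Longrightarrow> t < b \<Longrightarrow> F t (x t) = G t (y t)" "\<And>t. a \<le> t \<Longrightarrow> t \<le> b \<Longrightarrow> x t = y t"
  shows "integral_solution G y a b"
  unfolding integral_solution_def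
proof
  fix t assume t: "t \<in> {a..b}"
  have "((\<lambda>s. F s (x s)) has_integral (x t - x a)) {a..t}"
    using assms(1) t by (auto simp: integral_solution_def)
  moreover have "x t - x a = y t - y a" using assms(3) t by auto
  ultimately show "((\<lambda>s. G s (y s)) has_integral (y t - y a)) {a..t}"
    using has_integral_spike[of "{t}" "{a..t}" "\<lambda>s. G s (y s)" "\<lambda>s. F s (x s)"] assms(2) t by auto
qed

lemma integral_solution_shift:
  "integral_solution F x (a + c) (b + c) \<longleftrightarrow>
   integral_solution (\<lambda>t. F (t + c)) (\<lambda>t. x (t + c)) a b"
proof -
  have *: "((\<lambda>s. F (s + c) (x (s + c))) has_integral I) {a..t} \<longleftrightarrow>
      ((\<lambda>s. F s (x s)) has_integral I) {a + c..t + c}" for t I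
    using has_integral_shift_Icc_real[of "\<lambda>s. F s (x s)" c I a t]
    by (simp add: o_def add.commute)
  have "(\<forall>t\<in>{a + c..b + c}. Q t) \<longleftrightarrow> (\<forall>t\<in>{a..b}. Q (t + c))" for Q
  proof safe
    fix t assume "\<forall>t\<in>{a..b}. Q (t + c)" "t \<in> {a + c..b + c}"
    then have "Q ((t - c) + c)" by (intro bspec[of "{a..b}" "\<lambda>t. Q (t + c)"]) auto
    then show "Q t" by simp
  qed auto
  then show ?thesis by (simp add: integral_solution_def *)
qed

lemma integral_solution_derivative:
  assumes "\<And>t. t \<in> {a..b} \<Longrightarrow> (x has_vector_derivative F t (x t)) (at t within {a..b})"
  shows "integral_solution F x a b"
  unfolding integral_solution_def
proof
  fix t assume t: "t \<in> {a..b}"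
  show "((\<lambda>s. F s (x s)) has_integral (x t - x a)) {a..t}"
  proof (rule fundamental_theorem_of_calculus)
    show "(x has_vector_derivative F s (x s)) (at s within {a..t})" if "s \<in> {a..t}" for s
      using assms[of s] that t by (auto intro: has_vector_derivative_within_subset)
  qed (use t in auto)
qed

lemma caratheodory_integral_solution:
  assumes "caratheodory_solution F x" "0 \<le> a"
  shows "integral_solution F x a b"
proof -
  obtain N where N: "negligible N"
    and D: "\<And>t. 0 \<le> t \<Longrightarrow> t \<notin> N \<Longrightarrow> (x has_vector_derivative F t (x t)) (at t within {0..})"
  proof -
    have "AE t in lebesgue. t \<in> {0..} \<longrightarrow> (x has_vector_derivative F t (x t)) (at t within {0..})"
      using assms(1) by (auto simp: caratheodory_solution_def AE_restrict_space_iff)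
    then obtain N where "N \<in> null_sets lebesgue"
      "{t. \<not> (t \<in> {0..} \<longrightarrow> (x has_vector_derivative F t (x t)) (at t within {0..}))} \<subseteq> N"
      by (auto simp: eventually_ae_filter)
    then show ?thesis using that[of N] by (auto simp: negligible_iff_null_sets)
  qed
  have "integral_solution F x 0 b"
    unfolding integral_solution_def
  proof
    fix t assume "t \<in> {0..b}"
    then show "((\<lambda>s. F s (x s)) has_integral (x t - x 0)) {0..t}"
      using assms(1) N D
      by (intro has_integral_abs_continuous[where N = N])
         (auto simp: caratheodory_solution_def intro!: has_vector_derivative_within_subset[OF D])
  qed
  then show ?thesis using integral_solution_subinterval assms(2) by blast
qed

section \<open>Gronwall estimates and bootstrapping\<close>

lemma gronwall_integral:
  fixes g :: "real \<Rightarrow> real"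
  assumes cont: "continuous_on {a..b} g" and "L \<ge> 0"
    and le: "\<And>t. t \<in> {a..b} \<Longrightarrow> g t \<le> A + L * integral {a..t} g" and t: "t \<in> {a..b}"
  shows "g t \<le> A * exp (L * (t - a))"
proof -
  \<comment> \<open>Integrating factor: the derivative of \<open>G\<close> is a nonnegative multiple
    of \<open>g s - (A + L * integral {a..s} g)\<close>, hence nonpositive by assumption.\<close>
  define G where "G s = (A + L * integral {a..s} g) * exp (- L * (s - a))" for s
  have "G t \<le> G a"
  proof (rule DERIV_nonpos_imp_decreasing_open[of a t G])
    show "a \<le> t" using t by simp
    show "continuous_on {a..t} G" unfolding G_def
      by (intro continuous_intros indefinite_integral_continuous_1 integrable_continuous_real
            continuous_on_subset[OF cont]) (use t in auto)
    fix s assume s: "a < s" "s < t"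
    have "((\<lambda>s. integral {a..s} g) has_real_derivative g s) (at s within {a..b})"
      by (rule integral_has_real_derivative[OF cont]) (use s t in auto)
    moreover have "at s within {a..b} = at s" by (rule at_within_interior) (use s t in auto)
    ultimately have "((\<lambda>s. integral {a..s} g) has_real_derivative g s) (at s)" by simp
    then have "(G has_real_derivative
        (L * g s) * exp (- L * (s - a)) + (A + L * integral {a..s} g) * (exp (- L * (s - a)) * (- L))) (at s)"
      unfolding G_def by (auto intro!: derivative_eq_intros)
    moreover have "(L * g s) * exp (- L * (s - a)) + (A + L * integral {a..s} g) * (exp (- L * (s - a)) * (- L))
       = (L * exp (- L * (s - a))) * (g s - (A + L * integral {a..s} g))" by (simp add: algebra_simps)
    moreover have "\<dots> \<le> 0" using le[of s] s t \<open>L \<ge> 0\<close>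
      by (intro mult_nonneg_nonpos) auto
    ultimately show "\<exists>y. DERIV G s :> y \<and> y \<le> 0" by metis
  qed
  also have "G a = A" by (simp add: G_def)
  finally have "(A + L * integral {a..t} g) * exp (- L * (t - a)) * exp (L * (t - a)) \<le> A * exp (L * (t - a))"
    by (intro mult_right_mono) (auto simp: G_def)
  then have "(A + L * integral {a..t} g) \<le> A * exp (L * (t - a))"
    by (simp add: mult.assoc flip: exp_add)
  with le[OF t] show ?thesis by simp
qed

text \<open>The level set of \<open>\<kappa>\<close> is compact, so it has a first point, and by the
  intermediate value theorem the level cannot be exceeded before it. This serves to close bootstrap
  arguments and to stop trajectories at their first contact with a sphere.\<close>

lemma continuous_first_hit:
  fixes w :: "real \<Rightarrow> real"
  assumes cont: "continuous_on {a..b} w" and "a \<le> b" "w a \<le> \<kappa>" "\<kappa> \<le> w b"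
  obtains r where "r \<in> {a..b}" "w r = \<kappa>" "\<And>s. s \<in> {a..r} \<Longrightarrow> w s \<le> \<kappa>"
proof -
  define Z where "Z = {r \<in> {a..b}. w r = \<kappa>}"
  have "Z \<noteq> {}" using IVT'[of w a \<kappa> b] assms by (auto simp: Z_def)
  moreover have "closed Z" unfolding Z_def
    using continuous_closed_preimage_constant[OF cont] by auto
  moreover have "bounded Z" by (rule bounded_subset[of "{a..b}"]) (auto simp: Z_def)
  ultimately obtain r where r: "r \<in> Z" "\<And>s. s \<in> Z \<Longrightarrow> r \<le> s"
    using compact_attains_inf[of Z] by (auto simp: compact_eq_bounded_closed)
  show ?thesis
  proof (rule that)
    show "r \<in> {a..b}" "w r = \<kappa>" using r by (auto simp: Z_def)
    fix s assume s: "s \<in> {a..r}"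
    show "w s \<le> \<kappa>"
    proof (rule ccontr)
      assume "\<not> w s \<le> \<kappa>"
      then obtain r' where "a \<le> r'" "r' \<le> s" "w r' = \<kappa>"
        using IVT'[of w a \<kappa> s] assms s r(1) continuous_on_subset[OF cont, of "{a..s}"]
        by (auto simp: Z_def)
      moreover have "r' \<noteq> s" using \<open>\<not> w s \<le> \<kappa>\<close> calculation by auto
      moreover have "r' \<in> Z" using calculation s r(1) by (auto simp: Z_def)
      ultimately show False using r(2)[of r'] s by auto
    qed
  qed
qed

lemma integral_solution_diff_le:
  fixes x y :: "real \<Rightarrow> 'a::euclidean_space"
  assumes x: "integral_solution F x a b" and y: "integral_solution G y a b"
    and "L \<ge> 0" "c \<ge> 0"
    and lip: "\<And>s. s \<in> {a..b} \<Longrightarrow> norm (F s (x s) - G s (y s)) \<le> L * norm (x s - y s) + c"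
    and t: "t \<in> {a..b}"
  shows "norm (x t - y t) \<le> (norm (x a - y a) + c * (b - a)) * exp (L * (t - a))"
proof -
  have cont: "continuous_on {a..b} (\<lambda>s. norm (x s - y s))"
    using integral_solution_continuous_on[OF x] integral_solution_continuous_on[OF y]
    by (intro continuous_intros)
  show ?thesis
  proof (rule gronwall_integral[OF cont \<open>L \<ge> 0\<close> _ t])
    fix s assume s: "s \<in> {a..b}"
    have intg: "(\<lambda>s. norm (x s - y s)) integrable_on {a..s}"
      by (intro integrable_continuous_real continuous_on_subset[OF cont]) (use s in auto)
    have hi: "((\<lambda>s. F s (x s) - G s (y s)) has_integral ((x s - x a) - (y s - y a))) {a..s}"
      using x y s by (intro has_integral_diff) (auto simp: integral_solution_def)
    have "norm ((x s - x a) - (y s - y a)) = norm (integral {a..s} (\<lambda>s. F s (x s) - G s (y s)))"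
      using hi by (simp add: integral_unique)
    also have "\<dots> \<le> integral {a..s} (\<lambda>s. L * norm (x s - y s) + c)"
    proof (rule integral_norm_bound_integral)
      show "(\<lambda>s. L * norm (x s - y s) + c) integrable_on {a..s}"
        by (intro integrable_add integrable_on_mult_right intg) auto
    qed (use hi lip s in auto)
    also have "\<dots> = L * integral {a..s} (\<lambda>s. norm (x s - y s)) + c * (s - a)"
      using intg s by (subst integral_add) (auto intro: integrable_on_mult_right simp: mult.commute)
    also have "\<dots> \<le> L * integral {a..s} (\<lambda>s. norm (x s - y s)) + c * (b - a)"
      using s \<open>c \<ge> 0\<close> by (intro add_left_mono mult_left_mono) auto
    finally have "norm ((x s - x a) - (y s - y a)) \<le> L * integral {a..s} (\<lambda>s. norm (x s - y s)) + c * (b - a)" .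
    moreover have "norm (x s - y s) \<le> norm (x a - y a) + norm ((x s - x a) - (y s - y a))"
      using norm_triangle_ineq[of "x a - y a" "(x s - x a) - (y s - y a)"] by (simp add: algebra_simps)
    ultimately show "norm (x s - y s) \<le> norm (x a - y a) + c * (b - a) + L * integral {a..s} (\<lambda>s. norm (x s - y s))"
      by simp
  qed
qed

text \<open>The Lipschitz estimate is only demanded as long as the solutions stay \<open>\<kappa>\<close>-close up to
  the time in question; the estimate itself then keeps them \<open>\<kappa>\<close>-close.\<close>

lemma integral_solution_diff_less:
  fixes x y :: "real \<Rightarrow> 'a::euclidean_space"
  assumes x: "integral_solution F x a b" and y: "integral_solution G y a b"
    and "L \<ge> 0" "c \<ge> 0"
    and lip: "\<And>s. s \<in> {a..b} \<Longrightarrow> (\<And>r. r \<in> {a..s} \<Longrightarrow> norm (x r - y r) \<le> \<kappa>) \<Longrightarrow>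
      norm (F s (x s) - G s (y s)) \<le> L * norm (x s - y s) + c"
    and small: "norm (x a - y a) \<le> \<eta>" "(\<eta> + c * (b - a)) * exp (L * (b - a)) < \<kappa>"
    and t: "t \<in> {a..b}"
  shows "norm (x t - y t) \<le> (\<eta> + c * (b - a)) * exp (L * (b - a))" "norm (x t - y t) < \<kappa>"
proof -
  define w where "w s = norm (x s - y s)" for s
  define m where "m = (\<eta> + c * (b - a)) * exp (L * (b - a))"
  have m: "m < \<kappa>" using small by (simp add: m_def)
  have ab: "a \<le> b" using t by simp
  have \<eta>: "\<eta> \<ge> 0" using small(1) norm_ge_zero order_trans by blast
  have cont: "continuous_on {a..b} w" unfolding w_def
    using integral_solution_continuous_on[OF x] integral_solution_continuous_on[OF y]
    by (intro continuous_intros)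
  have step: "w t \<le> m" if t: "t \<in> {a..b}" and le: "\<And>r. r \<in> {a..t} \<Longrightarrow> w r \<le> \<kappa>" for t
  proof -
    have "w t \<le> (norm (x a - y a) + c * (t - a)) * exp (L * (t - a))"
      unfolding w_def
    proof (rule integral_solution_diff_le[OF _ _ \<open>L \<ge> 0\<close> \<open>c \<ge> 0\<close>])
      show "integral_solution F x a t" "integral_solution G y a t"
        using t integral_solution_subinterval[OF x] integral_solution_subinterval[OF y] by auto
    qed (use t lip le in \<open>auto simp: w_def\<close>)
    also have "\<dots> \<le> m" unfolding m_def
      using t small \<open>L \<ge> 0\<close> \<open>c \<ge> 0\<close> \<eta>
      by (intro mult_mono add_mono) (auto intro!: mult_left_mono add_nonneg_nonneg mult_nonneg_nonneg)
    finally show ?thesis .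
  qed
  \<comment> \<open>At a first contact with the level \<open>\<kappa>\<close> the estimate would
    still be available and give at most \<open>m\<close>, which is below
    \<open>\<kappa>\<close>.\<close>
  have lt: "w s < \<kappa>" if s: "s \<in> {a..b}" for s
  proof (rule ccontr)
    assume "\<not> w s < \<kappa>"
    moreover have wa: "w a \<le> m"
    proof -
      have "\<eta> * 1 \<le> (\<eta> + c * (b - a)) * exp (L * (b - a))"
        using \<eta> ab \<open>L \<ge> 0\<close> \<open>c \<ge> 0\<close> by (intro mult_mono) auto
      then show ?thesis using small by (simp add: w_def m_def)
    qed
    ultimately obtain r where r: "r \<in> {a..s}" "w r = \<kappa>" "\<And>r'. r' \<in> {a..r} \<Longrightarrow> w r' \<le> \<kappa>"
      using continuous_first_hit[of a s w \<kappa>] m s continuous_on_subset[OF cont, of "{a..s}"] by auto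
    then have "w r \<le> m" using step[of r] s by auto
    with m r(2) show False by simp
  qed
  show "norm (x t - y t) < \<kappa>" using lt[OF t] by (simp add: w_def)
  have "w t \<le> m"
  proof (rule step[OF t])
    fix r assume "r \<in> {a..t}"
    then show "w r \<le> \<kappa>" using lt[of r] t by auto
  qed
  then show "norm (x t - y t) \<le> (\<eta> + c * (b - a)) * exp (L * (b - a))" by (simp add: w_def m_def)
qed

section \<open>Lipschitz bounds, time reversal and open maps\<close>

lemma continuously_differentiable_lipschitz:
  fixes g :: "'a::euclidean_space \<Rightarrow> 'b::euclidean_space"
  assumes "continuously_differentiable g"
  obtains L where "L \<ge> 0"
    "\<And>p q. norm p \<le> \<rho> \<Longrightarrow> norm q \<le> \<rho> \<Longrightarrow> norm (g p - g q) \<le> L * norm (p - q)"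
proof -
  obtain g' :: "'a \<Rightarrow> 'a \<Rightarrow>\<^sub>L 'b" where
    d: "\<And>p. (g has_derivative blinfun_apply (g' p)) (at p)" and c: "continuous_on UNIV g'"
    using assms by (auto simp: continuously_differentiable_def)
  have "compact (g' ` cball 0 \<rho>)"
    by (intro compact_continuous_image continuous_on_subset[OF c]) auto
  then obtain B where B: "B > 0" "\<And>p. p \<in> cball 0 \<rho> \<Longrightarrow> norm (g' p) \<le> B"
    using compact_imp_bounded bounded_pos by (metis imageI)
  show ?thesis
  proof (rule that[of B])
    fix p q :: 'a assume pq: "norm p \<le> \<rho>" "norm q \<le> \<rho>"
    show "norm (g p - g q) \<le> B * norm (p - q)"
    proof (rule differentiable_bound[where S = "cball 0 \<rho>" and f' = "\<lambda>p. blinfun_apply (g' p)"])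
      show "onorm (blinfun_apply (g' p)) \<le> B" if "p \<in> cball 0 \<rho>" for p
        using B that by (metis norm_blinfun.rep_eq)
    qed (use pq d in \<open>auto intro: has_derivative_at_withinI\<close>)
  qed (use B in auto)
qed

lemma continuously_differentiable_continuous_on:
  assumes "continuously_differentiable g"
  shows "continuous_on S g"
  using assms by (auto simp: continuously_differentiable_def intro!: continuous_at_imp_continuous_on
      dest: has_derivative_continuous)

lemma integral_solution_bounded:
  assumes "integral_solution F x a b"
  obtains \<rho> where "\<And>t. t \<in> {a..b} \<Longrightarrow> norm (x t) \<le> \<rho>"
proof -
  have "compact (x ` {a..b})"
    using integral_solution_continuous_on[OF assms] by (intro compact_continuous_image) auto
  then obtain \<rho> where "\<And>y. y \<in> x ` {a..b} \<Longrightarrow> norm y \<le> \<rho>"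
    using compact_imp_bounded bounded_iff by metis
  then show ?thesis using that by blast
qed

text \<open>Turns forward estimates into backward ones: Gronwall for the reversed equation bounds
  the distance of initial points by that of end points, which makes flow maps injective with a lower
  Lipschitz bound.\<close>

lemma integral_solution_reverse:
  assumes "integral_solution F x 0 a"
  shows "integral_solution (\<lambda>s y. - F (a - s) y) (\<lambda>s. x (a - s)) 0 a"
  unfolding integral_solution_def
proof
  fix t assume t: "t \<in> {0..a}"
  have "((\<lambda>s. F s (x s)) has_integral (x a - x (a - t))) {a - t..a}"
    using integral_solution_has_integral[OF assms, of "a - t" a] t by auto
  then have "((\<lambda>s. F (-s) (x (-s))) has_integral (x a - x (a - t))) {-a..- (a - t)}"
    by (subst has_integral_reflect_real[symmetric]) simp
  then have "((\<lambda>s. F (-s) (x (-s))) has_integral (x a - x (a - t))) {0 + - a..t + - a}" by simp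
  then have "((\<lambda>s. F (a - s) (x (a - s))) has_integral (x a - x (a - t))) {0..t}"
    by (subst (asm) has_integral_shift_Icc_real[symmetric]) (simp add: o_def)
  from has_integral_neg[OF this]
  show "((\<lambda>s. - F (a - s) (x (a - s))) has_integral (x (a - t) - x (a - 0))) {0..t}" by simp
qed

text \<open>Quantitative invariance of domain. If the ball of radius \<open>r\<close> were not
  covered, connectedness would provide a frontier point of the image inside it; such a point stems
  from the sphere of radius \<open>\<epsilon>\<close>, whose image stays at distance at least
  \<open>r\<close>. The radius depends on the expansion alone, so one radius serves a whole family
  of maps.\<close>

lemma ball_subset_image:
  fixes \<Phi> :: "'a::euclidean_space \<Rightarrow> 'a"
  assumes cont: "continuous_on (cball p \<epsilon>) \<Phi>" and inj: "inj_on \<Phi> (cball p \<epsilon>)" and "0 < \<epsilon>"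
    and expand: "\<And>q. dist p q = \<epsilon> \<Longrightarrow> r \<le> dist (\<Phi> p) (\<Phi> q)"
  shows "ball (\<Phi> p) r \<subseteq> \<Phi> ` ball p \<epsilon>"
proof (rule ccontr)
  assume not: "\<not> ball (\<Phi> p) r \<subseteq> \<Phi> ` ball p \<epsilon>"
  have op: "open (\<Phi> ` ball p \<epsilon>)"
    by (rule invariance_of_domain) (auto intro: continuous_on_subset[OF cont] inj_on_subset[OF inj])
  have cl: "closed (\<Phi> ` cball p \<epsilon>)"
    by (intro compact_imp_closed compact_continuous_image cont) auto
  have "ball (\<Phi> p) r \<inter> frontier (\<Phi> ` ball p \<epsilon>) \<noteq> {}"
  proof (rule connected_Int_frontier)
    have "r > 0" using not by (rule_tac ccontr) (simp add: not_less ball_empty)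
    then show "ball (\<Phi> p) r \<inter> \<Phi> ` ball p \<epsilon> \<noteq> {}"
      using \<open>\<epsilon> > 0\<close> by (metis IntI centre_in_ball empty_iff imageI)
  qed (use not in auto)
  then obtain y where y: "dist (\<Phi> p) y < r" "y \<in> frontier (\<Phi> ` ball p \<epsilon>)" by auto
  have "frontier (\<Phi> ` ball p \<epsilon>) \<subseteq> \<Phi> ` cball p \<epsilon> - \<Phi> ` ball p \<epsilon>"
    using op closure_minimal[OF image_mono[OF ball_subset_cball] cl]
    by (auto simp: frontier_def interior_open)
  then obtain q where "y = \<Phi> q" "q \<in> cball p \<epsilon>" "q \<notin> ball p \<epsilon>" using y(2) by blast
  then show False using expand[of q] y(1) by auto
qed

text \<open>Defined on the whole line and bounded everywhere instead of almost everywhere, so that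
  shifting and splicing preserve the class with the same bound and pointwise suprema of an input
  history can be used for \<open>S\<close>.\<close>

definition bounded_inputs :: "real \<Rightarrow> (real \<Rightarrow> 'b::euclidean_space) set" where
  "bounded_inputs S = {u \<in> borel_measurable lebesgue. \<forall>t. norm (u t) \<le> S}"

lemma borel_measurable_lebesgue_shift:
  fixes u :: "real \<Rightarrow> 'b::euclidean_space"
  assumes "u \<in> borel_measurable lebesgue"
  shows "(\<lambda>s. u (s + a)) \<in> borel_measurable lebesgue"
proof -
  have "(\<lambda>s. a + s) \<in> lebesgue \<rightarrow>\<^sub>M (lebesgue :: real measure)"
    using lebesgue_affine_measurable[of "\<lambda>_. 1" a] by simp
  from measurable_compose[OF this assms] show ?thesis by (simp add: add.commute)
qed

lemma bounded_inputs_shift: "u \<in> bounded_inputs S \<Longrightarrow> (\<lambda>s. u (s + a)) \<in> bounded_inputs S"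
  by (simp add: bounded_inputs_def borel_measurable_lebesgue_shift)

lemma bounded_inputs_switch:
  assumes "u \<in> bounded_inputs S" "v \<in> bounded_inputs S"
  shows "(\<lambda>s. if s < a then u s else v (s - a)) \<in> bounded_inputs S"
proof -
  have "v \<in> bounded_inputs S \<Longrightarrow> (\<lambda>s. v (s - a)) \<in> borel_measurable lebesgue"
    using bounded_inputs_shift[of v S "-a"] by (auto simp: bounded_inputs_def)
  then have "(\<lambda>s. if s \<in> {..<a} then u s else v (s - a)) \<in> borel_measurable lebesgue"
    using assms by (intro measurable_If_set) (auto simp: bounded_inputs_def)
  then show ?thesis using assms by (auto simp: bounded_inputs_def)
qed

section \<open>Boundedness of reachable sets\<close>

locale control_system =
  fixes f :: "'a::euclidean_space \<times> 'b::euclidean_space \<Rightarrow> 'a"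
  assumes f_C1: "continuously_differentiable f"
    and f_zero: "f (0, 0) = 0"
    and complete: "forward_complete f"
begin

lemma f_lipschitz:
  obtains L where "L \<ge> 0"
    "\<And>x y u v. norm x \<le> \<rho> \<Longrightarrow> norm y \<le> \<rho> \<Longrightarrow> norm u \<le> \<rho> \<Longrightarrow> norm v \<le> \<rho> \<Longrightarrow>
       norm (f (x, u) - f (y, v)) \<le> L * (norm (x - y) + norm (u - v))"
proof -
  obtain L where L: "L \<ge> 0"
    "\<And>p q. norm p \<le> 2 * \<rho> \<Longrightarrow> norm q \<le> 2 * \<rho> \<Longrightarrow> norm (f p - f q) \<le> L * norm (p - q)"
    using continuously_differentiable_lipschitz[OF f_C1] by blast
  show ?thesis
  proof (rule that[OF L(1)])
    fix x y :: 'a and u v :: 'b assume le: "norm x \<le> \<rho>" "norm y \<le> \<rho>" "norm u \<le> \<rho>" "norm v \<le> \<rho>"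
    have "norm (f (x, u) - f (y, v)) \<le> L * norm ((x, u) - (y, v))"
      using le by (intro L(2)) (smt (verit) norm_Pair_le)+
    also have "\<dots> \<le> L * (norm (x - y) + norm (u - v))"
      using L(1) norm_Pair_le[of "x - y" "u - v"] by (intro mult_left_mono) auto
    finally show "norm (f (x, u) - f (y, v)) \<le> L * (norm (x - y) + norm (u - v))" .
  qed
qed

section \<open>Uniqueness and flow maps\<close>

lemma integral_solution_unique:
  assumes x: "integral_solution (\<lambda>t y. f (y, u t)) x a b"
    and y: "integral_solution (\<lambda>t y. f (y, v t)) y a b"
    and uv: "\<And>t. a \<le> t \<Longrightarrow> t < b \<Longrightarrow> u t = v t" "\<And>t. a \<le> t \<Longrightarrow> t < b \<Longrightarrow> norm (v t) \<le> S"
    and "x a = y a" and t: "t \<in> {a..b}"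
  shows "x t = y t"
proof -
  \<comment> \<open>Agreement and bounds are only known before \<open>b\<close>; \<open>w\<close> is
    a version bounded on the closed interval.\<close>
  define w where "w t = (if t < b then v t else 0)" for t
  have x': "integral_solution (\<lambda>t y. f (y, w t)) x a b"
    by (rule integral_solution_cong[OF x]) (auto simp: w_def uv)
  have y': "integral_solution (\<lambda>t y. f (y, w t)) y a b"
    by (rule integral_solution_cong[OF y]) (auto simp: w_def uv)
  obtain \<rho>1 where 1: "\<And>t. t \<in> {a..b} \<Longrightarrow> norm (x t) \<le> \<rho>1" using integral_solution_bounded[OF x] by blast
  obtain \<rho>2 where 2: "\<And>t. t \<in> {a..b} \<Longrightarrow> norm (y t) \<le> \<rho>2" using integral_solution_bounded[OF y] by blast
  define \<rho> where "\<rho> = \<bar>\<rho>1\<bar> + \<bar>\<rho>2\<bar> + \<bar>S\<bar>"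
  obtain L where L: "L \<ge> 0" "\<And>x y u v. norm x \<le> \<rho> \<Longrightarrow> norm y \<le> \<rho> \<Longrightarrow> norm u \<le> \<rho> \<Longrightarrow> norm v \<le> \<rho> \<Longrightarrow>
       norm (f (x, u) - f (y, v)) \<le> L * (norm (x - y) + norm (u - v))" using f_lipschitz by blast
  have "norm (x t - y t) \<le> (norm (x a - y a) + 0 * (b - a)) * exp (L * (t - a))"
  proof (rule integral_solution_diff_le[OF x' y' \<open>L \<ge> 0\<close> order_refl _ t])
    fix s assume s: "s \<in> {a..b}"
    have "norm (w s) \<le> \<bar>S\<bar>" using uv(2)[of s] s by (auto simp: w_def)
    then show "norm (f (x s, w s) - f (y s, w s)) \<le> L * norm (x s - y s) + 0"
      using L(2)[of "x s" "y s" "w s" "w s"] 1[OF s] 2[OF s] by (auto simp: \<rho>_def)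
  qed
  then show ?thesis using \<open>x a = y a\<close> by simp
qed

text \<open>For bounded inputs completeness provides a candidate, and at times
  \<open>t \<ge> 0\<close> uniqueness makes the choice immaterial. At negative times the values are
  arbitrary.\<close>

definition flow :: "(real \<Rightarrow> 'b) \<Rightarrow> 'a \<Rightarrow> real \<Rightarrow> 'a" where
  "flow u p = (SOME x. caratheodory_solution (\<lambda>t y. f (y, u t)) x \<and> x 0 = p)"

lemma
  assumes "u \<in> bounded_inputs S"
  shows flow_caratheodory: "caratheodory_solution (\<lambda>t y. f (y, u t)) (flow u p)"
    and flow_0 [simp]: "flow u p 0 = p"
proof -
  have "u \<in> borel_measurable (lebesgue_on {0..})" "locally_ess_bounded u"
    using assms by (auto simp: bounded_inputs_def locally_ess_bounded_def intro!: measurable_restrict_space1 exI[of _ S])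
  then have "\<exists>x. caratheodory_solution (\<lambda>t y. f (y, u t)) x \<and> x 0 = p"
    using complete by (auto simp: forward_complete_def)
  then have "caratheodory_solution (\<lambda>t y. f (y, u t)) (flow u p) \<and> flow u p 0 = p"
    unfolding flow_def by (rule someI_ex)
  then show "caratheodory_solution (\<lambda>t y. f (y, u t)) (flow u p)" "flow u p 0 = p" by auto
qed

lemma flow_integral_solution:
  assumes "u \<in> bounded_inputs S" "0 \<le> a"
  shows "integral_solution (\<lambda>t y. f (y, u t)) (flow u p) a b"
  using caratheodory_integral_solution[OF flow_caratheodory[OF assms(1)] assms(2)] .

lemma flow_eqI:
  assumes u: "u \<in> bounded_inputs S" and x: "integral_solution (\<lambda>t y. f (y, v t)) x 0 a"
    and "\<And>t. 0 \<le> t \<Longrightarrow> t < a \<Longrightarrow> v t = u t" "t \<in> {0..a}" "x 0 = p"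
  shows "flow u p t = x t"
proof (rule sym, rule integral_solution_unique[OF x flow_integral_solution[OF u order_refl], of S])
  show "norm (u t) \<le> S" for t using u by (auto simp: bounded_inputs_def)
qed (use assms flow_0[OF u] in auto)

lemma flow_cong:
  assumes "u \<in> bounded_inputs S" "v \<in> bounded_inputs S" "\<And>t. 0 \<le> t \<Longrightarrow> t < a \<Longrightarrow> u t = v t" "t \<in> {0..a}"
  shows "flow u p t = flow v p t"
  by (rule flow_eqI[OF assms(1) flow_integral_solution[OF assms(2)]]) (use assms flow_0[OF assms(2)] in auto)

lemma flow_shift:
  assumes u: "u \<in> bounded_inputs S" and "0 \<le> a" "0 \<le> t"
  shows "flow u p (t + a) = flow (\<lambda>s. u (s + a)) (flow u p a) t"
proof -
  have "integral_solution (\<lambda>t y. f (y, u t)) (flow u p) (0 + a) (t + a)"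
    using flow_integral_solution[OF u] \<open>0 \<le> a\<close> by simp
  then have "integral_solution (\<lambda>t y. f (y, u (t + a))) (\<lambda>t. flow u p (t + a)) 0 t"
    by (simp only: integral_solution_shift)
  from flow_eqI[OF bounded_inputs_shift[OF u] this] show ?thesis using assms by simp
qed

lemma flow_bounded:
  assumes "u \<in> bounded_inputs S"
  obtains \<rho> where "\<And>t. t \<in> {0..a} \<Longrightarrow> norm (flow u p t) \<le> \<rho>"
  using integral_solution_bounded[OF flow_integral_solution[OF assms order_refl]] by blast

lemma flow_continuous_on:
  assumes "u \<in> bounded_inputs S"
  shows "continuous_on {0..a} (flow u p)"
  using integral_solution_continuous_on[OF flow_integral_solution[OF assms order_refl]] .

text \<open>Both estimates share a constant that depends on the input only through its bound. The
  first assumes a bound on just one of the two trajectories: staying within distance 1 of it, the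
  other remains in the ball of radius \<open>\<rho> + 1\<close>. The second is the backward estimate
  obtained by time reversal and supplies the expansion used with
  \<open>ball_subset_image\<close>.\<close>

lemma flow_lipschitz:
  obtains \<Lambda> where "\<Lambda> > 0"
    "\<And>u a p q s. u \<in> bounded_inputs S \<Longrightarrow> a \<le> T \<Longrightarrow> s \<in> {0..a} \<Longrightarrow>
       (\<And>r. r \<in> {0..a} \<Longrightarrow> norm (flow u p r) \<le> \<rho>) \<Longrightarrow> norm (q - p) * \<Lambda> < 1 \<Longrightarrow>
       norm (flow u q s - flow u p s) \<le> \<Lambda> * norm (q - p)"
    "\<And>u a p q. u \<in> bounded_inputs S \<Longrightarrow> 0 \<le> a \<Longrightarrow> a \<le> T \<Longrightarrow>
       (\<And>r. r \<in> {0..a} \<Longrightarrow> norm (flow u p r) \<le> \<rho>) \<Longrightarrow>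
       (\<And>r. r \<in> {0..a} \<Longrightarrow> norm (flow u q r) \<le> \<rho> + 1) \<Longrightarrow>
       norm (q - p) \<le> \<Lambda> * norm (flow u q a - flow u p a)"
proof -
  define \<rho>' where "\<rho>' = \<bar>\<rho>\<bar> + 1 + \<bar>S\<bar>"
  obtain L where L: "L \<ge> 0" "\<And>x y u v. norm x \<le> \<rho>' \<Longrightarrow> norm y \<le> \<rho>' \<Longrightarrow> norm u \<le> \<rho>' \<Longrightarrow> norm v \<le> \<rho>' \<Longrightarrow>
       norm (f (x, u) - f (y, v)) \<le> L * (norm (x - y) + norm (u - v))" using f_lipschitz by blast
  have lip: "norm (f (x, u t) - f (y, u t)) \<le> L * norm (x - y)"
    if "u \<in> bounded_inputs S" "norm x \<le> \<rho> + 1" "norm y \<le> \<rho> + 1" for x y t and u :: "real \<Rightarrow> 'b"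
  proof -
    have "norm (u t) \<le> S" using that by (auto simp: bounded_inputs_def)
    then show ?thesis using L(2)[of x y "u t" "u t"] that by (auto simp: \<rho>'_def)
  qed
  have mono: "exp (L * a) \<le> exp (L * T)" if "a \<le> T" for a using that L(1) by (auto intro: mult_left_mono)
  show ?thesis
  proof (rule that[of "exp (L * T)"])
    fix u :: "real \<Rightarrow> 'b" and a p q s
    assume u: "u \<in> bounded_inputs S" and a: "a \<le> T" "s \<in> {0..a}"
      and b: "\<And>r. r \<in> {0..a} \<Longrightarrow> norm (flow u p r) \<le> \<rho>" and close: "norm (q - p) * exp (L * T) < 1"
    have "norm (flow u q s - flow u p s) \<le> (norm (q - p) + 0 * (a - 0)) * exp (L * (a - 0))"
    proof (rule integral_solution_diff_less[OF flow_integral_solution flow_integral_solution \<open>L \<ge> 0\<close> order_refl, OF u order_refl u order_refl, where \<kappa> = 1])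
      fix t assume t: "t \<in> {0..a}" and c: "\<And>r. r \<in> {0..t} \<Longrightarrow> norm (flow u q r - flow u p r) \<le> 1"
      have "norm (flow u q t) \<le> \<rho> + 1" using c[of t] b[OF t] t norm_triangle_sub[of "flow u q t" "flow u p t"] by auto
      then show "norm (f (flow u q t, u t) - f (flow u p t, u t)) \<le> L * norm (flow u q t - flow u p t) + 0"
        using lip[OF u] b[OF t] by auto
    next
      have "norm (q - p) * exp (L * a) \<le> norm (q - p) * exp (L * T)"
        using mono[OF a(1)] by (intro mult_left_mono) auto
      then show "(norm (q - p) + 0 * (a - 0)) * exp (L * (a - 0)) < 1" using close by simp
    qed (use flow_0[OF u] a in auto)
    also have "\<dots> \<le> exp (L * T) * norm (q - p)"
      using mono[OF a(1)] by (simp add: mult.commute mult_left_mono)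
    finally show "norm (flow u q s - flow u p s) \<le> exp (L * T) * norm (q - p)" .
  next
    fix u :: "real \<Rightarrow> 'b" and a p q
    assume u: "u \<in> bounded_inputs S" and a: "0 \<le> a" "a \<le> T"
      and b: "\<And>r. r \<in> {0..a} \<Longrightarrow> norm (flow u p r) \<le> \<rho>" "\<And>r. r \<in> {0..a} \<Longrightarrow> norm (flow u q r) \<le> \<rho> + 1"
    have "norm (flow u q (a - a) - flow u p (a - a)) \<le>
       (norm (flow u q (a - 0) - flow u p (a - 0)) + 0 * (a - 0)) * exp (L * (a - 0))"
    proof (rule integral_solution_diff_le[where x = "\<lambda>s. flow u q (a - s)" and y = "\<lambda>s. flow u p (a - s)",
            OF integral_solution_reverse integral_solution_reverse \<open>L \<ge> 0\<close> order_refl])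
      show "integral_solution (\<lambda>t y. f (y, u t)) (flow u q) 0 a" 
        "integral_solution (\<lambda>t y. f (y, u t)) (flow u p) 0 a"
        using flow_integral_solution[OF u] by auto
      fix s assume "s \<in> {0..a}"
      then have s: "a - s \<in> {0..a}" by auto
      show "norm (- f (flow u q (a - s), u (a - s)) - - f (flow u p (a - s), u (a - s)))
           \<le> L * norm (flow u q (a - s) - flow u p (a - s)) + 0"
        using lip[OF u, of "flow u q (a - s)" "flow u p (a - s)" "a - s"] b(1)[OF s] b(2)[OF s]
        by (simp add: norm_minus_commute)
    qed (use a in auto)
    then have "norm (q - p) \<le> exp (L * a) * norm (flow u q a - flow u p a)"
      by (simp add: flow_0[OF u] mult.commute)
    also have "\<dots> \<le> exp (L * T) * norm (flow u q a - flow u p a)"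
      using mono[OF a(2)] by (intro mult_right_mono) auto
    finally show "norm (q - p) \<le> exp (L * T) * norm (flow u q a - flow u p a)" .
  qed auto
qed

lemma flow_inj:
  assumes u: "u \<in> bounded_inputs S" and "0 \<le> a"
  shows "inj (\<lambda>p. flow u p a)"
proof (rule injI)
  fix p q assume eq: "flow u p a = flow u q a"
  obtain \<rho>1 where 1: "\<And>t. t \<in> {0..a} \<Longrightarrow> norm (flow u p t) \<le> \<rho>1" using flow_bounded[OF u] by blast
  obtain \<rho>2 where 2: "\<And>t. t \<in> {0..a} \<Longrightarrow> norm (flow u q t) \<le> \<rho>2" using flow_bounded[OF u] by blast
  show "p = q"
  proof (rule flow_lipschitz[of S a "\<bar>\<rho>1\<bar> + \<bar>\<rho>2\<bar>"])
    fix \<Lambda> assume "\<Lambda> > 0" and \<Lambda>: "\<And>u b p q. u \<in> bounded_inputs S \<Longrightarrow> 0 \<le> b \<Longrightarrow> b \<le> a \<Longrightarrow>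
       (\<And>r. r \<in> {0..b} \<Longrightarrow> norm (flow u p r) \<le> \<bar>\<rho>1\<bar> + \<bar>\<rho>2\<bar>) \<Longrightarrow>
       (\<And>r. r \<in> {0..b} \<Longrightarrow> norm (flow u q r) \<le> \<bar>\<rho>1\<bar> + \<bar>\<rho>2\<bar> + 1) \<Longrightarrow>
       norm (q - p) \<le> \<Lambda> * norm (flow u q b - flow u p b)"
    have "norm (q - p) \<le> \<Lambda> * norm (flow u q a - flow u p a)"
      using 1 2 by (intro \<Lambda>[OF u \<open>0 \<le> a\<close>]) fastforce+
    then show "p = q" using eq by simp
  qed
qed

lemma flow_near:
  assumes u: "u \<in> bounded_inputs S" and "e > 0"
  obtains d where "d > 0"
    "\<And>q s. norm (q - p) < d \<Longrightarrow> s \<in> {0..a} \<Longrightarrow> norm (flow u q s - flow u p s) < e"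
proof -
  obtain \<rho> where 1: "\<And>t. t \<in> {0..a} \<Longrightarrow> norm (flow u p t) \<le> \<rho>" using flow_bounded[OF u] by blast
  obtain \<Lambda> where \<Lambda>: "\<Lambda> > 0"
    "\<And>q s. s \<in> {0..a} \<Longrightarrow> norm (q - p) * \<Lambda> < 1 \<Longrightarrow>
       norm (flow u q s - flow u p s) \<le> \<Lambda> * norm (q - p)"
    using flow_lipschitz[of S a \<rho>] 1 u by (metis order_refl)
  show ?thesis
  proof (rule that[of "min 1 e / \<Lambda>"])
    fix q s assume q: "norm (q - p) < min 1 e / \<Lambda>" and s: "s \<in> {0..a}"
    have "norm (q - p) * \<Lambda> < min 1 e" using q \<Lambda>(1) by (simp add: field_simps)
    then show "norm (flow u q s - flow u p s) < e" using \<Lambda>(2)[OF s, of q] by (simp add: mult.commute)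
  qed (use \<Lambda> \<open>e > 0\<close> in auto)
qed

lemma flow_continuous_initial:
  assumes u: "u \<in> bounded_inputs S" and "0 \<le> a"
  shows "continuous_on A (\<lambda>p. flow u p a)"
proof (rule continuous_on_subset[OF _ subset_UNIV], rule continuous_at_imp_continuous_on, intro ballI)
  fix p show "isCont (\<lambda>p. flow u p a) p"
    unfolding continuous_at_eps_delta
  proof (intro allI impI)
    fix e :: real assume "e > 0"
    then obtain d where "d > 0"
      "\<And>q s. norm (q - p) < d \<Longrightarrow> s \<in> {0..a} \<Longrightarrow> norm (flow u q s - flow u p s) < e"
      using flow_near[OF u] by blast
    then show "\<exists>d>0. \<forall>q. dist q p < d \<longrightarrow> dist (flow u q a) (flow u p a) < e"
      using \<open>0 \<le> a\<close> by (auto simp: dist_norm)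
  qed
qed

section \<open>Unbounded reachable sets and blow-up\<close>

definition escapes :: "real \<Rightarrow> 'a \<Rightarrow> real \<Rightarrow> bool" where
  "escapes S p t \<longleftrightarrow> (\<forall>\<rho>. \<exists>u\<in>bounded_inputs S. \<exists>s\<in>{0..t}. norm (flow u p s) > \<rho>)"

lemma escapes_mono: "escapes S p t \<Longrightarrow> t \<le> t' \<Longrightarrow> escapes S p t'"
  unfolding escapes_def by (meson atLeastatMost_subset_iff order_refl subsetD)

lemma escapes_nonneg: "escapes S p t \<Longrightarrow> 0 \<le> t"
  by (fastforce simp: escapes_def)

text \<open>\<open>escapes\<close> allows a different input for every bound, so it does not
  contradict completeness at once. It is a closed property of the starting point: if the reachable
  set of \<open>q\<close> were bounded by \<open>\<rho>\<close>, that of all sufficiently close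
  points would be bounded by \<open>\<rho> + 1\<close>, since the Lipschitz estimate is uniform in
  the input.\<close>

lemma escapes_limit:
  assumes near: "\<And>\<delta> \<rho>. \<delta> > 0 \<Longrightarrow> \<exists>p u s. norm (p - q) < \<delta> \<and> u \<in> bounded_inputs S \<and> s \<in> {0..t} \<and> norm (flow u p s) > \<rho>"
  shows "escapes S q t"
  unfolding escapes_def
proof (intro allI, rule ccontr)
  fix \<rho> assume "\<not> (\<exists>u\<in>bounded_inputs S. \<exists>s\<in>{0..t}. \<rho> < norm (flow u q s))"
  then have bd: "norm (flow u q s) \<le> \<rho>" if "u \<in> bounded_inputs S" "s \<in> {0..t}" for u s
    using that by force
  obtain \<Lambda> where \<Lambda>: "\<Lambda> > 0"
    "\<And>u p s. u \<in> bounded_inputs S \<Longrightarrow> s \<in> {0..t} \<Longrightarrow> norm (p - q) * \<Lambda> < 1 \<Longrightarrow>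
       norm (flow u p s - flow u q s) \<le> \<Lambda> * norm (p - q)"
    using flow_lipschitz[of S t \<rho>] bd by (metis order_refl)
  obtain p u s where pus: "norm (p - q) < 1 / \<Lambda>" "u \<in> bounded_inputs S" "s \<in> {0..t}" "norm (flow u p s) > \<rho> + 1"
    using near[of "1 / \<Lambda>" "\<rho> + 1"] \<Lambda>(1) by auto
  have "norm (p - q) * \<Lambda> < 1" using pus(1) \<Lambda>(1) by (simp add: field_simps)
  then have "norm (flow u p s - flow u q s) < 1" using \<Lambda>(2)[OF pus(2,3), of p] by (simp add: mult.commute)
  moreover have "norm (flow u p s) \<le> norm (flow u q s) + norm (flow u p s - flow u q s)"
    by (rule norm_triangle_sub)
  ultimately show False using pus(4) bd[OF pus(2,3)] by simp
qed

text \<open>A limit point \<open>q\<close> of crossings of the sphere of radius \<open>R\<close> is in general not reachable from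
  \<open>p\<close> itself. Since the flow maps are open, uniformly in the input as long as
  trajectories stay in a fixed ball, \<open>q\<close> is reachable from points close to \<open>p\<close>.\<close>

lemma escapes_step:
  assumes esc: "escapes S p t" and R: "norm p < R" and "\<epsilon> > 0" "\<eta> > 0"
  obtains u a p' where "u \<in> bounded_inputs S" "a \<in> {0..t}" "norm (p' - p) < \<epsilon>"
    "norm (flow u p' a) = R" "escapes S (flow u p' a) (t - a + \<eta>)"
proof -
  have "\<forall>n::nat. \<exists>u s. u \<in> bounded_inputs S \<and> s \<in> {0..t} \<and> norm (flow u p s) > R + real n"
    using esc by (meson escapes_def)
  then obtain u s where us: "\<And>n::nat. u n \<in> bounded_inputs S" "\<And>n. s n \<in> {0..t}"
    "\<And>n. norm (flow (u n) p (s n)) > R + real n" by metis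
  \<comment> \<open>Stopping at the first contact with the sphere keeps the trajectories in the ball
    of radius \<open>R\<close>, for which one constant \<open>\<Lambda>\<close> is valid for all
    \<open>n\<close>.\<close>
  have "\<exists>a. a \<in> {0..s n} \<and> norm (flow (u n) p a) = R \<and> (\<forall>r\<in>{0..a}. norm (flow (u n) p r) \<le> R)" for n
  proof -
    have "continuous_on {0..s n} (\<lambda>r. norm (flow (u n) p r))"
      by (intro continuous_on_norm flow_continuous_on[OF us(1)])
    then obtain a where "a \<in> {0..s n}" "norm (flow (u n) p a) = R"
      "\<And>r. r \<in> {0..a} \<Longrightarrow> norm (flow (u n) p r) \<le> R"
      by (rule continuous_first_hit[where \<kappa> = R])
         (use us(2)[of n] us(3)[of n] R flow_0[OF us(1)[of n]] in auto)
    then show ?thesis by blast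
  qed
  then obtain a where a: "\<And>n. a n \<in> {0..s n}" "\<And>n. norm (flow (u n) p (a n)) = R"
    "\<And>n r. r \<in> {0..a n} \<Longrightarrow> norm (flow (u n) p r) \<le> R" by metis
  define q where "q n = flow (u n) p (a n)" for n
  have "compact (sphere 0 R \<times> {0..t} :: ('a \<times> real) set)" by (intro compact_Times compact_sphere compact_Icc)
  moreover have "(q n, a n) \<in> sphere 0 R \<times> {0..t}" for n
    using a(1)[of n] a(2)[of n] us(2)[of n] by (auto simp: q_def)
  ultimately obtain l \<sigma> where \<sigma>: "strict_mono (\<sigma> :: nat \<Rightarrow> nat)" "((\<lambda>n. (q n, a n)) \<circ> \<sigma>) \<longlonglongrightarrow> l" and l: "l \<in> sphere 0 R \<times> {0..t}"
    unfolding compact_def by meson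
  obtain q0 a0 where l0: "l = (q0, a0)" by (cases l)
  have limq: "(\<lambda>n. q (\<sigma> n)) \<longlonglongrightarrow> q0" and lima: "(\<lambda>n. a (\<sigma> n)) \<longlonglongrightarrow> a0"
    using tendsto_fst[OF \<sigma>(2)] tendsto_snd[OF \<sigma>(2)] by (auto simp: l0 o_def)
  have evq: "\<forall>\<^sub>F n in sequentially. norm (q (\<sigma> n) - q0) < \<delta>" if "\<delta> > 0" for \<delta>
    using tendstoD[OF limq that] by (simp add: dist_norm)
  have eva: "\<forall>\<^sub>F n in sequentially. \<bar>a (\<sigma> n) - a0\<bar> < \<eta> / 2"
    using tendstoD[OF lima, of "\<eta> / 2"] \<open>\<eta> > 0\<close> by (simp add: dist_real_def)
  \<comment> \<open>The rest of the \<open>n\<close>-th trajectory starts near \<open>q0\<close> and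
    still becomes large. One half of \<open>\<eta>\<close> pays for the difference between
    \<open>a n\<close> and its limit \<open>a0\<close>, the other half for replacing
    \<open>a0\<close> by \<open>b\<close> below.\<close>
  have esc0: "escapes S q0 (t - a0 + \<eta> / 2)"
  proof (rule escapes_limit)
    fix \<delta> \<rho> :: real assume "\<delta> > 0"
    have "\<forall>\<^sub>F n in sequentially. \<rho> - R \<le> real (\<sigma> n)"
      using filterlim_compose[OF filterlim_real_sequentially filterlim_subseq[OF \<sigma>(1)]]
      by (auto simp: filterlim_at_top)
    then have "\<forall>\<^sub>F n in sequentially. norm (q (\<sigma> n) - q0) < \<delta> \<and> \<bar>a (\<sigma> n) - a0\<bar> < \<eta> / 2 \<and> \<rho> - R \<le> real (\<sigma> n)"
      using evq[OF \<open>\<delta> > 0\<close>] eva by eventually_elim auto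
    then obtain n where n: "norm (q (\<sigma> n) - q0) < \<delta>" "\<bar>a (\<sigma> n) - a0\<bar> < \<eta> / 2" "\<rho> - R \<le> real (\<sigma> n)"
      by (auto dest: eventually_happens)
    define m where "m = \<sigma> n"
    have "flow (u m) p (s m) = flow (\<lambda>r. u m (r + a m)) (q m) (s m - a m)"
      using flow_shift[OF us(1)[of m], of "a m" "s m - a m" p] a(1)[of m] by (simp add: q_def)
    then have "norm (flow (\<lambda>r. u m (r + a m)) (q m) (s m - a m)) > \<rho>"
      using us(3)[of m] n(3) by (simp add: m_def)
    moreover have "a0 - a m \<le> \<eta> / 2" using n(2) unfolding m_def by linarith
    then have "s m - a m \<in> {0..t - a0 + \<eta> / 2}"
      using a(1)[of m] us(2)[of m] by auto
    ultimately show "\<exists>p u s. norm (p - q0) < \<delta> \<and> u \<in> bounded_inputs S \<and> s \<in> {0..t - a0 + \<eta> / 2} \<and> norm (flow u p s) > \<rho>"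
      using n(1) bounded_inputs_shift[OF us(1)] unfolding m_def by blast
  qed
  show thesis
  proof (rule flow_lipschitz[of S t R])
    fix \<Lambda> assume "\<Lambda> > 0" and fwd: "\<And>u a p q s. u \<in> bounded_inputs S \<Longrightarrow> a \<le> t \<Longrightarrow> s \<in> {0..a} \<Longrightarrow>
       (\<And>r. r \<in> {0..a} \<Longrightarrow> norm (flow u p r) \<le> R) \<Longrightarrow> norm (q - p) * \<Lambda> < 1 \<Longrightarrow>
       norm (flow u q s - flow u p s) \<le> \<Lambda> * norm (q - p)"
      and bwd: "\<And>u a p q. u \<in> bounded_inputs S \<Longrightarrow> 0 \<le> a \<Longrightarrow> a \<le> t \<Longrightarrow>
       (\<And>r. r \<in> {0..a} \<Longrightarrow> norm (flow u p r) \<le> R) \<Longrightarrow>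
       (\<And>r. r \<in> {0..a} \<Longrightarrow> norm (flow u q r) \<le> R + 1) \<Longrightarrow>
       norm (q - p) \<le> \<Lambda> * norm (flow u q a - flow u p a)"
    \<comment> \<open>Points at distance \<open>e\<close> from \<open>p\<close> have trajectories
      within 1 of the given one, where the expansion estimate applies; so the image of the
      \<open>e\<close>-ball contains a ball of radius \<open>e / \<Lambda>\<close>, for every
      \<open>n\<close>. For large \<open>n\<close> this ball contains \<open>q0\<close>.\<close>
    define e where "e = min \<epsilon> (1 / (2 * \<Lambda>))"
    have e: "e > 0" "e \<le> \<epsilon>" "e * \<Lambda> < 1"
      using \<open>\<epsilon> > 0\<close> \<open>\<Lambda> > 0\<close> by (auto simp: e_def min_def field_simps)
    obtain n where n: "norm (q (\<sigma> n) - q0) < e / \<Lambda>" "\<bar>a (\<sigma> n) - a0\<bar> < \<eta> / 2"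
      using eventually_happens'[OF sequentially_bot eventually_conj[OF evq[OF divide_pos_pos[OF e(1) \<open>\<Lambda> > 0\<close>]] eva]]
      by blast
    define v b where "v = u (\<sigma> n)" and "b = a (\<sigma> n)"
    have v: "v \<in> bounded_inputs S" using us by (simp add: v_def)
    have b: "0 \<le> b" "b \<le> t" "\<And>r. r \<in> {0..b} \<Longrightarrow> norm (flow v p r) \<le> R"
      using a(1)[of "\<sigma> n"] a(3)[of _ "\<sigma> n"] us(2)[of "\<sigma> n"] by (simp_all add: v_def b_def)
    have "ball (flow v p b) (e / \<Lambda>) \<subseteq> (\<lambda>p. flow v p b) ` ball p e"
    proof (rule ball_subset_image[OF flow_continuous_initial[OF v b(1)] inj_on_subset[OF flow_inj[OF v b(1)]] e(1)])
      fix p' assume p': "dist p p' = e"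
      have close: "norm (p' - p) * \<Lambda> < 1" using p' e by (simp add: dist_norm norm_minus_commute)
      have "norm (flow v p' r) \<le> R + 1" if "r \<in> {0..b}" for r
        using fwd[OF v b(2) that b(3) close] close b(3)[OF that] norm_triangle_sub[of "flow v p' r" "flow v p r"]
        by (simp add: mult.commute)
      then have "norm (p' - p) \<le> \<Lambda> * norm (flow v p' b - flow v p b)"
        using bwd[OF v b(1,2) b(3)] by blast
      then show "e / \<Lambda> \<le> dist (flow v p b) (flow v p' b)"
        using p' \<open>\<Lambda> > 0\<close> by (simp add: dist_norm norm_minus_commute field_simps)
    qed auto
    moreover have "q0 \<in> ball (flow v p b) (e / \<Lambda>)" using n(1) by (simp add: dist_norm q_def v_def b_def)
    ultimately obtain p' where p': "dist p p' < e" "q0 = flow v p' b" by auto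
    show thesis
    proof (rule that[OF v, of b p'])
      show "norm (p' - p) < \<epsilon>" using p' e by (simp add: dist_norm norm_minus_commute)
      show "norm (flow v p' b) = R" using l p'(2) by (simp add: l0)
      show "escapes S (flow v p' b) (t - b + \<eta>)"
      proof -
        have "t - a0 + \<eta> / 2 \<le> t - b + \<eta>" using n(2) unfolding b_def by linarith
        then show ?thesis using escapes_mono[OF esc0] p'(2) by simp
      qed
    qed (use b in auto)
  qed
qed

text \<open>Blow-up in finite time is produced by prolonging an input along larger and larger spheres,
  each time moving the initial point slightly; the initial points converge.\<close>

lemma not_escapes: "\<not> escapes S p t"
proof
  assume esc: "escapes S p t"
  define K where "K = norm p"
  \<comment> \<open>Stage \<open>j\<close> has an input leading to the sphere of radius
    \<open>K + j\<close> at time \<open>T\<close>, with escape possible in the remaining time. The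
    budget \<open>t + 1 - (1/2) ^ j\<close> starts at \<open>t\<close> and grows by the slack
    \<open>(1/2) ^ Suc j\<close> of each application of \<open>escapes_step\<close>, so all times
    stay below \<open>t + 1\<close>.\<close>
  define P where "P j = (\<lambda>(T, u, p'). u \<in> bounded_inputs S \<and> 0 \<le> T \<and> norm (flow u p' T) = K + real j \<and>
     escapes S (flow u p' T) (t + 1 - (1/2) ^ j - T))" for j :: nat
  \<comment> \<open>The input is only prolonged, and the change of the starting point is felt by
    less than \<open>(1/2) ^ j\<close> on the whole interval covered so far; this makes starting
    points and trajectories converge.\<close>
  define Q where "Q j = (\<lambda>(T, u, p') (T', u', p''). T \<le> T' \<and> (\<forall>s<T. u' s = u s) \<and>
     (\<forall>s\<in>{0..T}. norm (flow u p'' s - flow u p' s) < (1/2) ^ j))"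
    for j :: nat
  have "\<exists>X. \<forall>n. P n (X n) \<and> Q n (X n) (X (Suc n))"
  proof (rule dependent_nat_choice)
    obtain u :: "real \<Rightarrow> 'b" where u: "u \<in> bounded_inputs S" using esc[unfolded escapes_def, THEN spec, of 0] by blast
    then have "P 0 (0, u, p)" using esc by (simp add: P_def K_def flow_0[OF u])
    then show "\<exists>x. P 0 x" by blast
  next
    fix x and j :: nat assume Px: "P j x"
    obtain T u p' where x: "x = (T, u, p')" by (cases x)
    have u: "u \<in> bounded_inputs S" and T: "0 \<le> T" and nrm: "norm (flow u p' T) = K + real j"
      and e: "escapes S (flow u p' T) (t + 1 - (1/2) ^ j - T)"
      using Px by (auto simp: P_def x)
    obtain d where d: "d > 0"
      "\<And>q s. norm (q - p') < d \<Longrightarrow> s \<in> {0..T} \<Longrightarrow> norm (flow u q s - flow u p' s) < (1/2) ^ j"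
      using flow_near[OF u, of "(1/2) ^ j"] by auto
    \<comment> \<open>\<open>escapes_step\<close> moves its starting point, which here is the end of
      the old trajectory. Openness of the flow map lets the moved point be reached from a starting
      point near \<open>p'\<close> along the old input.\<close>
    have "open ((\<lambda>p. flow u p T) ` ball p' d)"
      by (rule invariance_of_domain[OF flow_continuous_initial[OF u T] open_ball inj_on_subset[OF flow_inj[OF u T]]]) auto
    moreover have "flow u p' T \<in> (\<lambda>p. flow u p T) ` ball p' d" using d(1) by auto
    ultimately obtain \<epsilon> where \<epsilon>: "\<epsilon> > 0" "ball (flow u p' T) \<epsilon> \<subseteq> (\<lambda>p. flow u p T) ` ball p' d"
      by (meson openE)
    obtain v a q where v: "v \<in> bounded_inputs S" and a: "a \<in> {0..t + 1 - (1/2) ^ j - T}"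
      and q: "norm (q - flow u p' T) < \<epsilon>" "norm (flow v q a) = K + real (Suc j)"
      and e': "escapes S (flow v q a) (t + 1 - (1/2) ^ j - T - a + (1/2) ^ Suc j)"
      by (rule escapes_step[OF e, of "K + real (Suc j)" \<epsilon> "(1/2) ^ Suc j"]) (use nrm \<epsilon> in auto)
    have "q \<in> ball (flow u p' T) \<epsilon>" using q(1) by (simp add: dist_norm norm_minus_commute)
    then obtain p'' where p'': "q = flow u p'' T" "norm (p'' - p') < d"
      using \<epsilon>(2) by (auto simp: dist_norm norm_minus_commute)
    define w where "w s = (if s < T then u s else v (s - T))" for s
    have w: "w \<in> bounded_inputs S" using bounded_inputs_switch[OF u v] by (simp add: w_def[abs_def])
    have "flow w p'' T = q"
      using flow_cong[OF w u, of T T p''] T p''(1) by (simp add: w_def)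
    moreover have "flow w p'' (a + T) = flow (\<lambda>s. w (s + T)) (flow w p'' T) a"
      using flow_shift[OF w T] a by auto
    moreover have "flow (\<lambda>s. w (s + T)) q a = flow v q a"
      using a by (intro flow_cong[OF bounded_inputs_shift[OF w] v, of a]) (auto simp: w_def)
    ultimately have fw: "flow w p'' (T + a) = flow v q a" by (simp add: add.commute)
    have "P (Suc j) (T + a, w, p'')"
      using w T a q(2) e' by (simp add: P_def fw algebra_simps)
    moreover have "Q j x (T + a, w, p'')"
      using a d(2)[OF p''(2)] by (auto simp: Q_def x w_def)
    ultimately show "\<exists>y. P (Suc j) y \<and> Q j x y" by blast
  qed
  then obtain X where X: "\<And>n. P n (X n)" "\<And>n. Q n (X n) (X (Suc n))" by blast
  define T where "T n = fst (X n)" for n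
  define u where "u n = fst (snd (X n))" for n
  define x where "x n = snd (snd (X n))" for n
  have XX: "X n = (T n, u n, x n)" for n by (simp add: T_def u_def x_def)
  have u: "u n \<in> bounded_inputs S" and T: "0 \<le> T n" "T n \<le> t + 1"
    and nrm: "norm (flow (u n) (x n) (T n)) = K + real n" for n
  proof -
    have *: "u n \<in> bounded_inputs S" "0 \<le> T n" "norm (flow (u n) (x n) (T n)) = K + real n"
      "escapes S (flow (u n) (x n) (T n)) (t + 1 - (1/2) ^ n - T n)"
      using X(1)[of n] by (auto simp: P_def XX)
    have "0 < (1/2 :: real) ^ n" by simp
    then have "T n \<le> t + 1" using escapes_nonneg[OF *(4)] by linarith
    then show "u n \<in> bounded_inputs S" "0 \<le> T n" "T n \<le> t + 1"
      "norm (flow (u n) (x n) (T n)) = K + real n" using * by auto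
  qed
  have nxt: "T n \<le> T (Suc n)" "\<And>s. s < T n \<Longrightarrow> u (Suc n) s = u n s"
    "\<And>s. s \<in> {0..T n} \<Longrightarrow> norm (flow (u n) (x (Suc n)) s - flow (u n) (x n) s) < (1/2) ^ n" for n
    using X(2)[of n] by (auto simp: Q_def XX)
  have Tmono: "T m \<le> T n" if "m \<le> n" for m n using lift_Suc_mono_le[of T m n] nxt(1) that by blast
  have ueq: "u n s = u m s" if "m \<le> n" "s < T m" for m n s
    using that(1)
  proof (induction n rule: dec_induct)
    case (step n)
    have "s < T n" using that(2) Tmono[OF step(1)] by simp
    then show ?case using nxt(2) step by simp
  qed simp
  \<comment> \<open>At each time the stages are eventually constant, and constantly 0 if no
    \<open>T n\<close> exceeds \<open>s\<close>. Writing this as a limit gives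
    measurability.\<close>
  define w where "w s = lim (\<lambda>n. if s < T n then u n s else 0)" for s
  have wu: "w s = u n s" if "s < T n" for s n
  proof -
    have "\<forall>\<^sub>F m in sequentially. (if s < T m then u m s else 0) = u n s"
      using eventually_ge_at_top[of n]
    proof eventually_elim
      case (elim m)
      then show ?case using ueq[OF elim that] Tmono[OF elim] that by auto
    qed
    then have "(\<lambda>m. if s < T m then u m s else 0) \<longlonglongrightarrow> u n s" by (rule tendsto_eventually)
    then show ?thesis unfolding w_def by (rule limI)
  qed
  have w0: "w s = 0" if "\<And>n. \<not> s < T n" for s unfolding w_def using that by simp
  have w: "w \<in> bounded_inputs S"
  proof -
    have "w \<in> borel_measurable lebesgue" unfolding w_def
    proof (rule borel_measurable_lim_metric)
      fix n
      have "(\<lambda>s. if s \<in> {..<T n} then u n s else 0) \<in> borel_measurable lebesgue"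
        using u[of n] by (intro measurable_If_set) (auto simp: bounded_inputs_def)
      then show "(\<lambda>s. if s < T n then u n s else 0) \<in> borel_measurable lebesgue" by simp
    qed
    moreover have "norm (w s) \<le> S" for s
    proof (cases "\<exists>n. s < T n")
      case True
      then obtain n where "s < T n" by blast
      then show ?thesis using wu[of s n] u[of n] by (simp add: bounded_inputs_def)
    next
      case False
      have "norm (u 0 0) \<le> S" using u[of 0] by (simp add: bounded_inputs_def)
      then have "0 \<le> S" using norm_ge_zero order_trans by blast
      then show ?thesis using w0 False by auto
    qed
    ultimately show ?thesis by (simp add: bounded_inputs_def)
  qed
  have fw: "flow (u n) y s = flow w y s" if "s \<in> {0..T n}" for n s y
    by (rule flow_cong[OF u w _ that]) (simp add: wu)
  have stepw: "norm (flow w (x (Suc n)) s - flow w (x n) s) < (1/2) ^ n" if "s \<in> {0..T n}" for n s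
    using nxt(3)[OF that] fw[OF that] by simp
  \<comment> \<open>The subtracted term keeps the geometric sum exact, so that the induction goes
    through.\<close>
  have tele: "norm (flow w (x (n + k)) s - flow w (x n) s) \<le> 2 * (1/2) ^ n - 2 * (1/2) ^ (n + k)"
    if "s \<in> {0..T n}" for n k s
  proof (induction k)
    case (Suc k)
    have "s \<in> {0..T (n + k)}" using that Tmono[of n "n + k"] by auto
    from stepw[OF this] Suc
    have "norm ((flow w (x (Suc (n + k))) s - flow w (x (n + k)) s) + (flow w (x (n + k)) s - flow w (x n) s))
       \<le> (1/2) ^ (n + k) + (2 * (1/2) ^ n - 2 * (1/2) ^ (n + k))"
      by (intro order_trans[OF norm_triangle_ineq] add_mono) auto
    then show ?case by simp
  qed simp
  have "Cauchy x"
  proof (rule metric_CauchyI)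
    fix e :: real assume "e > 0"
    obtain n where n: "(1/2 :: real) ^ n < e / 4"
      using real_arch_pow_inv[of "e / 4" "1/2"] \<open>e > 0\<close> by auto
    have "dist (x m) (x n) < e / 2" if "m \<ge> n" for m
    proof -
      have "norm (x (n + (m - n)) - x n) \<le> 2 * (1/2) ^ n - 2 * (1/2) ^ (n + (m - n))"
        using tele[of 0 n "m - n"] T[of n] flow_0[OF w] by simp
      moreover have "0 < (1/2 :: real) ^ (n + (m - n))" by simp
      ultimately have "norm (x (n + (m - n)) - x n) < e / 2" using n by linarith
      then show ?thesis using that by (simp add: dist_norm)
    qed
    then show "\<exists>M. \<forall>m\<ge>M. \<forall>n\<ge>M. dist (x m) (x n) < e"
      by (metis dist_triangle_half_l)
  qed
  then obtain y where y: "x \<longlonglongrightarrow> y" using Cauchy_convergent convergent_def by blast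
  \<comment> \<open>The total drift at time \<open>T n\<close> after stage \<open>n\<close> is at
    most 2, so the limiting trajectory is still unbounded on \<open>{0..t + 1}\<close>, although it
    is continuous there by completeness.\<close>
  have big: "K + real n - 2 \<le> norm (flow w y (T n))" for n
  proof -
    have "isCont (\<lambda>p. flow w p (T n)) y"
      using flow_continuous_initial[OF w T(1)] continuous_on_eq_continuous_at[OF open_UNIV] by blast
    then have "(\<lambda>m. flow w (x (m + n)) (T n)) \<longlonglongrightarrow> flow w y (T n)"
      by (intro isCont_tendsto_compose[of _ "\<lambda>p. flow w p (T n)"] LIMSEQ_ignore_initial_segment[OF y])
    then have "(\<lambda>m. norm (flow w (x (m + n)) (T n))) \<longlonglongrightarrow> norm (flow w y (T n))" by (rule tendsto_norm)
    moreover have "K + real n - 2 \<le> norm (flow w (x (m + n)) (T n))" for m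
    proof -
      have "norm (flow w (x (n + m)) (T n) - flow w (x n) (T n)) \<le> 2 * (1/2) ^ n - 2 * (1/2) ^ (n + m)"
        using tele[of "T n" n m] T by auto
      also have "\<dots> \<le> 2" using power_le_one[of "1/2 :: real" n] zero_le_power[of "1/2 :: real" "n + m"] by linarith
      finally have "norm (flow w (x (n + m)) (T n) - flow w (x n) (T n)) \<le> 2" .
      moreover have "norm (flow w (x n) (T n)) = K + real n" using nrm[of n] fw[of "T n" n] T(1) by simp
      ultimately show ?thesis
        using norm_triangle_ineq2[of "flow w (x n) (T n)" "flow w (x (n + m)) (T n)"]
        by (simp add: add.commute norm_minus_commute)
    qed
    ultimately show ?thesis by (intro LIMSEQ_le_const) auto
  qed
  obtain \<rho> where \<rho>: "\<And>s. s \<in> {0..t + 1} \<Longrightarrow> norm (flow w y s) \<le> \<rho>" using flow_bounded[OF w] by blast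
  obtain n :: nat where "\<rho> - K + 2 < real n" using reals_Archimedean2 by blast
  then show False using big[of n] \<rho>[of "T n"] T by auto
qed

text \<open>Compactness of the ball of initial points: a limit of points with larger and larger
  reachable states would escape.\<close>

lemma reachable_set_bounded:
  obtains Q where "\<And>u p t. u \<in> bounded_inputs S \<Longrightarrow> norm p \<le> R \<Longrightarrow> t \<in> {0..T} \<Longrightarrow> norm (flow u p t) \<le> Q"
proof (rule ccontr)
  assume "\<not> thesis"
  then have "\<exists>u p t. u \<in> bounded_inputs S \<and> norm p \<le> R \<and> t \<in> {0..T} \<and> norm (flow u p t) > real n" for n
    using that[of "real n"] by (meson not_le)
  then obtain u p t where upt: "\<And>n. u n \<in> bounded_inputs S" "\<And>n. norm (p n) \<le> R" "\<And>n. t n \<in> {0..T}"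
    "\<And>n. norm (flow (u n) (p n) (t n)) > real n" by metis
  have "\<forall>n. p n \<in> cball 0 R" using upt(2) by simp
  moreover have "compact (cball (0::'a) R)" by simp
  ultimately obtain q \<sigma> where \<sigma>: "strict_mono (\<sigma> :: nat \<Rightarrow> nat)" "(p \<circ> \<sigma>) \<longlonglongrightarrow> q"
    unfolding compact_def by meson
  have "escapes S q T"
  proof (rule escapes_limit)
    fix \<delta> \<rho> :: real assume "\<delta> > 0"
    have "\<forall>\<^sub>F n in sequentially. \<rho> \<le> real (\<sigma> n)"
      using filterlim_compose[OF filterlim_real_sequentially filterlim_subseq[OF \<sigma>(1)]]
      by (auto simp: filterlim_at_top)
    moreover have "\<forall>\<^sub>F n in sequentially. norm (p (\<sigma> n) - q) < \<delta>"
      using tendstoD[OF \<sigma>(2) \<open>\<delta> > 0\<close>] by (simp add: dist_norm)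
    ultimately obtain n where "\<rho> \<le> real (\<sigma> n)" "norm (p (\<sigma> n) - q) < \<delta>"
      by (auto dest: eventually_happens[OF eventually_conj])
    then show "\<exists>p u s. norm (p - q) < \<delta> \<and> u \<in> bounded_inputs S \<and> s \<in> {0..T} \<and> norm (flow u p s) > \<rho>"
      using upt[of "\<sigma> n"] by (meson le_less_trans)
  qed
  then show False using not_escapes by blast
qed

section \<open>Accuracy of the predictor\<close>

lemma f_integrable:
  assumes "v \<in> bounded_inputs S"
  shows "(\<lambda>s. f (z, v s)) integrable_on {a..b}"
proof -
  define \<rho> where "\<rho> = norm z + \<bar>S\<bar>"
  obtain L where L: "L \<ge> 0" "\<And>x y u v. norm x \<le> \<rho> \<Longrightarrow> norm y \<le> \<rho> \<Longrightarrow> norm u \<le> \<rho> \<Longrightarrow> norm v \<le> \<rho> \<Longrightarrow>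
       norm (f (x, u) - f (y, v)) \<le> L * (norm (x - y) + norm (u - v))" using f_lipschitz by blast
  have "continuous_on UNIV (\<lambda>w. f (z, w))"
    by (intro continuous_on_compose2[OF continuously_differentiable_continuous_on[OF f_C1]] continuous_intros) auto
  then have "(\<lambda>w. f (z, w)) \<in> borel_measurable borel" by (rule borel_measurable_continuous_onI)
  then have "(\<lambda>s. f (z, v s)) \<in> borel_measurable lebesgue"
    using measurable_compose[of v lebesgue borel "\<lambda>w. f (z, w)" borel] assms by (auto simp: bounded_inputs_def)
  then have m: "(\<lambda>s. f (z, v s)) \<in> borel_measurable (lebesgue_on {a..b})" by (rule measurable_restrict_space1)
  have "norm (f (z, v s)) \<le> L * (norm z + \<bar>S\<bar>)" for s
  proof -
    have v: "norm (v s) \<le> \<bar>S\<bar>" using assms abs_ge_self[of S] order_trans by (fastforce simp: bounded_inputs_def)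
    then have "norm (f (z, v s) - f (0, 0)) \<le> L * (norm (z - 0) + norm (v s - 0))"
      by (intro L(2)) (auto simp: \<rho>_def add_increasing)
    also have "\<dots> \<le> L * (norm z + \<bar>S\<bar>)" using L(1) v by (intro mult_left_mono) auto
    finally show ?thesis by (simp add: f_zero)
  qed
  then show ?thesis
    by (intro measurable_bounded_by_integrable_imp_integrable[OF m, of "\<lambda>_. L * (norm z + \<bar>S\<bar>)"]) auto
qed

text \<open>On the ball containing all reachable states \<open>f\<close> is Lipschitz, and
  comparison with the zero solution makes the bound proportional to the size of the data.
  Proportionality is essential: prediction errors must shrink with the state for the decay to be
  exponential.\<close>

lemma flow_linear_bound:
  obtains Q where "Q \<ge> 1"
    "\<And>v \<sigma> p t. v \<in> bounded_inputs \<sigma> \<Longrightarrow> norm p + \<sigma> \<le> S \<Longrightarrow> t \<in> {0..T} \<Longrightarrow> norm (flow v p t) \<le> Q * (norm p + \<sigma>)"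
proof -
  obtain Q0 where Q0: "\<And>u p t. u \<in> bounded_inputs S \<Longrightarrow> norm p \<le> S \<Longrightarrow> t \<in> {0..T} \<Longrightarrow> norm (flow u p t) \<le> Q0"
    using reachable_set_bounded by blast
  define \<rho> where "\<rho> = \<bar>Q0\<bar> + \<bar>S\<bar>"
  obtain L where L: "L \<ge> 0" "\<And>x y u v. norm x \<le> \<rho> \<Longrightarrow> norm y \<le> \<rho> \<Longrightarrow> norm u \<le> \<rho> \<Longrightarrow> norm v \<le> \<rho> \<Longrightarrow>
       norm (f (x, u) - f (y, v)) \<le> L * (norm (x - y) + norm (u - v))" using f_lipschitz by blast
  define Q where "Q = (1 + L * \<bar>T\<bar>) * exp (L * \<bar>T\<bar>)"
  show ?thesis
  proof (rule that[of Q])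
    have "1 * 1 \<le> Q" unfolding Q_def using L(1) by (intro mult_mono) auto
    then show "Q \<ge> 1" by simp
    fix v :: "real \<Rightarrow> 'b" and \<sigma> t :: real and p :: 'a assume v: "v \<in> bounded_inputs \<sigma>" and le: "norm p + \<sigma> \<le> S" and t: "t \<in> {0..T}"
    have vs: "norm (v s) \<le> \<sigma>" for s using v by (auto simp: bounded_inputs_def)
    have \<sigma>: "\<sigma> \<ge> 0" using vs[of 0] norm_ge_zero order_trans by blast
    have "norm (v s) \<le> S" for s using vs[of s] le norm_ge_zero[of p] by linarith
    then have vS: "v \<in> bounded_inputs S" using v by (auto simp: bounded_inputs_def)
    have "norm (flow v p t - 0) \<le> (norm (flow v p 0 - 0) + (L * \<sigma>) * (T - 0)) * exp (L * (t - 0))"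
    proof (rule integral_solution_diff_le[where y = "\<lambda>_. 0" and G = "\<lambda>_ _. 0", OF flow_integral_solution[OF v order_refl] _ \<open>L \<ge> 0\<close>])
      fix s assume s: "s \<in> {0..T}"
      have "norm (f (flow v p s, v s) - f (0, 0)) \<le> L * (norm (flow v p s - 0) + norm (v s - 0))"
      proof (rule L(2))
        show "norm (flow v p s) \<le> \<rho>" using Q0[OF vS _ s, of p] le \<sigma> by (auto simp: \<rho>_def)
        show "norm (v s) \<le> \<rho>" using vs[of s] le norm_ge_zero[of p] unfolding \<rho>_def by linarith
      qed (auto simp: \<rho>_def)
      also have "\<dots> \<le> L * (norm (flow v p s) + \<sigma>)" using L(1) vs by (intro mult_left_mono) auto
      finally show "norm (f (flow v p s, v s) - 0) \<le> L * norm (flow v p s - 0) + L * \<sigma>"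
        by (simp add: f_zero distrib_left)
    qed (use t L \<sigma> in \<open>auto simp: integral_solution_def\<close>)
    also have "\<dots> \<le> ((1 + L * T) * (norm p + \<sigma>)) * exp (L * T)"
    proof (intro mult_mono)
      have "norm p * 1 \<le> norm p * (1 + L * T)" "\<sigma> * (L * T) \<le> \<sigma> * (1 + L * T)"
        using L(1) t \<sigma> by (intro mult_left_mono; simp)+
      then show "norm (flow v p 0 - 0) + L * \<sigma> * (T - 0) \<le> (1 + L * T) * (norm p + \<sigma>)"
        by (simp add: flow_0[OF v] algebra_simps)
    qed (use t L \<sigma> in \<open>auto intro!: mult_left_mono\<close>)
    also have "\<dots> = Q * (norm p + \<sigma>)" using t by (simp add: Q_def)
    finally show "norm (flow v p t) \<le> Q * (norm p + \<sigma>)" by simp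
  qed
qed

text \<open>Only the state is frozen in a step, the input being integrated as it is. So the local
  error comes solely from the displacement of the exact trajectory during one step, and inputs that
  are merely measurable do no harm. A discrete Gronwall argument adds up these errors. The Euler
  iterates are not known to be bounded beforehand; their closeness to the exact trajectory keeps
  them in the ball of radius \<open>\<rho>\<close>.\<close>

lemma predictor_accurate:
  assumes "\<tau> > 0" "\<epsilon> > 0"
  obtains N :: nat where "N \<ge> 1"
    "\<And>v \<sigma> \<xi>. v \<in> bounded_inputs \<sigma> \<Longrightarrow> norm \<xi> + \<sigma> \<le> S \<Longrightarrow>
       norm (predictor_seq f v (\<tau> / real N) \<xi> N - flow v \<xi> \<tau>) \<le> \<epsilon> * (norm \<xi> + \<sigma>)"
proof -
  obtain Q where Q: "Q \<ge> 1" "\<And>v \<sigma> p t. v \<in> bounded_inputs \<sigma> \<Longrightarrow> norm p + \<sigma> \<le> S \<Longrightarrow> t \<in> {0..\<tau>} \<Longrightarrow>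
      norm (flow v p t) \<le> Q * (norm p + \<sigma>)"
    using flow_linear_bound by blast
  define \<rho> where "\<rho> = Q * \<bar>S\<bar> + 1 + \<bar>S\<bar>"
  obtain L where L: "L \<ge> 0" "\<And>x y u v. norm x \<le> \<rho> \<Longrightarrow> norm y \<le> \<rho> \<Longrightarrow> norm u \<le> \<rho> \<Longrightarrow> norm v \<le> \<rho> \<Longrightarrow>
       norm (f (x, u) - f (y, v)) \<le> L * (norm (x - y) + norm (u - v))" using f_lipschitz by blast
  \<comment> \<open>\<open>c * s0\<close> bounds the speed along the exact trajectory, hence
    \<open>h * c * s0\<close> the displacement in one step.\<close>
  define c where "c = L * (Q + 1)"
  have c: "c \<ge> 0" using L Q by (simp add: c_def)
  \<comment> \<open>The second entry makes the absolute error at most 1 for all data of size up to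
    \<open>S\<close>; this is the margin contained in \<open>\<rho>\<close>.\<close>
  define m where "m = min \<epsilon> (1 / (\<bar>S\<bar> + 1))"
  have m: "m > 0" using \<open>\<epsilon> > 0\<close> by (simp add: m_def)
  obtain N0 :: nat where N0: "\<tau> * c * exp (L * \<tau>) / m < real N0" using reals_Archimedean2 by blast
  define N where "N = Suc N0"
  define h where "h = \<tau> / real N"
  have h: "h > 0" "real N * h = \<tau>" using \<open>\<tau> > 0\<close> by (auto simp: h_def N_def)
  have hm: "h * c * exp (L * \<tau>) \<le> m"
    using N0 m by (simp add: h_def N_def field_simps)
  show ?thesis
  proof (rule that[of N])
    fix v :: "real \<Rightarrow> 'b" and \<sigma> :: real and \<xi> :: 'a assume v: "v \<in> bounded_inputs \<sigma>" and le: "norm \<xi> + \<sigma> \<le> S"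
    define s0 where "s0 = norm \<xi> + \<sigma>"
    define x where "x = flow v \<xi>"
    define z where "z = predictor_seq f v h \<xi>"
    have vs: "norm (v s) \<le> \<sigma>" for s using v by (auto simp: bounded_inputs_def)
    have \<sigma>: "\<sigma> \<ge> 0" using vs[of 0] norm_ge_zero order_trans by blast
    have s0: "0 \<le> s0" "\<sigma> \<le> s0" "s0 \<le> S" using \<sigma> le by (auto simp: s0_def)
    have x: "norm (x t) \<le> Q * s0" if "t \<in> {0..\<tau>}" for t using Q(2)[OF v le that] by (simp add: x_def s0_def)
    have QS: "Q * s0 \<le> Q * \<bar>S\<bar>" using Q(1) s0 by (intro mult_left_mono) auto
    have x\<rho>: "norm (x t) \<le> \<rho> - 1" if "t \<in> {0..\<tau>}" for t using x[OF that] QS unfolding \<rho>_def by linarith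
    have v\<rho>: "norm (v t) \<le> \<rho>" for t
    proof -
      have "0 \<le> Q * \<bar>S\<bar>" using Q(1) by simp
      then show ?thesis using vs[of t] s0 unfolding \<rho>_def by linarith
    qed
    have \<rho>: "\<rho> \<ge> 0" using Q(1) by (simp add: \<rho>_def)
    have sol: "integral_solution (\<lambda>t y. f (y, v t)) x a b" if "0 \<le> a" for a b
      using flow_integral_solution[OF v that] by (simp add: x_def)
    have incr: "norm (x t - x a) \<le> h * c * s0" if "0 \<le> a" "a \<le> t" "t \<le> a + h" "a + h \<le> \<tau>" for a t
    proof -
      have "norm (x t - x a) \<le> (norm (x a - x a) + (c * s0) * (a + h - a)) * exp (0 * (t - a))"
      proof (rule integral_solution_diff_le[where y = "\<lambda>_. x a" and G = "\<lambda>_ _. 0", OF sol[OF that(1)]])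
        fix s assume s: "s \<in> {a..a + h}"
        then have s': "s \<in> {0..\<tau>}" using that by auto
        have "norm (f (x s, v s) - f (0, 0)) \<le> L * (norm (x s - 0) + norm (v s - 0))"
          using x\<rho>[OF s'] v\<rho>[of s] \<rho> by (intro L(2)) auto
        also have "\<dots> \<le> L * (Q * s0 + s0)" using x[OF s'] vs[of s] s0 L(1) by (intro mult_left_mono add_mono) auto
        finally show "norm (f (x s, v s) - 0) \<le> 0 * norm (x s - x a) + c * s0"
          by (simp add: f_zero c_def algebra_simps)
      qed (use that c s0 in \<open>auto simp: integral_solution_def\<close>)
      then show ?thesis by (simp add: mult_ac)
    qed
    have pw: "((1 + h * L) ^ j - 1) * h * c * s0 \<le> m * s0" if "j \<le> N" for j
    proof -
      have "(1 + h * L) ^ j \<le> exp (h * L) ^ j" using h(1) L(1) exp_ge_add_one_self[of "h * L"] by (intro power_mono) auto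
      also have "\<dots> = exp (real j * h * L)" by (simp add: exp_of_nat_mult mult.assoc)
      also have "\<dots> \<le> exp (real N * h * L)" using that h(1) L(1) by (auto intro!: mult_right_mono)
      finally have "(1 + h * L) ^ j - 1 \<le> exp (L * \<tau>)" using h(2) by (simp add: mult.commute)
      then have "((1 + h * L) ^ j - 1) * (h * c) \<le> exp (L * \<tau>) * (h * c)"
        using h c by (intro mult_right_mono) auto
      also have "\<dots> \<le> m" using hm by (simp add: mult_ac)
      finally have "((1 + h * L) ^ j - 1) * (h * c) * s0 \<le> m * s0" using s0 by (intro mult_right_mono)
      then show ?thesis by (simp add: mult_ac)
    qed
    have "m * s0 \<le> 1 / (\<bar>S\<bar> + 1) * \<bar>S\<bar>" using s0 by (intro mult_mono) (auto simp: m_def)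
    also have "\<dots> \<le> 1" by (simp add: field_simps)
    finally have ms: "m * s0 \<le> 1" .
    \<comment> \<open>The right-hand side solves the recursion
      \<open>e (j + 1) = (1 + h * L) * e j + h * L * (h * c * s0)\<close> with initial value
      0.\<close>
    have err: "norm (z j - x (real j * h)) \<le> ((1 + h * L) ^ j - 1) * h * c * s0" if "j \<le> N" for j
      using that
    proof (induction j)
      case 0
      then show ?case by (simp add: z_def x_def flow_0[OF v])
    next
      case (Suc j)
      define a where "a = real j * h"
      have ah: "real (Suc j) * h = a + h" by (simp add: a_def algebra_simps)
      have "a + h \<le> real N * h" unfolding ah[symmetric] using Suc.prems h(1) by (intro mult_right_mono) auto
      then have a: "0 \<le> a" "a + h \<le> \<tau>" using h by (auto simp: a_def)
      define E where "E = norm (z j - x a)"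
      have E: "E \<le> ((1 + h * L) ^ j - 1) * h * c * s0" using Suc by (simp add: E_def a_def)
      then have "E \<le> 1" using pw[of j] ms Suc.prems by simp
      then have z\<rho>: "norm (z j) \<le> \<rho>"
        using x\<rho>[of a] a h(1) norm_triangle_sub[of "z j" "x a"] unfolding E_def by auto
      have i1: "((\<lambda>s. f (x s, v s)) has_integral (x (a + h) - x a)) {a..a + h}"
        using integral_solution_has_integral[OF sol[of a "a + h"], of a "a + h"] a h by simp
      have i2: "((\<lambda>s. f (z j, v s)) has_integral integral {a..a + h} (\<lambda>s. f (z j, v s))) {a..a + h}"
        using f_integrable[OF v] by (rule integrable_integral)
      have eq: "z (Suc j) - x (a + h) = (z j - x a) + (integral {a..a + h} (\<lambda>s. f (z j, v s)) - (x (a + h) - x a))"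
        by (simp add: z_def algebra_simps a_def)
      have "norm (integral {a..a + h} (\<lambda>s. f (z j, v s)) - (x (a + h) - x a)) \<le> (L * (E + h * c * s0)) * measure lborel (cbox a (a + h))"
      proof (rule has_integral_bound)
        show "((\<lambda>s. f (z j, v s) - f (x s, v s)) has_integral (integral {a..a + h} (\<lambda>s. f (z j, v s)) - (x (a + h) - x a))) (cbox a (a + h))"
          using has_integral_diff[OF i2 i1] by simp
        show "0 \<le> L * (E + h * c * s0)" using L(1) h c s0 by (auto simp: E_def)
        fix s assume s: "s \<in> cbox a (a + h)"
        have "norm (f (z j, v s) - f (x s, v s)) \<le> L * (norm (z j - x s) + norm (v s - v s))"
          using z\<rho> x\<rho>[of s] v\<rho>[of s] s a by (intro L(2)) auto
        also have "\<dots> \<le> L * (E + h * c * s0)"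
        proof -
          have "norm (z j - x s) \<le> norm (z j - x a) + norm (x s - x a)"
            using norm_triangle_ineq4[of "z j - x a" "x s - x a"] by simp
          then show ?thesis using incr[of a s] a s L(1) by (intro mult_left_mono) (auto simp: E_def)
        qed
        finally show "norm (f (z j, v s) - f (x s, v s)) \<le> L * (E + h * c * s0)" .
      qed
      then have "norm (z (Suc j) - x (a + h)) \<le> E + L * (E + h * c * s0) * h"
        unfolding eq E_def using h by (intro order_trans[OF norm_triangle_ineq] add_left_mono) simp
      also have "\<dots> = (1 + h * L) * E + h * L * h * c * s0" by (simp add: algebra_simps)
      also have "\<dots> \<le> (1 + h * L) * (((1 + h * L) ^ j - 1) * h * c * s0) + h * L * h * c * s0"
        using E h L by (intro add_right_mono mult_left_mono) auto
      also have "\<dots> = ((1 + h * L) ^ Suc j - 1) * h * c * s0" by (simp add: algebra_simps)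
      finally show ?case by (simp only: ah)
    qed
    have "norm (z N - x \<tau>) \<le> m * s0" using err[of N] pw[of N] h by simp
    also have "\<dots> \<le> \<epsilon> * s0" using s0 by (intro mult_right_mono) (auto simp: m_def)
    finally show "norm (predictor_seq f v (\<tau> / real N) \<xi> N - flow v \<xi> \<tau>) \<le> \<epsilon> * (norm \<xi> + \<sigma>)"
      by (simp add: z_def x_def h_def s0_def)
  qed (simp add: N_def)
qed

end

section \<open>Decay of the nominal closed loop\<close>

lemma autonomous_solution_shift:
  assumes "autonomous_solution g y" "0 \<le> a"
  shows "autonomous_solution g (\<lambda>t. y (t + a))"
  unfolding autonomous_solution_def
proof (intro allI impI)
  fix t :: real assume "t \<ge> 0"
  have "((\<lambda>t. t + a) has_vector_derivative 1) (at t within {0..})"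
    by (auto intro!: derivative_eq_intros)
  moreover have "(y has_vector_derivative g (y (t + a))) (at (t + a) within (\<lambda>t. t + a) ` {0..})"
    using assms \<open>t \<ge> 0\<close> unfolding autonomous_solution_def
    by (auto intro: has_vector_derivative_within_subset[where S = "{0..}"])
  ultimately have "((y \<circ> (\<lambda>t. t + a)) has_vector_derivative 1 *\<^sub>R g (y (t + a))) (at t within {0..})"
    by (rule vector_diff_chain_within)
  then show "((\<lambda>t. y (t + a)) has_vector_derivative g (y (t + a))) (at t within {0..})"
    by (simp add: o_def)
qed

lemma autonomous_integral_solution:
  assumes "autonomous_solution g y" "0 \<le> a"
  shows "integral_solution (\<lambda>_. g) y a b"
  using assms unfolding autonomous_solution_def
  by (intro integral_solution_derivative)
     (auto intro: has_vector_derivative_within_subset[where S = "{0..}"])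

locale stabilized_system = control_system f
  for f :: "'a::euclidean_space \<times> 'b::euclidean_space \<Rightarrow> 'a" +
  fixes k :: "'a \<Rightarrow> 'b"
  assumes k_C1: "continuously_differentiable k"
    and k_zero: "k 0 = 0"
    and gas: "globally_asymptotically_stable (\<lambda>x. f (x, k x))"
    and les: "locally_exponentially_stable (\<lambda>x. f (x, k x))"
begin

text \<open>State and feedback argument vary independently, because the predicted state is driven by
  \<open>k (z t)\<close> and not by its own feedback.\<close>

lemma feedback_lipschitz:
  obtains L where "L \<ge> 0"
    "\<And>x y p q. norm x \<le> \<rho> \<Longrightarrow> norm y \<le> \<rho> \<Longrightarrow> norm p \<le> \<rho> \<Longrightarrow> norm q \<le> \<rho> \<Longrightarrow>
       norm (f (x, k p) - f (y, k q)) \<le> L * (norm (x - y) + norm (p - q))"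
    "\<And>p. norm p \<le> \<rho> \<Longrightarrow> norm (k p) \<le> L * norm p"
proof -
  obtain K where K: "K \<ge> 0" "\<And>p q. norm p \<le> \<rho> \<Longrightarrow> norm q \<le> \<rho> \<Longrightarrow> norm (k p - k q) \<le> K * norm (p - q)"
    using continuously_differentiable_lipschitz[OF k_C1] by blast
  have k: "norm (k p) \<le> K * norm p" if "norm p \<le> \<rho>" for p
    using K(2)[OF that, of 0] k_zero that order_trans[OF norm_ge_zero that] by simp
  obtain L where L: "L \<ge> 0" "\<And>x y u v. norm x \<le> (1 + K) * \<bar>\<rho>\<bar> \<Longrightarrow> norm y \<le> (1 + K) * \<bar>\<rho>\<bar> \<Longrightarrow>
       norm u \<le> (1 + K) * \<bar>\<rho>\<bar> \<Longrightarrow> norm v \<le> (1 + K) * \<bar>\<rho>\<bar> \<Longrightarrow>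
       norm (f (x, u) - f (y, v)) \<le> L * (norm (x - y) + norm (u - v))" using f_lipschitz by blast
  show ?thesis
  proof (rule that[of "L * (1 + K) + K"])
    fix x y p q :: 'a assume le: "norm x \<le> \<rho>" "norm y \<le> \<rho>" "norm p \<le> \<rho>" "norm q \<le> \<rho>"
    have \<rho>: "0 \<le> \<rho>" using le(1) norm_ge_zero order_trans by blast
    then have K\<rho>: "0 \<le> K * \<rho>" using K(1) by simp
    have "norm (k w) \<le> K * \<rho>" if "norm w \<le> \<rho>" for w
      using k[OF that] mult_left_mono[OF that K(1)] by simp
    then have "norm (f (x, k p) - f (y, k q)) \<le> L * (norm (x - y) + norm (k p - k q))"
      using le K\<rho> \<rho> by (intro L(2)) (force simp: distrib_right)+
    also have "\<dots> \<le> L * ((1 + K) * norm (x - y) + (1 + K) * norm (p - q))"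
    proof (intro mult_left_mono add_mono)
      show "norm (x - y) \<le> (1 + K) * norm (x - y)" using K(1) by (simp add: distrib_right)
      show "norm (k p - k q) \<le> (1 + K) * norm (p - q)"
        using K(2)[OF le(3,4)] norm_ge_zero[of "p - q"] unfolding distrib_right by linarith
    qed (rule L(1))
    also have "\<dots> = L * (1 + K) * (norm (x - y) + norm (p - q))" by (simp add: algebra_simps)
    also have "\<dots> \<le> (L * (1 + K) + K) * (norm (x - y) + norm (p - q))"
      using K(1) by (intro mult_right_mono) auto
    finally show "norm (f (x, k p) - f (y, k q)) \<le> (L * (1 + K) + K) * (norm (x - y) + norm (p - q))" .
  next
    fix p :: 'a assume "norm p \<le> \<rho>"
    from k[OF this] show "norm (k p) \<le> (L * (1 + K) + K) * norm p"
      using mult_right_mono[of K "L * (1 + K) + K" "norm p"] K(1) L(1) by simp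
  qed (use L K in auto)
qed

definition nominal :: "(real \<Rightarrow> 'a) \<Rightarrow> bool" where
  "nominal y \<longleftrightarrow> autonomous_solution (\<lambda>x. f (x, k x)) y"

lemma nominal_integral_solution: "nominal y \<Longrightarrow> 0 \<le> a \<Longrightarrow> integral_solution (\<lambda>_ x. f (x, k x)) y a b"
  unfolding nominal_def by (rule autonomous_integral_solution)

lemma nominal_shift: "nominal y \<Longrightarrow> 0 \<le> a \<Longrightarrow> nominal (\<lambda>t. y (t + a))"
  unfolding nominal_def by (rule autonomous_solution_shift)

lemma nominal_exists: obtains y where "nominal y" "y 0 = p"
  using gas unfolding globally_asymptotically_stable_def nominal_def by blast

lemma nominal_near:
  assumes y: "nominal y" and "e > 0"
  obtains d where "d > 0"
    "\<And>x t. nominal x \<Longrightarrow> norm (x 0 - y 0) < d \<Longrightarrow> t \<in> {0..a} \<Longrightarrow> norm (x t - y t) < e"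
proof -
  obtain \<rho> where \<rho>: "\<And>t. t \<in> {0..a} \<Longrightarrow> norm (y t) \<le> \<rho>"
    using integral_solution_bounded[OF nominal_integral_solution[OF y order_refl]] by blast
  obtain L where L: "L \<ge> 0" "\<And>x y p q. norm x \<le> \<rho> + e \<Longrightarrow> norm y \<le> \<rho> + e \<Longrightarrow> norm p \<le> \<rho> + e \<Longrightarrow> norm q \<le> \<rho> + e \<Longrightarrow>
       norm (f (x, k p) - f (y, k q)) \<le> L * (norm (x - y) + norm (p - q))" using feedback_lipschitz by metis
  show ?thesis
  proof (rule that[of "e / exp (2 * L * a)"])
    fix x t assume x: "nominal x" and near: "norm (x 0 - y 0) < e / exp (2 * L * a)" and t: "t \<in> {0..a}"
    show "norm (x t - y t) < e"
    proof (rule integral_solution_diff_less(2)[where L = "2 * L" and c = 0, OF nominal_integral_solution[OF x order_refl] nominal_integral_solution[OF y order_refl] _ order_refl _ order_refl _ t])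
      fix s assume s: "s \<in> {0..a}" and close: "\<And>r. r \<in> {0..s} \<Longrightarrow> norm (x r - y r) \<le> e"
      have "norm (x s) \<le> \<rho> + e" using close[of s] \<rho>[OF s] s norm_triangle_sub[of "x s" "y s"] by auto
      then show "norm (f (x s, k (x s)) - f (y s, k (y s))) \<le> 2 * L * norm (x s - y s) + 0"
        using L(2)[of "x s" "y s" "x s" "y s"] \<rho>[OF s] \<open>e > 0\<close> by auto
    qed (use L near in \<open>auto simp: field_simps\<close>)
  qed (use \<open>e > 0\<close> in auto)
qed

text \<open>Attraction gives each starting point its own entry time, which by continuous dependence
  also serves a neighbourhood; finitely many neighbourhoods cover the ball. Sums over the finite
  cover take the place of maxima and also make sense if it is empty.\<close>

lemma nominal_uniformly_attracted:
  assumes "\<delta> > 0"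
  obtains T K where "T \<ge> 0" "\<And>y. nominal y \<Longrightarrow> norm (y 0) \<le> R \<Longrightarrow>
     \<exists>s\<in>{0..T}. norm (y s) < \<delta> \<and> (\<forall>t\<in>{0..s}. norm (y t) \<le> K)"
proof -
  have "\<exists>d s \<rho>. d > 0 \<and> 0 \<le> s \<and> (\<forall>x. nominal x \<and> norm (x 0 - p) < d \<longrightarrow>
      norm (x s) < \<delta> \<and> (\<forall>t\<in>{0..s}. norm (x t) \<le> \<rho>))" for p
  proof -
    obtain y where y: "nominal y" "y 0 = p" by (rule nominal_exists)
    have "(y \<longlongrightarrow> 0) at_top" using gas y(1) by (auto simp: globally_asymptotically_stable_def nominal_def)
    then have "\<forall>\<^sub>F s in at_top. norm (y s) < \<delta> / 2"
      using tendstoD[of y 0 at_top "\<delta> / 2"] \<open>\<delta> > 0\<close> by simp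
    then obtain s where s: "0 \<le> s" "norm (y s) < \<delta> / 2"
      unfolding eventually_at_top_linorder by (meson nle_le)
    obtain \<rho> where \<rho>: "\<And>t. t \<in> {0..s} \<Longrightarrow> norm (y t) \<le> \<rho>"
      using integral_solution_bounded[OF nominal_integral_solution[OF y(1) order_refl]] by blast
    obtain d where d: "d > 0" "\<And>x t. nominal x \<Longrightarrow> norm (x 0 - y 0) < d \<Longrightarrow> t \<in> {0..s} \<Longrightarrow> norm (x t - y t) < \<delta> / 2"
      using nominal_near[OF y(1), of "\<delta> / 2" s] \<open>\<delta> > 0\<close> by auto
    have "norm (x s) < \<delta> \<and> (\<forall>t\<in>{0..s}. norm (x t) \<le> \<rho> + \<delta>)" if "nominal x" "norm (x 0 - p) < d" for x
    proof -
      have c: "norm (x t - y t) < \<delta> / 2" if "t \<in> {0..s}" for t using d(2) that y(2) \<open>nominal x\<close> \<open>norm (x 0 - p) < d\<close> by auto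
      have "norm (x t) \<le> \<rho> + \<delta>" if "t \<in> {0..s}" for t
        using c[OF that] \<rho>[OF that] norm_triangle_sub[of "x t" "y t"] \<open>\<delta> > 0\<close> by linarith
      moreover have "norm (x s) < \<delta>"
        using c[of s] s norm_triangle_sub[of "x s" "y s"] by auto
      ultimately show ?thesis by blast
    qed
    then show ?thesis using d(1) s(1) by blast
  qed
  then obtain d s \<rho> where d: "\<And>p. d p > 0" and s: "\<And>p. 0 \<le> s p"
    and near: "\<And>p x. nominal x \<Longrightarrow> norm (x 0 - p) < d p \<Longrightarrow> norm (x (s p)) < \<delta>"
      "\<And>p x t. nominal x \<Longrightarrow> norm (x 0 - p) < d p \<Longrightarrow> t \<in> {0..s p} \<Longrightarrow> norm (x t) \<le> \<rho> p"
    by metis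
  have cover: "cball 0 R \<subseteq> (\<Union>p\<in>UNIV. ball p (d p))" proof
    fix x show "x \<in> (\<Union>p\<in>UNIV. ball p (d p))" by (rule UN_I[of x]) (use d in auto)
  qed
  obtain C where C: "finite C" "cball 0 R \<subseteq> (\<Union>p\<in>C. ball p (d p))"
    by (rule compactE_image[OF compact_cball _ cover]) auto
  show ?thesis
  proof (rule that)
    show "0 \<le> (\<Sum>p\<in>C. s p)" using s by (simp add: sum_nonneg)
    fix y assume y: "nominal y" "norm (y 0) \<le> R"
    then have "y 0 \<in> (\<Union>p\<in>C. ball p (d p))" by (intro subsetD[OF C(2)]) simp
    then obtain p where p: "p \<in> C" "norm (y 0 - p) < d p" by (auto simp: dist_norm norm_minus_commute)
    have "s p \<le> (\<Sum>p\<in>C. s p)" using s by (intro member_le_sum[OF p(1)]) (auto simp: C)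
    moreover have "\<bar>\<rho> p\<bar> \<le> (\<Sum>p\<in>C. \<bar>\<rho> p\<bar>)" by (intro member_le_sum[OF p(1)]) (auto simp: C)
    ultimately show "\<exists>s\<in>{0..\<Sum>p\<in>C. s p}. norm (y s) < \<delta> \<and> (\<forall>t\<in>{0..s}. norm (y t) \<le> (\<Sum>p\<in>C. \<bar>\<rho> p\<bar>))"
      using near[OF y(1) p(2)] s[of p] by (intro bexI[of _ "s p"]) fastforce+
  qed
qed

text \<open>Asymptotic stability alone gives bounds that are not proportional to the initial value.
  Up to the entry into the neighbourhood of exponential stability, proportionality comes from
  Gronwall, as 0 is an equilibrium; afterwards it comes from the local estimate. The factor
  \<open>exp (\<mu> * T)\<close> pays for the time before the entry.\<close>

lemma nominal_decay:
  obtains M \<mu> where "M \<ge> 1" "\<mu> > 0"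
    "\<And>y t. nominal y \<Longrightarrow> norm (y 0) \<le> R \<Longrightarrow> 0 \<le> t \<Longrightarrow> norm (y t) \<le> M * exp (- \<mu> * t) * norm (y 0)"
proof -
  obtain \<delta> M0 \<mu> where "\<delta> > 0" "M0 > 0" "\<mu> > 0"
    and loc: "\<And>y t. nominal y \<Longrightarrow> norm (y 0) < \<delta> \<Longrightarrow> 0 \<le> t \<Longrightarrow> norm (y t) \<le> M0 * exp (- \<mu> * t) * norm (y 0)"
    using les unfolding locally_exponentially_stable_def nominal_def by blast
  obtain T K where "T \<ge> 0" and TK: "\<And>y. nominal y \<Longrightarrow> norm (y 0) \<le> R \<Longrightarrow>
     \<exists>s\<in>{0..T}. norm (y s) < \<delta> \<and> (\<forall>t\<in>{0..s}. norm (y t) \<le> K)"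
    using nominal_uniformly_attracted[OF \<open>\<delta> > 0\<close>] by blast
  obtain L where L: "L \<ge> 0" "\<And>x y p q. norm x \<le> \<bar>K\<bar> \<Longrightarrow> norm y \<le> \<bar>K\<bar> \<Longrightarrow> norm p \<le> \<bar>K\<bar> \<Longrightarrow> norm q \<le> \<bar>K\<bar> \<Longrightarrow>
       norm (f (x, k p) - f (y, k q)) \<le> L * (norm (x - y) + norm (p - q))" using feedback_lipschitz by metis
  define M1 where "M1 = max M0 1"
  show ?thesis
  proof (rule that[OF _ \<open>\<mu> > 0\<close>])
    have "1 * (1 * 1) \<le> M1 * (exp (\<mu> * T) * exp (2 * L * T))"
      using L(1) \<open>T \<ge> 0\<close> \<open>\<mu> > 0\<close> by (intro mult_mono) (auto simp: M1_def)
    then show "1 \<le> M1 * (exp (\<mu> * T) * exp (2 * L * T))" by simp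
    fix y t assume y: "nominal y" "norm (y 0) \<le> R" and t: "0 \<le> (t::real)"
    obtain s where s: "s \<in> {0..T}" "norm (y s) < \<delta>" "\<And>t. t \<in> {0..s} \<Longrightarrow> norm (y t) \<le> K"
      using TK[OF y] by blast
    have init: "norm (y r) \<le> exp (2 * L * T) * norm (y 0)" if r: "r \<in> {0..s}" for r
    proof -
      have "norm (y r - 0) \<le> (norm (y 0 - 0) + 0 * (s - 0)) * exp (2 * L * (r - 0))"
      proof (rule integral_solution_diff_le[where y = "\<lambda>_. 0" and G = "\<lambda>_ _. 0", OF nominal_integral_solution[OF y(1) order_refl] _ _ order_refl _ r])
        fix q assume q: "q \<in> {0..s}"
        show "norm (f (y q, k (y q)) - 0) \<le> 2 * L * norm (y q - 0) + 0"
          using L(2)[of "y q" 0 "y q" 0] s(3)[OF q] by (simp add: k_zero f_zero mult_ac)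
      qed (use L in \<open>auto simp: integral_solution_def\<close>)
      also have "\<dots> = exp (2 * L * r) * norm (y 0)" by simp
      also have "\<dots> \<le> exp (2 * L * T) * norm (y 0)"
        using r s(1) L(1) by (auto intro!: mult_right_mono mult_left_mono)
      finally show ?thesis by simp
    qed
    show "norm (y t) \<le> M1 * (exp (\<mu> * T) * exp (2 * L * T)) * exp (- \<mu> * t) * norm (y 0)"
    proof (cases "t \<le> s")
      case True
      have "1 * 1 \<le> M1 * exp (\<mu> * T - \<mu> * t)"
        using True s(1) \<open>\<mu> > 0\<close> by (intro mult_mono) (auto simp: M1_def)
      then have "1 * (exp (2 * L * T) * norm (y 0)) \<le> (M1 * exp (\<mu> * T - \<mu> * t)) * (exp (2 * L * T) * norm (y 0))"
        by (intro mult_right_mono) auto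
      moreover have "norm (y t) \<le> 1 * (exp (2 * L * T) * norm (y 0))" using init[of t] True t by simp
      ultimately have "norm (y t) \<le> (M1 * exp (\<mu> * T - \<mu> * t)) * (exp (2 * L * T) * norm (y 0))"
        by (rule order_trans[rotated])
      then show ?thesis by (simp add: exp_diff exp_minus field_simps)
    next
      case False
      have "norm (y ((t - s) + s)) \<le> M0 * exp (- \<mu> * (t - s)) * norm (y (0 + s))"
        using loc[OF nominal_shift[OF y(1), of s], of "t - s"] s False by auto
      also have "\<dots> \<le> M1 * exp (\<mu> * T - \<mu> * t) * (exp (2 * L * T) * norm (y 0))"
        using init[of s] s(1) \<open>\<mu> > 0\<close> \<open>M0 > 0\<close>
        by (intro mult_mono) (auto simp: M1_def algebra_simps)
      finally show ?thesis by (simp add: exp_diff exp_minus field_simps)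
    qed
  qed
qed

end

section \<open>The sampled closed loop\<close>

lemma time_partition_index:
  assumes "time_partition T" "T i \<le> t"
  obtains j where "i \<le> j" "T j \<le> t" "t < T (Suc j)"
proof -
  have "\<forall>\<^sub>F j in sequentially. t < T j"
    using assms(1) by (auto simp: time_partition_def filterlim_at_top_dense)
  then obtain n where n: "\<And>j. j \<ge> n \<Longrightarrow> t < T j" by (auto simp: eventually_sequentially)
  define J where "J = {j. T j \<le> t}"
  have "J \<subseteq> {..n}"
  proof
    fix j assume "j \<in> J"
    then show "j \<in> {..n}" using n[of j] by (cases "n \<le> j") (auto simp: J_def)
  qed
  then have "finite J" by (rule finite_subset) simp
  moreover have "i \<in> J" using assms(2) by (simp add: J_def)
  moreover have "Suc (Max J) \<notin> J" using Max_ge[OF \<open>finite J\<close>, of "Suc (Max J)"] by auto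
  ultimately have "Max J \<in> J" "i \<le> Max J" "Suc (Max J) \<notin> J"
    using Max_in[of J] Max_ge[of J i] by blast+
  then show ?thesis using that[of "Max J"] by (auto simp: J_def)
qed

lemma time_partition_mono: "time_partition T \<Longrightarrow> i \<le> j \<Longrightarrow> T i \<le> T j"
  by (simp add: time_partition_def strict_mono_less_eq)

lemma time_partition_nonneg: "time_partition T \<Longrightarrow> 0 \<le> T i"
  using time_partition_mono[of T 0 i] by (simp add: time_partition_def)

text \<open>The past input as a total function, set to 0 outside the half-open window. Time
  \<open>\<tau>\<close> is left out, because \<open>u t\<close> is not part of the history but, at a
  sampling time, a result of the prediction made from it.\<close>

definition history :: "real \<Rightarrow> (real \<Rightarrow> 'b::euclidean_space) \<Rightarrow> real \<Rightarrow> real \<Rightarrow> 'b" where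
  "history \<tau> u t s = (if 0 \<le> s \<and> s < \<tau> then u (t - \<tau> + s) else 0)"

text \<open>Stated pointwise, since \<^const>\<open>sup_norm_on\<close> is meaningless for inputs not known to be bounded.\<close>

definition state_bounded :: "real \<Rightarrow> (real \<Rightarrow> 'a::euclidean_space) \<Rightarrow> (real \<Rightarrow> 'b::euclidean_space) \<Rightarrow> real \<Rightarrow> real \<Rightarrow> bool" where
  "state_bounded \<tau> x u t c \<longleftrightarrow> (\<forall>s\<in>{t - \<tau>..<t}. norm (x t) + norm (u s) \<le> c)"

lemma state_bounded_mono: "state_bounded \<tau> x u t c \<Longrightarrow> c \<le> d \<Longrightarrow> state_bounded \<tau> x u t d"
  by (force simp: state_bounded_def)

context stabilized_system
begin

text \<open>The closed loop with the reset rule removed. Resets enter the decay estimates only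
  through bounds on \<open>z (T j) - x (T j + \<tau>)\<close>, so decay can be studied without
  reference to the predictor.\<close>

definition sampled_loop ::
  "real \<Rightarrow> real \<Rightarrow> (nat \<Rightarrow> real) \<Rightarrow> (real \<Rightarrow> 'a) \<Rightarrow> (real \<Rightarrow> 'a) \<Rightarrow> (real \<Rightarrow> 'b) \<Rightarrow> bool" where
  "sampled_loop \<tau> r T x z u \<longleftrightarrow> time_partition T \<and> (\<forall>i. T (Suc i) - T i \<le> r) \<and>
     (\<forall>i. history \<tau> u (T i) \<in> borel_measurable lebesgue) \<and>
     (\<forall>b. integral_solution (\<lambda>t y. f (y, u (t - \<tau>))) x 0 b) \<and>
     (\<forall>i. \<forall>t\<in>{T i..<T (Suc i)}.
        (z has_vector_derivative f (z t, k (z t))) (at t within {T i..<T (Suc i)}) \<and> u t = k (z t))"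

lemma sampled_loop_predicted:
  assumes "sampled_loop \<tau> r T x z u" "0 \<le> \<tau>" "0 \<le> a"
  shows "integral_solution (\<lambda>t y. f (y, u t)) (\<lambda>t. x (t + \<tau>)) a b"
proof -
  have "integral_solution (\<lambda>t y. f (y, u (t - \<tau>))) x (a + \<tau>) (b + \<tau>)"
    using assms integral_solution_subinterval[of _ x 0 "b + \<tau>"] by (auto simp: sampled_loop_def)
  then show ?thesis by (simp add: integral_solution_shift)
qed

lemma
  assumes SL: "sampled_loop \<tau> r T x z u" and "0 < \<tau>"
    and \<sigma>: "\<And>s. s \<in> {T i - \<tau>..<T i} \<Longrightarrow> norm (u s) \<le> \<sigma>"
  shows history_bounded_inputs: "history \<tau> u (T i) \<in> bounded_inputs \<sigma>"
    and sampled_loop_flow: "t \<in> {0..\<tau>} \<Longrightarrow> x (T i + t) = flow (history \<tau> u (T i)) (x (T i)) t"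
proof -
  have "norm (u (T i - \<tau>)) \<le> \<sigma>" using \<sigma>[of "T i - \<tau>"] \<open>0 < \<tau>\<close> by simp
  then have "0 \<le> \<sigma>" using norm_ge_zero order_trans by blast
  then show h: "history \<tau> u (T i) \<in> bounded_inputs \<sigma>"
    using SL \<sigma> by (auto simp: sampled_loop_def bounded_inputs_def history_def)
  assume t: "t \<in> {0..\<tau>}"
  have "0 \<le> T i" using SL time_partition_nonneg by (auto simp: sampled_loop_def)
  then have "integral_solution (\<lambda>t y. f (y, u (t - \<tau>))) x (0 + T i) (\<tau> + T i)"
    using SL integral_solution_subinterval[of _ x 0 "\<tau> + T i"] by (auto simp: sampled_loop_def)
  then have "integral_solution (\<lambda>t y. f (y, u (t + T i - \<tau>))) (\<lambda>t. x (t + T i)) 0 \<tau>"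
    by (simp only: integral_solution_shift)
  from flow_eqI[OF h this _ t refl] show "x (T i + t) = flow (history \<tau> u (T i)) (x (T i)) t"
    by (simp add: history_def algebra_simps)
qed

lemma sampled_loop_feedback:
  assumes "sampled_loop \<tau> r T x z u" "t < T (Suc j)"
  shows "integral_solution (\<lambda>_ y. f (y, k y)) z (T j) t"
proof (rule integral_solution_derivative)
  fix s assume s: "s \<in> {T j..t}"
  have "(z has_vector_derivative f (z s, k (z s))) (at s within {T j..<T (Suc j)})"
    using assms s by (simp add: sampled_loop_def)
  then show "(z has_vector_derivative f (z s, k (z s))) (at s within {T j..t})"
    by (rule has_vector_derivative_within_subset) (use assms(2) in auto)
qed

text \<open>\<open>B\<close> is the overshoot, \<open>H\<close> the horizon and
  \<open>\<delta>\<close> the admissible relative error of resets. The error bound is assumed only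
  at samples where the state is already known to be at most \<open>B * s\<close>: this is what a
  predictor adapted to the current size can guarantee, and inside the proof the required bound at
  \<open>T j\<close> follows from tracking up to \<open>T j\<close>. As sampling times are
  irregular, halving is asserted at any sample within the last \<open>r\<close> before
  \<open>T i + H\<close>.\<close>

lemma sampled_loop_phase:
  assumes "\<tau> > 0" "r > 0" "R > 0"
  obtains B H \<delta> where "B \<ge> 1" "H > r" "\<delta> > 0"
    "\<And>T x z u s i J t. sampled_loop \<tau> r T x z u \<Longrightarrow> 0 < s \<Longrightarrow> s \<le> R \<Longrightarrow>
       state_bounded \<tau> x u (T i) s \<Longrightarrow> i \<le> J \<Longrightarrow> T J \<le> T i + H \<Longrightarrow>
       (\<And>j. i \<le> j \<Longrightarrow> j < J \<Longrightarrow> state_bounded \<tau> x u (T j) (B * s) \<Longrightarrow> norm (z (T j) - x (T j + \<tau>)) \<le> \<delta> * s) \<Longrightarrow>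
       (t \<in> {T i..T J} \<longrightarrow> state_bounded \<tau> x u t (B * s)) \<and>
       (T i + H - r \<le> T J \<longrightarrow> state_bounded \<tau> x u (T J) (s / 2))"
proof -
  obtain Q where Q: "Q \<ge> 1" "\<And>v \<sigma> p t. v \<in> bounded_inputs \<sigma> \<Longrightarrow> norm p + \<sigma> \<le> R \<Longrightarrow> t \<in> {0..\<tau>} \<Longrightarrow>
      norm (flow v p t) \<le> Q * (norm p + \<sigma>)"
    using flow_linear_bound by blast
  obtain M \<mu> where M: "M \<ge> 1" "\<mu> > 0"
    and decay: "\<And>y t. nominal y \<Longrightarrow> norm (y 0) \<le> Q * R \<Longrightarrow> 0 \<le> t \<Longrightarrow> norm (y t) \<le> M * exp (- \<mu> * t) * norm (y 0)"
    using nominal_decay by metis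
  \<comment> \<open>\<open>A * s\<close> bounds the nominal trajectory, which starts at size at most
    \<open>Q * s\<close>. In \<open>\<rho>\<close> one further \<open>s\<close> is for the distance
    of \<open>P\<close> from it, another for that of \<open>z\<close> from \<open>P\<close>.\<close>
  define A where "A = M * Q"
  have A: "A \<ge> 1" "Q \<le> A" using mult_mono[of 1 M 1 Q] mult_mono[of 1 M Q Q] M(1) Q(1) by (auto simp: A_def)
  define \<rho> where "\<rho> = (A + 2) * R"
  obtain L where L: "L \<ge> 0" "\<And>x y p q. norm x \<le> \<rho> \<Longrightarrow> norm y \<le> \<rho> \<Longrightarrow> norm p \<le> \<rho> \<Longrightarrow> norm q \<le> \<rho> \<Longrightarrow>
       norm (f (x, k p) - f (y, k q)) \<le> L * (norm (x - y) + norm (p - q))"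
    "\<And>p. norm p \<le> \<rho> \<Longrightarrow> norm (k p) \<le> L * norm p" using feedback_lipschitz by metis
  \<comment> \<open>\<open>W\<close> and \<open>H\<close> are chosen for \<open>expH\<close> below.
    Sampling may end the phase up to \<open>r\<close> before \<open>T i + H\<close>, and the state
    at time \<open>T J\<close> consists of values going back to \<open>P\<close> and
    \<open>z\<close> at time \<open>T J - \<tau>\<close>; so only \<open>H - r - \<tau>\<close> is
    available for the nominal decay.\<close>
  define W where "W = 4 * (A * (1 + L))"
  define H where "H = 2 * r + \<tau> + 1 + ln W / \<mu>"
  \<comment> \<open>A reset error grows by at most the factor \<open>E\<close> until the next reset;
    \<open>c\<close> is the resulting deviation of \<open>P\<close> from the nominal trajectory over
    the horizon, per unit of reset error. \<open>\<delta>\<close> makes both deviations smaller than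
    \<open>s\<close> and their part in the final size at most \<open>s / 4\<close>; the other
    \<open>s / 4\<close> is for the nominal decay. In \<open>B\<close>, the part
    \<open>A + 1 + Q\<close> is for \<open>x\<close> and the rest for \<open>u\<close>.\<close>
  define E where "E = exp (L * r)"
  define c where "c = L * E * H * exp (2 * L * H)"
  define \<delta> where "\<delta> = 1 / (4 * ((1 + L) * c + L * E + E + c + 1))"
  define B where "B = A + 1 + Q + 1 + L * (A + 2)"
  have E: "E \<ge> 1" using L(1) \<open>r > 0\<close> by (simp add: E_def)
  have "1 \<le> A * (1 + L)" using L(1) A(1) mult_mono[of 1 A 1 "1 + L"] by simp
  then have W: "1 \<le> W" unfolding W_def by linarith
  then have ln: "0 \<le> ln W" by (rule ln_ge_zero)
  then have "0 \<le> ln W / \<mu>" using M(2) by simp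
  then have H: "H > r" "H > 0" "H - r - \<tau> \<ge> ln W / \<mu>"
    using \<open>r > 0\<close> \<open>\<tau> > 0\<close> unfolding H_def by linarith+
  have c: "c \<ge> 0" using L(1) E H by (simp add: c_def)
  define D where "D = (1 + L) * c + L * E + E + c + 1"
  have "0 \<le> (1 + L) * c" "0 \<le> L * E" using L(1) c E by auto
  then have D: "D > 0" "(1 + L) * c + L * E \<le> D" "E \<le> D" "c \<le> D"
    using c E unfolding D_def by linarith+
  then have D4: "E < 4 * D" "c < 4 * D" by linarith+
  have \<delta>D: "\<delta> = 1 / (4 * D)" by (simp add: \<delta>_def D_def)
  have \<delta>: "\<delta> > 0" "E * \<delta> < 1" "c * \<delta> < 1" "((1 + L) * c + L * E) * \<delta> \<le> 1 / 4"
    using D D4 by (simp_all add: \<delta>D pos_divide_le_eq)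
  have expH: "A * exp (- \<mu> * (H - r - \<tau>)) * (1 + L) \<le> 1 / 4"
  proof -
    have "ln W \<le> \<mu> * (H - r - \<tau>)" using H(3) M(2) by (simp add: field_simps)
    then have "exp (- \<mu> * (H - r - \<tau>)) \<le> exp (- ln W)" by simp
    also have "\<dots> = 1 / W" using W by (simp add: exp_minus inverse_eq_divide)
    finally have "A * (1 + L) * exp (- \<mu> * (H - r - \<tau>)) \<le> A * (1 + L) * (1 / W)"
      using A(1) L(1) by (intro mult_left_mono) auto
    also have "A * (1 + L) = W / 4" by (simp add: W_def)
    also have "W / 4 * (1 / W) = 1 / 4" using W by simp
    finally have "W / 4 * exp (- \<mu> * (H - r - \<tau>)) \<le> 1 / 4" .
    moreover have "W / 4 = A * (1 + L)" by (simp add: W_def)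
    ultimately show ?thesis by (simp only: mult_ac)
  qed
  show ?thesis
  proof (rule that[of B H \<delta>])
    have "0 \<le> L * (A + 2)" using L(1) A(1) by simp
    then show "1 \<le> B" using A(1) Q(1) by (simp add: B_def)
  next
    fix T :: "nat \<Rightarrow> real" and x z :: "real \<Rightarrow> 'a" and u :: "real \<Rightarrow> 'b" and s and i J :: nat and t
    assume SL: "sampled_loop \<tau> r T x z u" and s: "0 < s" "s \<le> R"
      and init: "state_bounded \<tau> x u (T i) s" and iJ: "i \<le> J" "T J \<le> T i + H"
      and err: "\<And>j. i \<le> j \<Longrightarrow> j < J \<Longrightarrow> state_bounded \<tau> x u (T j) (B * s) \<Longrightarrow> norm (z (T j) - x (T j + \<tau>)) \<le> \<delta> * s"
    have part: "time_partition T" and gap: "\<And>i. T (Suc i) - T i \<le> r"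
      and uz: "\<And>i t. T i \<le> t \<Longrightarrow> t < T (Suc i) \<Longrightarrow> u t = k (z t)"
      using SL unfolding sampled_loop_def by (blast, blast, simp)
    have T0: "0 \<le> T j" for j using part by (rule time_partition_nonneg)
    have Tmono: "T j \<le> T l" if "j \<le> l" for j l using part that by (rule time_partition_mono)
    have Tless: "j < l" if "T j < T l" for j l using Tmono[of l j] that by (meson leD leI)
    have u_hist: "norm (u q) \<le> s - norm (x (T i))" if "q \<in> {T i - \<tau>..<T i}" for q
      using init that by (auto simp: state_bounded_def algebra_simps)
    define P where "P q = x (q + \<tau>)" for q
    have Psol: "integral_solution (\<lambda>t y. f (y, u t)) P a b" if "0 \<le> a" for a b
      using sampled_loop_predicted[OF SL _ that] \<open>\<tau> > 0\<close> by (simp add: P_def[abs_def])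
    have x_init: "norm (x (T i + q)) \<le> Q * s" if "q \<in> {0..\<tau>}" for q
      using Q(2)[OF history_bounded_inputs[OF SL \<open>\<tau> > 0\<close> u_hist], of i "x (T i)" q]
        sampled_loop_flow[OF SL \<open>\<tau> > 0\<close> u_hist that, of i] that s by simp
    obtain y0 where y0: "nominal y0" "y0 0 = P (T i)" by (rule nominal_exists)
    define y where "y q = y0 (q - T i)" for q
    have PTi: "norm (P (T i)) \<le> Q * s" using x_init[of \<tau>] \<open>\<tau> > 0\<close> by (simp add: P_def)
    also have "Q * s \<le> Q * R" using Q(1) s by simp
    finally have PTi': "norm (y0 0) \<le> Q * R" by (simp add: y0)
    have y: "norm (y q) \<le> A * exp (- \<mu> * (q - T i)) * s" if "T i \<le> q" for q
    proof -
      have "norm (y q) \<le> M * exp (- \<mu> * (q - T i)) * norm (y0 0)"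
        unfolding y_def using decay[OF y0(1) PTi'] that by simp
      also have "\<dots> \<le> M * exp (- \<mu> * (q - T i)) * (Q * s)"
        using PTi y0(2) M(1) by (intro mult_left_mono) auto
      finally show ?thesis by (simp add: A_def mult_ac)
    qed
    have yA: "norm (y q) \<le> A * s" if "T i \<le> q" for q
    proof -
      have "A * exp (- \<mu> * (q - T i)) * s \<le> A * 1 * s"
        using that M(2) A(1) s by (intro mult_right_mono mult_left_mono) auto
      then show ?thesis using y[OF that] by simp
    qed
    have ysol: "integral_solution (\<lambda>_ y. f (y, k y)) y (T i) (T J)"
    proof -
      have "integral_solution (\<lambda>_ y. f (y, k y)) y0 (T i + - T i) (T J + - T i)"
        using nominal_integral_solution[OF y0(1)] by simp
      then show ?thesis by (subst (asm) integral_solution_shift) (simp add: y_def[abs_def])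
    qed
    have As\<rho>: "(A + 2) * s \<le> \<rho>" using s A(1) by (simp add: \<rho>_def)
    \<comment> \<open>On the first \<open>\<tau>\<close> time units \<open>x\<close> is the response
      to the old input history, later it is the delayed \<open>P\<close>. Likewise \<open>u\<close>
      is old before \<open>T i\<close> and the feedback of \<open>z\<close> afterwards.\<close>
    have bounded: "state_bounded \<tau> x u q (B * s)"
      if q: "q \<in> {T i..T J}" and near: "\<And>p. p \<in> {T i..<q} \<Longrightarrow> norm (P p) \<le> (A + 1) * s \<and> norm (z p - P p) \<le> s" for q
      unfolding state_bounded_def
    proof
      fix p assume p: "p \<in> {q - \<tau>..<q}"
      have "norm (x q) \<le> (A + 1 + Q) * s"
      proof (cases "q \<le> T i + \<tau>")
        case True
        have "Q * s \<le> (A + 1 + Q) * s" using A(1) s by (intro mult_right_mono) auto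
        then show ?thesis using x_init[of "q - T i"] q True by simp
      next
        case False
        have "(A + 1) * s \<le> (A + 1 + Q) * s" using Q(1) s by (intro mult_right_mono) auto
        then show ?thesis using near[of "q - \<tau>"] False \<open>\<tau> > 0\<close> by (simp add: P_def)
      qed
      moreover have "norm (u p) \<le> (1 + L * (A + 2)) * s"
      proof (cases "p < T i")
        case True
        have "norm (u p) \<le> s - norm (x (T i))" using u_hist[of p] True p q by auto
        moreover have "1 * s \<le> (1 + L * (A + 2)) * s"
          using L(1) A(1) s by (intro mult_right_mono) auto
        ultimately show ?thesis using norm_ge_zero[of "x (T i)"] by linarith
      next
        case False
        then obtain j where j: "i \<le> j" "T j \<le> p" "p < T (Suc j)"
          using time_partition_index[OF part, of i p] by auto
        have "norm (z p) \<le> (A + 2) * s"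
          using near[of p] False p norm_triangle_sub[of "z p" "P p"] by (auto simp: distrib_right)
        then have "norm (u p) \<le> L * ((A + 2) * s)"
          using uz[OF j(2,3)] L(3)[of "z p"] As\<rho> mult_left_mono[of "norm (z p)" "(A + 2) * s" L] L(1) by simp
        also have "\<dots> \<le> (1 + L * (A + 2)) * s" using s by (simp add: distrib_right mult.assoc)
        finally show ?thesis .
      qed
      ultimately show "norm (x q) + norm (u p) \<le> B * s" by (simp add: B_def algebra_simps)
    qed
    \<comment> \<open>Induction over the sampling intervals: tracking on the earlier ones bounds the
      state at \<open>T j\<close>, this makes \<open>err\<close> applicable, and Gronwall on a time
      of length at most \<open>r\<close> turns the reset error into \<open>E * \<delta> * s\<close>.
      \<open>P\<close> is assumed bounded only up to \<open>t'\<close>, so that the claim can be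
      used while \<open>P\<close> is still being compared with \<open>y\<close>.\<close>
    have track: "norm (z q - P q) \<le> E * \<delta> * s"
      if P: "\<And>p. p \<in> {T i..t'} \<Longrightarrow> norm (P p) \<le> (A + 1) * s" and tq: "t' < T J" "q \<in> {T i..t'}" for q t'
    proof -
      have "\<forall>q. q \<in> {T j..<T (Suc j)} \<and> q \<le> t' \<longrightarrow> norm (z q - P q) \<le> E * \<delta> * s" if "i \<le> j" for j
        using that
      proof (induction j rule: less_induct)
        case (less j)
        show ?case
        proof (intro allI impI)
          fix q assume q: "q \<in> {T j..<T (Suc j)} \<and> q \<le> t'"
          have jJ: "j < J" using q tq(1) by (intro Tless) auto
          have "state_bounded \<tau> x u (T j) (B * s)"
          proof (rule bounded)
            show "T j \<in> {T i..T J}" using less.prems jJ Tmono by auto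
            fix p assume p: "p \<in> {T i..<T j}"
            then obtain l where l: "i \<le> l" "T l \<le> p" "p < T (Suc l)"
              using time_partition_index[OF part, of i p] by auto
            have "l < j" using l p by (intro Tless) auto
            then have "norm (z p - P p) \<le> E * \<delta> * s" using less.IH[of l] l p q by auto
            also have "\<dots> \<le> s" using \<delta>(2) s by simp
            finally show "norm (P p) \<le> (A + 1) * s \<and> norm (z p - P p) \<le> s" using P p q by auto
          qed
          from err[OF less.prems jJ this] have e: "norm (z (T j) - P (T j)) \<le> \<delta> * s" by (simp add: P_def)
          have len: "q - T j \<le> r" using q gap[of j] by auto
          have ex: "exp (L * (q - T j)) \<le> E" using len L(1) by (auto simp: E_def intro: mult_left_mono)
          have "\<delta> * s * exp (L * (q - T j)) \<le> \<delta> * s * E" using ex \<delta> s by (intro mult_left_mono) auto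
          also have "\<dots> = E * \<delta> * s" by simp
          finally have le: "\<delta> * s * exp (L * (q - T j)) \<le> E * \<delta> * s" .
          also have "\<dots> < s" using \<delta>(2) s by simp
          finally have lt: "\<delta> * s * exp (L * (q - T j)) < s" .
          have zs: "integral_solution (\<lambda>_ y. f (y, k y)) z (T j) q"
            by (rule sampled_loop_feedback[OF SL]) (use q in auto)
          have "norm (z q - P q) \<le> (\<delta> * s + 0 * (q - T j)) * exp (L * (q - T j))"
          proof (rule integral_solution_diff_less(1)[where \<kappa> = s, OF zs Psol[OF T0] L(1) order_refl _ e])
            fix p assume p: "p \<in> {T j..q}" and close: "\<And>r. r \<in> {T j..p} \<Longrightarrow> norm (z r - P r) \<le> s"
            have Pp: "norm (P p) \<le> (A + 1) * s" using P[of p] p q Tmono[OF less.prems] by auto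
            then have "norm (z p) \<le> (A + 2) * s"
              using close[of p] p norm_triangle_sub[of "z p" "P p"] by (auto simp: distrib_right)
            moreover have "(A + 1) * s \<le> (A + 2) * s" using s by simp
            ultimately show "norm (f (z p, k (z p)) - f (P p, u p)) \<le> L * norm (z p - P p) + 0"
              using uz[of j p] p q L(2)[of "z p" "P p" "z p" "z p"] As\<rho> Pp by auto
          qed (use lt q in auto)
          then show "norm (z q - P q) \<le> E * \<delta> * s" using le by simp
        qed
      qed
      moreover obtain j where "i \<le> j" "T j \<le> q" "q < T (Suc j)"
        using time_partition_index[OF part, of i q] tq(2) by auto
      ultimately show ?thesis using tq(2) by auto
    qed
    have TiJ: "T i \<le> T J" using Tmono iJ by auto
    \<comment> \<open>At time \<open>T J\<close> the input already stems from the next reset, which is not controlled yet.\<close>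
    define F where "F q p = f (p, if q < T J then u q else k (y q))" for q p
    have Fsol: "integral_solution F P (T i) (T J)"
      by (rule integral_solution_cong[OF Psol[OF T0]]) (auto simp: F_def)
    \<comment> \<open>\<open>track\<close> is invoked only up to time \<open>p\<close>, where
      closeness of \<open>P\<close> to \<open>y\<close> is assumed;
      \<open>integral_solution_diff_less\<close> then discharges this assumption.\<close>
    have hyp: "norm (F p (P p) - f (y p, k (y p))) \<le> 2 * L * norm (P p - y p) + L * E * \<delta> * s"
      if p: "p \<in> {T i..T J}" and close: "\<And>r. r \<in> {T i..p} \<Longrightarrow> norm (P r - y r) \<le> s" for p
    proof -
      have P: "norm (P q) \<le> (A + 1) * s" if "q \<in> {T i..p}" for q
        using close[OF that] yA[of q] that norm_triangle_sub[of "P q" "y q"] by (auto simp: distrib_right)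
      have in\<rho>: "norm (P p) \<le> \<rho>" "norm (y p) \<le> \<rho>"
      proof -
        have "(A + 1) * s \<le> (A + 2) * s" "A * s \<le> (A + 2) * s" using s by auto
        then show "norm (P p) \<le> \<rho>" "norm (y p) \<le> \<rho>" using P[of p] yA[of p] p As\<rho> by auto
      qed
      have pos: "0 \<le> L * E * \<delta> * s" using L(1) E \<delta> s by simp
      show ?thesis
      proof (cases "p < T J")
        case True
        then have zP: "norm (z p - P p) \<le> E * \<delta> * s" using track[of p p] P p by auto
        also have "\<dots> \<le> s" using \<delta>(2) s by simp
        finally have "norm (z p) \<le> \<rho>"
          using P[of p] p As\<rho> norm_triangle_sub[of "z p" "P p"] by (auto simp: distrib_right)
        moreover obtain j where "T j \<le> p" "p < T (Suc j)" using time_partition_index[OF part, of i p] p by auto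
        ultimately have "norm (F p (P p) - f (y p, k (y p))) \<le> L * (norm (P p - y p) + norm (z p - y p))"
          using L(2)[of "P p" "y p" "z p" "y p"] in\<rho> uz[of j p] True by (simp add: F_def)
        also have "\<dots> \<le> L * (norm (P p - y p) + (norm (P p - y p) + E * \<delta> * s))"
          using norm_triangle_ineq[of "z p - P p" "P p - y p"] zP L(1) by (intro mult_left_mono) auto
        finally show ?thesis by (simp add: algebra_simps)
      next
        case False
        then have "norm (F p (P p) - f (y p, k (y p))) \<le> L * (norm (P p - y p) + norm (y p - y p))"
          using L(2)[of "P p" "y p" "y p" "y p"] in\<rho> by (simp add: F_def)
        also have "\<dots> \<le> 2 * L * norm (P p - y p) + L * E * \<delta> * s"
          using pos L(1) mult_nonneg_nonneg[OF L(1) norm_ge_zero[of "P p - y p"]] by simp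
        finally show ?thesis .
      qed
    qed
    have small: "(0 + L * E * \<delta> * s * (T J - T i)) * exp (2 * L * (T J - T i)) \<le> c * \<delta> * s"
    proof -
      have "(L * E * \<delta> * s * (T J - T i)) * exp (2 * L * (T J - T i)) \<le> (L * E * \<delta> * s * H) * exp (2 * L * H)"
        using iJ TiJ L(1) E \<delta> s H by (intro mult_mono mult_left_mono) (auto intro!: mult_left_mono)
      then show ?thesis by (simp add: c_def mult_ac)
    qed
    also have "\<dots> < s" using \<delta>(3) s by simp
    finally have small': "(0 + L * E * \<delta> * s * (T J - T i)) * exp (2 * L * (T J - T i)) < s" .
    have L2: "0 \<le> 2 * L" "0 \<le> L * E * \<delta> * s" using L(1) E \<delta> s by auto
    have start: "norm (P (T i) - y (T i)) \<le> 0" using y0(2) by (simp add: y_def)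
    have Py: "norm (P q - y q) \<le> c * \<delta> * s" "norm (P q - y q) < s" if "q \<in> {T i..T J}" for q
      using integral_solution_diff_less[where \<kappa> = s, OF Fsol ysol L2 hyp start small' that] small by auto
    have PA: "norm (P q) \<le> (A + 1) * s" if "q \<in> {T i..T J}" for q
      using Py(2)[OF that] yA[of q] that norm_triangle_sub[of "P q" "y q"] by (auto simp: distrib_right)
    have zP: "norm (z q - P q) \<le> E * \<delta> * s" if "q \<in> {T i..<T J}" for q
      using track[of q q] PA that by auto
    have Es: "E * \<delta> * s \<le> s" using \<delta>(2) s by simp
    have zP': "norm (z q - P q) \<le> s" if "q \<in> {T i..<T J}" for q using zP[OF that] Es by simp
    have "state_bounded \<tau> x u t (B * s)" if t: "t \<in> {T i..T J}"
      by (rule bounded[OF t]) (use PA zP' t in simp)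
    moreover have "state_bounded \<tau> x u (T J) (s / 2)" if late: "T i + H - r \<le> T J"
      unfolding state_bounded_def
    proof
      fix p assume p: "p \<in> {T J - \<tau>..<T J}"
      define a where "a = A * exp (- \<mu> * (H - r - \<tau>)) * s"
      have HT: "0 \<le> H - r - \<tau>" using H(3) divide_nonneg_pos[OF ln M(2)] by linarith
      have Pl: "norm (P q) \<le> a + c * \<delta> * s" if q: "q \<in> {T J - \<tau>..T J}" for q
      proof -
        have q': "q \<in> {T i..T J}" "H - r - \<tau> \<le> q - T i" using q late HT by auto
        have "A * exp (- \<mu> * (q - T i)) * s \<le> a"
          unfolding a_def using q' M(2) A(1) s by (intro mult_right_mono mult_left_mono) auto
        then show ?thesis using y[of q] Py(1)[OF q'(1)] q' norm_triangle_sub[of "P q" "y q"] by auto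
      qed
      have "norm (x (T J)) \<le> a + c * \<delta> * s" using Pl[of "T J - \<tau>"] \<open>\<tau> > 0\<close> by (simp add: P_def)
      moreover have "norm (u p) \<le> L * (a + c * \<delta> * s + E * \<delta> * s)"
      proof -
        have p': "p \<in> {T i..<T J}" using p late HT by auto
        then obtain j where j: "T j \<le> p" "p < T (Suc j)" using time_partition_index[OF part, of i p] by auto
        have "norm (z p) \<le> (A + 2) * s"
          using zP[OF p'] Es PA[of p] p' norm_triangle_sub[of "z p" "P p"] by (auto simp: distrib_right)
        then have "norm (u p) \<le> L * norm (z p)" using uz[OF j] L(3)[of "z p"] As\<rho> by simp
        also have "\<dots> \<le> L * (a + c * \<delta> * s + E * \<delta> * s)"
          using zP[OF p'] Pl[of p] p norm_triangle_sub[of "z p" "P p"] L(1) by (intro mult_left_mono) auto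
        finally show ?thesis .
      qed
      moreover have "a + c * \<delta> * s + L * (a + c * \<delta> * s + E * \<delta> * s) \<le> s / 2"
      proof -
        have "a + c * \<delta> * s + L * (a + c * \<delta> * s + E * \<delta> * s) =
          (A * exp (- \<mu> * (H - r - \<tau>)) * (1 + L) + ((1 + L) * c + L * E) * \<delta>) * s"
          by (simp add: a_def algebra_simps)
        also have "\<dots> \<le> (1 / 4 + 1 / 4) * s" using expH \<delta>(4) s by (intro mult_right_mono add_mono) auto
        finally show ?thesis by simp
      qed
      ultimately show "norm (x (T J)) + norm (u p) \<le> s / 2" by simp
    qed
    ultimately show "(t \<in> {T i..T J} \<longrightarrow> state_bounded \<tau> x u t (B * s)) \<and>
       (T i + H - r \<le> T J \<longrightarrow> state_bounded \<tau> x u (T J) (s / 2))" by blast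
  qed (use H \<delta> in auto)
qed

end

section \<open>From single phases to exponential decay\<close>

definition state_size :: "real \<Rightarrow> (real \<Rightarrow> 'a::euclidean_space) \<Rightarrow> (real \<Rightarrow> 'b::euclidean_space) \<Rightarrow> real \<Rightarrow> real" where
  "state_size \<tau> x u t = norm (x t) + sup_norm_on {t - \<tau>..<t} u"

lemma sup_norm_on_upper:
  assumes "bounded (u ` I)" "s \<in> I"
  shows "norm (u s) \<le> sup_norm_on I u"
  unfolding sup_norm_on_def
  by (rule cSUP_upper[OF assms(2)]) (use assms(1) in \<open>auto simp: bounded_iff bdd_above_def\<close>)

lemma sup_norm_on_nonneg:
  assumes "bounded (u ` I)" "I \<noteq> {}"
  shows "0 \<le> sup_norm_on I u"
  using sup_norm_on_upper[OF assms(1)] assms(2) norm_ge_zero order_trans by blast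

lemma state_bounded_iff:
  assumes "\<tau> > 0" "bounded (u ` {t - \<tau>..<t})"
  shows "state_bounded \<tau> x u t c \<longleftrightarrow> state_size \<tau> x u t \<le> c"
proof
  assume "state_bounded \<tau> x u t c"
  then have "sup_norm_on {t - \<tau>..<t} u \<le> c - norm (x t)"
    unfolding sup_norm_on_def by (intro cSUP_least) (use assms(1) in \<open>auto simp: state_bounded_def algebra_simps\<close>)
  then show "state_size \<tau> x u t \<le> c" by (simp add: state_size_def)
next
  assume "state_size \<tau> x u t \<le> c"
  then show "state_bounded \<tau> x u t c"
    using sup_norm_on_upper[OF assms(2)] by (fastforce simp: state_bounded_def state_size_def)
qed

context stabilized_system
begin

text \<open>Phases are used at the scales \<open>2 ^ n\<close>, each with its own constants, but
  \<open>\<omega>\<close> comes from the scale \<open>2 ^ 0\<close> alone. The admissible reset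
  error is a function of the current size, since a reset knows the current state but not the phase
  in progress.\<close>

lemma sampled_loop_decay:
  assumes "\<tau> > 0" "r > 0"
  obtains \<epsilon> D :: "nat \<Rightarrow> real" and \<omega> where "\<And>m. \<epsilon> m > 0" "\<And>m. D m \<ge> 0" "\<omega> > 0"
    "\<And>T x z u m t. sampled_loop \<tau> r T x z u \<Longrightarrow> (\<And>j. bounded (u ` {T j - \<tau>..<T j})) \<Longrightarrow>
       (\<And>j. norm (z (T j) - x (T j + \<tau>)) \<le> \<epsilon> (nat \<lceil>state_size \<tau> x u (T j)\<rceil>) * state_size \<tau> x u (T j)) \<Longrightarrow>
       state_size \<tau> x u 0 \<le> real m \<Longrightarrow> 0 \<le> t \<Longrightarrow>
       state_bounded \<tau> x u t (exp (- \<omega> * t) * (D m * state_size \<tau> x u 0))"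
proof -
  have "\<forall>n::nat. \<exists>B H \<delta>. B \<ge> 1 \<and> H > r \<and> \<delta> > 0 \<and>
    (\<forall>T x z u s i J t. sampled_loop \<tau> r T x z u \<longrightarrow> 0 < s \<longrightarrow> s \<le> 2 ^ n \<longrightarrow>
       state_bounded \<tau> x u (T i) s \<longrightarrow> i \<le> J \<longrightarrow> T J \<le> T i + H \<longrightarrow>
       (\<forall>j. i \<le> j \<longrightarrow> j < J \<longrightarrow> state_bounded \<tau> x u (T j) (B * s) \<longrightarrow> norm (z (T j) - x (T j + \<tau>)) \<le> \<delta> * s) \<longrightarrow>
       (t \<in> {T i..T J} \<longrightarrow> state_bounded \<tau> x u t (B * s)) \<and>
       (T i + H - r \<le> T J \<longrightarrow> state_bounded \<tau> x u (T J) (s / 2)))"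
  proof
    fix n :: nat
    have R: "(2::real) ^ n > 0" by simp
    show "\<exists>B H \<delta>. B \<ge> 1 \<and> H > r \<and> \<delta> > 0 \<and>
    (\<forall>T x z u s i J t. sampled_loop \<tau> r T x z u \<longrightarrow> 0 < s \<longrightarrow> s \<le> 2 ^ n \<longrightarrow>
       state_bounded \<tau> x u (T i) s \<longrightarrow> i \<le> J \<longrightarrow> T J \<le> T i + H \<longrightarrow>
       (\<forall>j. i \<le> j \<longrightarrow> j < J \<longrightarrow> state_bounded \<tau> x u (T j) (B * s) \<longrightarrow> norm (z (T j) - x (T j + \<tau>)) \<le> \<delta> * s) \<longrightarrow>
       (t \<in> {T i..T J} \<longrightarrow> state_bounded \<tau> x u t (B * s)) \<and>
       (T i + H - r \<le> T J \<longrightarrow> state_bounded \<tau> x u (T J) (s / 2)))"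
      by (rule sampled_loop_phase[OF assms R], intro exI conjI allI impI; (assumption | blast)?)
  qed
  then obtain B H \<delta> where B: "\<And>n::nat. B n \<ge> 1" and H: "\<And>n. H n > r" and \<delta>: "\<And>n. \<delta> n > 0" and
    phase: "\<forall>n T x z u s i J t. sampled_loop \<tau> r T x z u \<longrightarrow> 0 < s \<longrightarrow> s \<le> 2 ^ n \<longrightarrow>
       state_bounded \<tau> x u (T i) s \<longrightarrow> i \<le> J \<longrightarrow> T J \<le> T i + H n \<longrightarrow>
       (\<forall>j. i \<le> j \<longrightarrow> j < J \<longrightarrow> state_bounded \<tau> x u (T j) (B n * s) \<longrightarrow> norm (z (T j) - x (T j + \<tau>)) \<le> \<delta> n * s) \<longrightarrow>
       (t \<in> {T i..T J} \<longrightarrow> state_bounded \<tau> x u t (B n * s)) \<and>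
       (T i + H n - r \<le> T J \<longrightarrow> state_bounded \<tau> x u (T J) (s / 2))"
    unfolding choice_iff by (elim exE) blast
  \<comment> \<open>A state of size \<open>m > 2 ^ n\<close> has to meet the error bound for all scales up to \<open>n + 1 \<le> m\<close>, but not
    for smaller ones, because the phase started at scale \<open>2 ^ (n + 1)\<close> ends below \<open>2 ^ n\<close>.\<close>
  define \<epsilon> where "\<epsilon> m = Min ((\<lambda>n. \<delta> n / B n) ` {..m})" for m
  have \<epsilon>: "\<epsilon> m > 0" for m
    unfolding \<epsilon>_def using \<delta> B by (subst Min_gr_iff) (auto intro!: divide_pos_pos simp: less_le_trans[OF zero_less_one])
  have \<epsilon>_le: "\<epsilon> m \<le> \<delta> n / B n" if "n \<le> m" for m n
    unfolding \<epsilon>_def using that by (intro Min_le) auto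
  \<comment> \<open>In the unit ball each halving takes at most time \<open>H 0\<close>.\<close>
  define \<omega> where "\<omega> = ln 2 / H 0"
  have H0: "H n > 0" for n using H[of n] \<open>r > 0\<close> by simp
  have \<omega>: "\<omega> > 0" using H0 by (simp add: \<omega>_def)
  \<comment> \<open>\<open>G m\<close> and \<open>K m\<close> bound the time spent and the size
    attained on the way down from \<open>2 ^ m\<close> to the unit ball. In \<open>D\<close>, the
    factor \<open>exp (\<omega> * G m)\<close> pays for this time, and \<open>2 * B 0\<close> covers
    the decay afterwards.\<close>
  define G where "G m = (\<Sum>l\<le>m. H l)" for m
  define K where "K m = (\<Sum>l\<le>m. B l * 2 ^ l)" for m
  have K: "K m \<ge> 1" for m
  proof -
    have "B 0 * 2 ^ 0 \<le> K m" unfolding K_def using B by (intro member_le_sum) (auto simp: order_trans[OF zero_le_one])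
    then show ?thesis using B[of 0] by simp
  qed
  have G: "G m \<ge> 0" for m unfolding G_def using H0 by (intro sum_nonneg) (auto intro: less_imp_le)
  define D where "D m = (2 * B 0 + K m) * exp (\<omega> * G m)" for m
  have expG: "1 \<le> exp (\<omega> * G m)" for m using \<omega> G by simp
  have D: "D m \<ge> 0" "2 * B 0 \<le> D m" for m
  proof -
    have "2 * B 0 * 1 \<le> D m" unfolding D_def using expG K[of m] B[of 0] by (intro mult_mono) auto
    then show "D m \<ge> 0" "2 * B 0 \<le> D m" using B[of 0] by auto
  qed
  show ?thesis
  proof (rule that[of \<epsilon> D \<omega>])
    fix T :: "nat \<Rightarrow> real" and x z :: "real \<Rightarrow> 'a" and u :: "real \<Rightarrow> 'b" and m :: nat and t :: real
    assume SL: "sampled_loop \<tau> r T x z u" and ub: "\<And>j. bounded (u ` {T j - \<tau>..<T j})"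
      and err: "\<And>j. norm (z (T j) - x (T j + \<tau>)) \<le> \<epsilon> (nat \<lceil>state_size \<tau> x u (T j)\<rceil>) * state_size \<tau> x u (T j)"
      and init: "state_size \<tau> x u 0 \<le> real m" and t: "0 \<le> t"
    let ?S = "state_bounded \<tau> x u"
    have part: "time_partition T" and gap: "\<And>i. T (Suc i) - T i \<le> r"
      using SL by (auto simp: sampled_loop_def)
    have T0: "T 0 = 0" using part by (simp add: time_partition_def)
    have Tmono: "T j \<le> T l" if "j \<le> l" for j l using part that by (rule time_partition_mono)
    have size: "?S (T j) c \<longleftrightarrow> state_size \<tau> x u (T j) \<le> c" for j c
      by (rule state_bounded_iff[OF \<open>\<tau> > 0\<close> ub])
    have size0: "0 \<le> state_size \<tau> x u (T j)" for j
      unfolding state_size_def using sup_norm_on_nonneg[OF ub[of j]] \<open>\<tau> > 0\<close> by simp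
    \<comment> \<open>This is the reason for the division by \<open>B n\<close> in
      \<open>\<epsilon>\<close>: the current size may be as large as \<open>B n * s\<close>, while
      the phase needs an error relative to its initial size \<open>s\<close>.\<close>
    have err_le: "norm (z (T j) - x (T j + \<tau>)) \<le> \<delta> n * s"
      if "n \<le> nat \<lceil>state_size \<tau> x u (T j)\<rceil>" "?S (T j) (B n * s)" for j n s
    proof -
      have "norm (z (T j) - x (T j + \<tau>)) \<le> \<delta> n / B n * (B n * s)"
        using that(2) size0[of j] \<delta>[of n] B[of n]
        by (intro order_trans[OF err] mult_mono \<epsilon>_le[OF that(1)]) (auto simp: size)
      also have "\<dots> = \<delta> n * s" using B[of n] by simp
      finally show ?thesis .
    qed
    have last_sample: "\<exists>J\<ge>i. T J \<le> T i + H n \<and> T i + H n - r \<le> T J" for i n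
    proof -
      obtain J where "i \<le> J" "T J \<le> T i + H n" "T i + H n < T (Suc J)"
        using time_partition_index[OF part, of i "T i + H n"] H0[of n] by auto
      then show ?thesis using gap[of J] by auto
    qed
    \<comment> \<open>Successive phases at scale 0. The phase starting from size
      \<open>s / 2 ^ n\<close> ends at most \<open>(n + 1) * H 0\<close> after \<open>T i\<close>,
      so the exponential is still at least \<open>1 / 2 ^ (n + 1)\<close> during it; comparison with
      the overshoot \<open>B 0 * s / 2 ^ n\<close> explains the factor 2. Since each phase lasts at
      least \<open>H 0 - r > 0\<close>, all times are reached.\<close>
    have local_decay: "?S t (2 * B 0 * s * exp (- \<omega> * (t - T i)))"
      if s: "0 < s" "s \<le> 1" and Si: "?S (T i) s" and t: "T i \<le> t" for s i t
    proof -
      have "\<exists>j\<ge>i. T i + real n * (H 0 - r) \<le> T j \<and> T j \<le> T i + real n * H 0 \<and> ?S (T j) (s / 2 ^ n) \<and>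
         (\<forall>t\<in>{T i..T j}. ?S t (2 * B 0 * s * exp (- \<omega> * (t - T i))))" for n
      proof (induction n)
        case 0
        have "?S (T i) (2 * B 0 * s)"
          using Si by (rule state_bounded_mono) (use B[of 0] s in auto)
        then show ?case using Si by (intro exI[of _ i]) auto
      next
        case (Suc n)
        then obtain j where j: "i \<le> j" "T i + real n * (H 0 - r) \<le> T j" "T j \<le> T i + real n * H 0"
          "?S (T j) (s / 2 ^ n)" "\<And>t. t \<in> {T i..T j} \<Longrightarrow> ?S t (2 * B 0 * s * exp (- \<omega> * (t - T i)))" by blast
        obtain J where J: "j \<le> J" "T J \<le> T j + H 0" "T j + H 0 - r \<le> T J" using last_sample by blast
        have s': "0 < s / 2 ^ n" "s / 2 ^ n \<le> 2 ^ 0"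
          using s(1) order_trans[OF s(2) one_le_power[of "2::real" n]] by (simp_all add: divide_le_eq)
        have ph: "(t \<in> {T j..T J} \<longrightarrow> ?S t (B 0 * (s / 2 ^ n))) \<and>
           (T j + H 0 - r \<le> T J \<longrightarrow> ?S (T J) (s / 2 ^ n / 2))" for t
          by (rule phase[rule_format, OF SL s' j(4) J(1,2)]) (rule err_le, simp_all)
        have "?S t (2 * B 0 * s * exp (- \<omega> * (t - T i)))" if "t \<in> {T j..T J}" for t
        proof (rule state_bounded_mono)
          show "?S t (B 0 * (s / 2 ^ n))" using ph that by blast
          have "t - T i \<le> real (Suc n) * H 0" using that j(3) J(2) by (simp add: algebra_simps)
          then have "\<omega> * (t - T i) \<le> \<omega> * (real (Suc n) * H 0)" using \<omega> by simp
          also have "\<dots> = real (Suc n) * ln 2" using H0[of 0] by (simp add: \<omega>_def)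
          finally have "exp (- (real (Suc n) * ln 2)) \<le> exp (- \<omega> * (t - T i))" by simp
          moreover have "exp (- (real (Suc n) * ln 2)) = 1 / 2 ^ Suc n"
            by (simp only: exp_minus exp_of_nat_mult exp_ln zero_less_numeral inverse_eq_divide)
          ultimately have "1 / 2 ^ Suc n \<le> exp (- \<omega> * (t - T i))" by (simp only:)
          then have "2 * B 0 * s * (1 / 2 ^ Suc n) \<le> 2 * B 0 * s * exp (- \<omega> * (t - T i))"
            by (rule mult_left_mono) (use B[of 0] s in auto)
          then show "B 0 * (s / 2 ^ n) \<le> 2 * B 0 * s * exp (- \<omega> * (t - T i))" by simp
        qed
        then have "?S t (2 * B 0 * s * exp (- \<omega> * (t - T i)))" if "t \<in> {T i..T J}" for t
          using that j(5)[of t] by (cases "t \<le> T j") auto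
        moreover have "?S (T J) (s / 2 ^ Suc n)" using ph J(3) by (simp add: mult.commute)
        ultimately show ?case using j J by (intro exI[of _ J]) (auto simp: algebra_simps)
      qed note steps = this
      obtain n :: nat where n: "t - T i \<le> real n * (H 0 - r)"
        using reals_Archimedean3[of "H 0 - r"] H[of 0] by (metis diff_gt_0_iff_gt less_imp_le)
      show ?thesis using steps[of n] n t by fastforce
    qed
    \<comment> \<open>A phase at scale \<open>2 ^ Suc n\<close> may lose its error bound once the
      state is below \<open>2 ^ n\<close>, as \<open>\<epsilon>\<close> then takes fewer scales into
      account. It is therefore stopped at the first sample \<open>J\<close> with size at most
      \<open>2 ^ n\<close>, where the induction hypothesis takes over; such a sample exists, since
      otherwise the full phase would end with one.\<close>
    have reach_unit: "\<exists>j\<ge>i. T j \<le> T i + G n \<and> ?S (T j) 1 \<and> (\<forall>t\<in>{T i..T j}. ?S t (K n))"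
      if "?S (T i) (2 ^ n)" for i n
      using that
    proof (induction n arbitrary: i)
      case 0
      then show ?case using G K[of 0] by (intro exI[of _ i]) (auto intro: state_bounded_mono)
    next
      case (Suc n)
      have small: "norm (z (T j) - x (T j + \<tau>)) \<le> \<delta> (Suc n) * 2 ^ Suc n"
        if "\<not> ?S (T j) (2 ^ n)" "?S (T j) (B (Suc n) * 2 ^ Suc n)" for j
      proof (rule err_le[OF _ that(2)])
        have "real (2 ^ n) < state_size \<tau> x u (T j)" using that(1) by (simp add: size)
        then have "2 ^ n \<le> nat \<lceil>state_size \<tau> x u (T j)\<rceil>" by linarith
        then show "Suc n \<le> nat \<lceil>state_size \<tau> x u (T j)\<rceil>" using less_exp[of n] by linarith
      qed
      have ph: "(t \<in> {T i..T J} \<longrightarrow> ?S t (B (Suc n) * 2 ^ Suc n)) \<and>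
           (T i + H (Suc n) - r \<le> T J \<longrightarrow> ?S (T J) (2 ^ Suc n / 2))"
        if "i \<le> J" "T J \<le> T i + H (Suc n)" "\<And>j. i \<le> j \<Longrightarrow> j < J \<Longrightarrow> \<not> ?S (T j) (2 ^ n)" for J t
        by (rule phase[rule_format, OF SL _ order_refl Suc.prems that(1,2)])
           (simp, rule small[OF that(3)], assumption+)
      obtain J0 where J0: "i \<le> J0" "T J0 \<le> T i + H (Suc n)" "T i + H (Suc n) - r \<le> T J0" using last_sample by blast
      have "\<exists>J. i \<le> J \<and> J \<le> J0 \<and> ?S (T J) (2 ^ n)"
      proof (rule ccontr)
        assume none: "\<not> (\<exists>J. i \<le> J \<and> J \<le> J0 \<and> ?S (T J) (2 ^ n))"
        then have "?S (T J0) (2 ^ Suc n / 2)" using ph[OF J0(1,2)] J0(3) by auto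
        then show False using none J0(1) by auto
      qed
      define J where "J = (LEAST J. i \<le> J \<and> J \<le> J0 \<and> ?S (T J) (2 ^ n))"
      have J: "i \<le> J" "J \<le> J0" "?S (T J) (2 ^ n)"
        using LeastI_ex[OF \<open>\<exists>J. i \<le> J \<and> J \<le> J0 \<and> ?S (T J) (2 ^ n)\<close>] by (simp_all add: J_def)
      have least: "\<not> ?S (T j) (2 ^ n)" if "i \<le> j" "j < J" for j
        using not_less_Least[OF that(2)[unfolded J_def]] that J(2) by simp
      have TJ: "T J \<le> T i + H (Suc n)" using Tmono[OF J(2)] J0(2) by simp
      obtain j where j: "J \<le> j" "T j \<le> T J + G n" "?S (T j) 1" "\<forall>t\<in>{T J..T j}. ?S t (K n)"
        using Suc.IH[OF J(3)] by blast
      have Kn: "K n \<le> K (Suc n)" "B (Suc n) * 2 ^ Suc n \<le> K (Suc n)"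
        using K[of n] B[of "Suc n"] by (auto simp: K_def)
      have "?S t (K (Suc n))" if "t \<in> {T i..T j}" for t
      proof (cases "t \<le> T J")
        case True
        then have "?S t (B (Suc n) * 2 ^ Suc n)" using ph[OF J(1) TJ least] that by auto
        then show ?thesis by (rule state_bounded_mono) (rule Kn)
      next
        case False
        then have "?S t (K n)" using j(4) that by auto
        then show ?thesis by (rule state_bounded_mono) (rule Kn)
      qed
      moreover have "T j \<le> T i + G (Suc n)" using j(2) TJ by (simp add: G_def)
      ultimately show ?case using j J(1) by (intro exI[of _ j]) auto
    qed
    define s0 where "s0 = state_size \<tau> x u 0"
    have s0: "0 \<le> s0" "s0 \<le> real m" using size0[of 0] init by (auto simp: s0_def T0)
    have start: "?S (T 0) c" if "s0 \<le> c" for c using that size[of 0 c] by (simp add: s0_def T0)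
    have loc0: "?S t (2 * B 0 * s * exp (- \<omega> * t))" if "0 < s" "s \<le> 1" "s0 \<le> s" for s
      using local_decay[OF that(1,2) start[OF that(3)]] t by (simp add: T0)
    show "?S t (exp (- \<omega> * t) * (D m * state_size \<tau> x u 0))"
      unfolding s0_def[symmetric]
    proof (cases "s0 \<le> 1")
      case True
      have "?S t (exp (- \<omega> * t) * (2 * B 0 * s0))"
      proof (cases "s0 = 0")
        case False
        then show ?thesis using loc0[of s0] True s0(1) by (simp add: mult_ac)
      next
        \<comment> \<open>Phases need a positive size; for \<open>s0 = 0\<close> the estimate is
          obtained from arbitrarily small positive \<open>s\<close>.\<close>
        case zero: True
        show ?thesis unfolding state_bounded_def
        proof
          fix p assume p: "p \<in> {t - \<tau>..<t}"
          have "norm (x t) + norm (u p) \<le> 0 + e" if "e > 0" for e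
          proof -
            define s where "s = min 1 (e / (2 * B 0 * exp (- \<omega> * t)))"
            have pos: "2 * B 0 * exp (- \<omega> * t) > 0" using B[of 0] by simp
            have s: "0 < s" "s \<le> 1" "2 * B 0 * exp (- \<omega> * t) * s \<le> e"
              using that pos by (auto simp: s_def min_def field_simps)
            have "norm (x t) + norm (u p) \<le> 2 * B 0 * s * exp (- \<omega> * t)"
              using loc0[OF s(1,2)] zero s(1) p by (auto simp: state_bounded_def)
            also have "\<dots> \<le> e" using s(3) by (simp add: mult_ac)
            finally show ?thesis by simp
          qed
          then show "norm (x t) + norm (u p) \<le> exp (- \<omega> * t) * (2 * B 0 * s0)"
            unfolding zero by (simp add: field_le_epsilon)
        qed
      qed
      then show "?S t (exp (- \<omega> * t) * (D m * s0))"
        by (rule state_bounded_mono) (use D(2)[of m] s0 in \<open>intro mult_left_mono mult_right_mono, auto\<close>)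
    next
      case False
      have "real m \<le> 2 ^ m" using of_nat_less_two_power[of m, where ?'a = real] by simp
      then have "?S (T 0) (2 ^ m)" using s0(2) by (intro start) linarith
      from reach_unit[OF this] obtain j where j: "T j \<le> G m" "?S (T j) 1" "\<And>t. t \<in> {T 0..T j} \<Longrightarrow> ?S t (K m)"
        by (auto simp: T0)
      have "?S t (exp (- \<omega> * t) * D m)"
      proof (cases "t \<le> T j")
        case True
        then have "?S t (K m)" using j(3)[of t] t by (simp add: T0)
        then show ?thesis
        proof (rule state_bounded_mono)
          have "\<omega> * t \<le> \<omega> * G m" using True j(1) \<omega> by simp
          then have "K m * 1 \<le> (2 * B 0 + K m) * exp (\<omega> * G m - \<omega> * t)"
            using K[of m] B[of 0] by (intro mult_mono) auto
          then show "K m \<le> exp (- \<omega> * t) * D m" by (simp add: D_def exp_diff exp_minus field_simps)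
        qed
      next
        case False
        then have "?S t (2 * B 0 * 1 * exp (- \<omega> * (t - T j)))" by (intro local_decay j(2)) auto
        then show ?thesis
        proof (rule state_bounded_mono)
          have "\<omega> * T j \<le> \<omega> * G m" using j(1) \<omega> by simp
          then have "2 * B 0 * exp (- \<omega> * (t - T j)) \<le> (2 * B 0 + K m) * exp (\<omega> * G m - \<omega> * t)"
            using K[of m] B[of 0] by (intro mult_mono) (auto simp: algebra_simps)
          then show "2 * B 0 * 1 * exp (- \<omega> * (t - T j)) \<le> exp (- \<omega> * t) * D m"
            by (simp add: D_def exp_diff exp_minus field_simps)
        qed
      qed
      then show "?S t (exp (- \<omega> * t) * (D m * s0))"
      proof (rule state_bounded_mono)
        have "D m * 1 \<le> D m * s0" using False D(1) by (intro mult_left_mono) auto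
        then show "exp (- \<omega> * t) * D m \<le> exp (- \<omega> * t) * (D m * s0)" by simp
      qed
    qed
  qed (use \<epsilon> D \<omega> in auto)
qed

end

section \<open>Regularity and existence of closed-loop solutions\<close>

lemma borel_measurable_lebesgue_on_Un:
  fixes u :: "real \<Rightarrow> 'b::euclidean_space"
  assumes "S \<in> sets lebesgue" "T \<in> sets lebesgue"
    and "u \<in> borel_measurable (lebesgue_on S)" "u \<in> borel_measurable (lebesgue_on T)"
  shows "u \<in> borel_measurable (lebesgue_on (S \<union> T))"
proof -
  have "(\<lambda>s. if s \<in> S then u s else 0) \<in> borel_measurable lebesgue"
    "(\<lambda>s. if s \<in> T then u s else 0) \<in> borel_measurable lebesgue"
    using assms by (simp_all add: borel_measurable_if)
  then have "(\<lambda>s. if s \<in> S then (if s \<in> S then u s else 0) else (if s \<in> T then u s else 0)) \<in> borel_measurable lebesgue"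
    by (rule measurable_If_set) (use assms(1) in simp_all)
  also have "(\<lambda>s. if s \<in> S then (if s \<in> S then u s else 0) else (if s \<in> T then u s else 0)) =
      (\<lambda>s. if s \<in> S \<union> T then u s else 0)" by auto
  finally show ?thesis by (rule borel_measurable_if_D)
qed

text \<open>The endpoint \<open>s = n h\<close> is excluded: in the closed loop it is the sampling time itself, where the
  value of \<open>u\<close> is only determined by the outcome of the predictor.\<close>

lemma predictor_seq_cong:
  fixes f :: "'a::euclidean_space \<times> 'b::euclidean_space \<Rightarrow> 'a"
  assumes eq: "\<And>s. 0 \<le> s \<Longrightarrow> s < real n * h \<Longrightarrow> v s = w s" and "0 \<le> h" "j \<le> n"
  shows "predictor_seq f v h \<xi> j = predictor_seq f w h \<xi> j"
  using \<open>j \<le> n\<close>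
proof (induction j)
  case (Suc j)
  let ?z = "predictor_seq f w h \<xi> j"
  have "integral {real j * h..real (Suc j) * h} (\<lambda>s. f (?z, v s)) =
        integral {real j * h..real (Suc j) * h} (\<lambda>s. f (?z, w s))"
  proof (rule integral_spike[of "{real (Suc j) * h}"])
    fix s assume s: "s \<in> {real j * h..real (Suc j) * h} - {real (Suc j) * h}"
    have "0 \<le> real j * h" "real (Suc j) * h \<le> real n * h"
      using \<open>0 \<le> h\<close> Suc.prems by (auto intro!: mult_right_mono simp del: of_nat_Suc)
    then show "f (?z, w s) = f (?z, v s)" using eq[of s] s by auto
  qed simp
  then show ?case using Suc by simp
qed simp

text \<open>For \<open>n = 0\<close> the step size is \<open>\<tau> / 0 = 0\<close> and equality
  fails. The lemmas on the closed loop allow an arbitrary \<open>N\<close>, so this case has to be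
  covered.\<close>

lemma divide_nat_mult_le: "0 < \<tau> \<Longrightarrow> real n * (\<tau> / real n) \<le> \<tau>"
  by (cases "n = 0") auto

context stabilized_system
begin

text \<open>In the closed loop \<open>z\<close> is given on half-open sampling intervals only.
  Identified with a nominal trajectory it extends beyond the right endpoint, and this makes the
  input measurable and bounded up to there.\<close>

lemma nominal_unique:
  assumes z: "integral_solution (\<lambda>_ y. f (y, k y)) z a b" and y: "nominal y" "y 0 = z a" and t: "t \<in> {a..b}"
  shows "z t = y (t - a)"
proof -
  have "integral_solution (\<lambda>_ y. f (y, k y)) y (a + - a) (b + - a)"
    using nominal_integral_solution[OF y(1)] by simp
  then have y': "integral_solution (\<lambda>_ y. f (y, k y)) (\<lambda>t. y (t - a)) a b"
    by (subst (asm) integral_solution_shift) simp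
  obtain \<rho>1 where 1: "\<And>t. t \<in> {a..b} \<Longrightarrow> norm (z t) \<le> \<rho>1" using integral_solution_bounded[OF z] by blast
  obtain \<rho>2 where 2: "\<And>t. t \<in> {a..b} \<Longrightarrow> norm (y (t - a)) \<le> \<rho>2" using integral_solution_bounded[OF y'] by blast
  define \<rho> where "\<rho> = \<bar>\<rho>1\<bar> + \<bar>\<rho>2\<bar>"
  obtain L where L: "L \<ge> 0" "\<And>x y p q. norm x \<le> \<rho> \<Longrightarrow> norm y \<le> \<rho> \<Longrightarrow> norm p \<le> \<rho> \<Longrightarrow> norm q \<le> \<rho> \<Longrightarrow>
       norm (f (x, k p) - f (y, k q)) \<le> L * (norm (x - y) + norm (p - q))" using feedback_lipschitz by metis
  have "norm (z t - y (t - a)) \<le> (norm (z a - y (a - a)) + 0 * (b - a)) * exp (2 * L * (t - a))"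
  proof (rule integral_solution_diff_le[OF z y' _ order_refl _ t])
    fix s assume s: "s \<in> {a..b}"
    have "norm (z s) \<le> \<rho>" "norm (y (s - a)) \<le> \<rho>" using 1[OF s] 2[OF s] by (auto simp: \<rho>_def)
    then show "norm (f (z s, k (z s)) - f (y (s - a), k (y (s - a)))) \<le> 2 * L * norm (z s - y (s - a)) + 0"
      using L(2)[of "z s" "y (s - a)" "z s" "y (s - a)"] by simp
  qed (use L in auto)
  then show ?thesis using y(2) by simp
qed

lemma nominal_continuous_on: "nominal y \<Longrightarrow> 0 \<le> a \<Longrightarrow> continuous_on {a..b} y"
  using integral_solution_continuous_on[OF nominal_integral_solution] .

lemma k_continuous_on: "continuous_on A k"
  by (rule continuously_differentiable_continuous_on[OF k_C1])

lemma feedback_nominal: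
  assumes y: "nominal y" and u: "\<And>t. t \<in> {a..<b} \<Longrightarrow> u t = k (y (t - a))"
  shows "u \<in> borel_measurable (lebesgue_on {a..<b})" "bounded (u ` {a..<b})"
proof -
  have cont: "continuous_on {a..b} (\<lambda>t. k (y (t - a)))"
    by (intro continuous_on_compose2[OF k_continuous_on[of UNIV]]
          continuous_on_compose2[OF nominal_continuous_on[OF y order_refl, of "b - a"]] continuous_intros) auto
  then have "(\<lambda>t. k (y (t - a))) \<in> borel_measurable (lebesgue_on {a..<b})"
    by (intro continuous_imp_measurable_on_sets_lebesgue) (auto intro: continuous_on_subset)
  then show "u \<in> borel_measurable (lebesgue_on {a..<b})"
    by (rule measurable_cong[THEN iffD1, rotated]) (simp add: u)
  have "bounded ((\<lambda>t. k (y (t - a))) ` {a..b})"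
    by (intro compact_imp_bounded compact_continuous_image cont) auto
  then show "bounded (u ` {a..<b})"
    by (rule bounded_subset) (auto simp: u)
qed

lemma
  assumes CL: "closed_loop_solution f k \<tau> N T x0 u0 x z u" and "\<tau> > 0"
    and part: "time_partition T"
    and u0: "u0 \<in> borel_measurable (lebesgue_on {-\<tau>..<0})" "bounded (u0 ` {-\<tau>..<0})"
  shows closed_loop_measurable: "u \<in> borel_measurable (lebesgue_on {-\<tau>..<T i})"
    and closed_loop_bounded: "bounded (u ` {-\<tau>..<T i})"
proof -
  have "u \<in> borel_measurable (lebesgue_on {-\<tau>..<T i}) \<and> bounded (u ` {-\<tau>..<T i})"
  proof (induction i)
    case 0
    have eq: "u s = u0 s" if "s \<in> {-\<tau>..<0}" for s using CL that by (auto simp: closed_loop_solution_def)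
    have "u \<in> borel_measurable (lebesgue_on {-\<tau>..<0})"
      using u0(1) by (rule measurable_cong[THEN iffD1, rotated]) (simp add: eq)
    moreover have "bounded (u ` {-\<tau>..<0})" using u0(2) by (simp add: eq cong: image_cong_simp)
    ultimately show ?case using part by (simp add: time_partition_def)
  next
    case (Suc i)
    obtain y where y: "nominal y" "y 0 = z (T i)" by (rule nominal_exists)
    have D: "(z has_vector_derivative f (z t, k (z t))) (at t within {T i..<T (Suc i)})" and uz: "u t = k (z t)"
      if "t \<in> {T i..<T (Suc i)}" for t
      using CL that by (auto simp: closed_loop_solution_def)
    have "u t = k (y (t - T i))" if t: "t \<in> {T i..<T (Suc i)}" for t
    proof -
      have "integral_solution (\<lambda>_ y. f (y, k y)) z (T i) t"
        by (intro integral_solution_derivative has_vector_derivative_within_subset[OF D]) (use t in auto)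
      from nominal_unique[OF this y, of t] show ?thesis using t uz[OF t] by simp
    qed
    note feedback_nominal[OF y(1) this]
    moreover have "{-\<tau>..<T (Suc i)} = {-\<tau>..<T i} \<union> {T i..<T (Suc i)}"
      using time_partition_nonneg[OF part, of i] time_partition_mono[OF part, of i "Suc i"] \<open>\<tau> > 0\<close> by auto
    ultimately show ?case using Suc by (auto simp: image_Un intro!: borel_measurable_lebesgue_on_Un)
  qed
  then show "u \<in> borel_measurable (lebesgue_on {-\<tau>..<T i})" "bounded (u ` {-\<tau>..<T i})" by auto
qed

lemma closed_loop_sampled:
  assumes CL: "closed_loop_solution f k \<tau> N T x0 u0 x z u" and "\<tau> > 0"
    and part: "time_partition T" and gap: "\<And>i. T (Suc i) - T i \<le> r"
    and u0: "u0 \<in> borel_measurable (lebesgue_on {-\<tau>..<0})" "bounded (u0 ` {-\<tau>..<0})"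
  shows "sampled_loop \<tau> r T x z u"
  unfolding sampled_loop_def
proof (intro conjI allI)
  fix i
  have "(\<lambda>q. if q \<in> {T i - \<tau>..<T i} then u q else 0) \<in> borel_measurable lebesgue"
    using measurable_restrict_mono[OF closed_loop_measurable[OF CL \<open>\<tau> > 0\<close> part u0, of i], of "{T i - \<tau>..<T i}"]
      time_partition_nonneg[OF part, of i] by (subst borel_measurable_if) auto
  from borel_measurable_lebesgue_shift[OF this, of "T i - \<tau>"]
  have "(\<lambda>s. if s + (T i - \<tau>) \<in> {T i - \<tau>..<T i} then u (s + (T i - \<tau>)) else 0) \<in> borel_measurable lebesgue" .
  also have "(\<lambda>s. if s + (T i - \<tau>) \<in> {T i - \<tau>..<T i} then u (s + (T i - \<tau>)) else 0) = history \<tau> u (T i)"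
    by (auto simp: history_def fun_eq_iff algebra_simps)
  finally show "history \<tau> u (T i) \<in> borel_measurable lebesgue" .
next
  show "integral_solution (\<lambda>t y. f (y, u (t - \<tau>))) x 0 b" for b
    using CL by (intro caratheodory_integral_solution) (auto simp: closed_loop_solution_def)
qed (use CL part gap in \<open>auto simp: closed_loop_solution_def\<close>)

lemma closed_loop_predictor:
  assumes CL: "closed_loop_solution f k \<tau> N T x0 u0 x z u" and "\<tau> > 0"
    and n: "n = N (x (T i), sup_norm_on {T i - \<tau>..<T i} u)"
  shows "z (T i) = predictor_seq f (history \<tau> u (T i)) (\<tau> / real n) (x (T i)) n"
proof -
  have "z (T i) = predictor_seq f (\<lambda>s. u (T i - \<tau> + s)) (\<tau> / real n) (x (T i)) n"
    using CL by (simp add: closed_loop_solution_def Let_def n)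
  also have "\<dots> = predictor_seq f (history \<tau> u (T i)) (\<tau> / real n) (x (T i)) n"
    using divide_nat_mult_le[OF \<open>\<tau> > 0\<close>, of n] \<open>\<tau> > 0\<close>
    by (intro predictor_seq_cong) (auto simp: history_def simp del: times_divide_eq_right)
  finally show ?thesis .
qed

text \<open>\<open>W i\<close> is an input that is correct before \<open>T i\<close>; it determines
  \<open>x (T i)\<close>, the prediction made there, and thus the input up to
  \<open>T (Suc i)\<close>. The whole state trajectory is obtained only at the end, from
  completeness applied to the finished input.\<close>

lemma closed_loop_exists:
  assumes "\<tau> > 0" and part: "time_partition T"
    and u0: "u0 \<in> borel_measurable (lebesgue_on {-\<tau>..<0})" "bounded (u0 ` {-\<tau>..<0})"
  shows "\<exists>x z u. closed_loop_solution f k \<tau> N T x0 u0 x z u"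
proof -
  define nom where "nom p = (SOME y. nominal y \<and> y 0 = p)" for p
  have nom: "nominal (nom p)" "nom p 0 = p" for p
    using nominal_exists[of p] someI_ex[of "\<lambda>y. nominal y \<and> y 0 = p"] unfolding nom_def by blast+
  define start where
    "start i W = (let x = flow (\<lambda>t. W (t - \<tau>)) x0; n = N (x (T i), sup_norm_on {T i - \<tau>..<T i} W)
       in predictor_seq f (\<lambda>s. W (T i - \<tau> + s)) (\<tau> / real n) (x (T i)) n)" for i and W :: "real \<Rightarrow> 'b"
  define extend where
    "extend i W = (\<lambda>t. if t \<in> {T i..<T (Suc i)} then k (nom (start i W) (t - T i)) else W t)" for i W
  define W where "W = rec_nat (\<lambda>s. if s \<in> {-\<tau>..<0} then u0 s else 0) extend"
  have W0: "W 0 = (\<lambda>s. if s \<in> {-\<tau>..<0} then u0 s else 0)" by (simp add: W_def)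
  have WS: "W (Suc i) = (\<lambda>t. if t \<in> {T i..<T (Suc i)} then k (nom (start i (W i)) (t - T i)) else W i t)" for i
  proof -
    have "W (Suc i) = extend i (W i)" by (simp add: W_def)
    then show ?thesis by (simp only: extend_def)
  qed
  have T0: "T 0 = 0" using part by (simp add: time_partition_def)
  have Tmono: "T i \<le> T j" if "i \<le> j" for i j using part that by (rule time_partition_mono)
  have Tless: "T i < T (Suc i)" for i using part by (simp add: time_partition_def strict_mono_less)
  have "\<exists>S. W i \<in> bounded_inputs S" for i
  proof (induction i)
    case 0
    have "W 0 \<in> borel_measurable lebesgue" unfolding W0 using u0(1) by (subst borel_measurable_if) auto
    moreover obtain S where "\<forall>s\<in>{-\<tau>..<0}. norm (u0 s) \<le> S" using u0(2) by (auto simp: bounded_iff)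
    then have "\<forall>t. norm (W 0 t) \<le> max S 0" by (auto simp: W0 le_max_iff_disj)
    ultimately show ?case by (auto simp: bounded_inputs_def)
  next
    case (Suc i)
    then obtain S where S: "W i \<in> bounded_inputs S" by blast
    define w where "w t = k (nom (start i (W i)) (t - T i))" for t
    have w: "w \<in> borel_measurable (lebesgue_on {T i..<T (Suc i)})" "bounded (w ` {T i..<T (Suc i)})"
      using feedback_nominal[OF nom(1), of "T i" "T (Suc i)" w "start i (W i)"] by (auto simp: w_def)
    have eq: "W (Suc i) = (\<lambda>t. if t \<in> {T i..<T (Suc i)} then (if t \<in> {T i..<T (Suc i)} then w t else 0) else W i t)"
      by (auto simp: WS w_def)
    have "(\<lambda>t. if t \<in> {T i..<T (Suc i)} then w t else 0) \<in> borel_measurable lebesgue"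
      using w(1) by (subst borel_measurable_if) auto
    then have "W (Suc i) \<in> borel_measurable lebesgue"
      unfolding eq by (rule measurable_If_set) (use S in \<open>simp_all add: bounded_inputs_def\<close>)
    moreover obtain B where "\<forall>t\<in>{T i..<T (Suc i)}. norm (w t) \<le> B" using w(2) by (auto simp: bounded_iff)
    then have "\<forall>t. norm (W (Suc i) t) \<le> max B S" using S by (auto simp: eq bounded_inputs_def le_max_iff_disj)
    ultimately show ?case by (auto simp: bounded_inputs_def)
  qed
  then obtain S where S: "\<And>i. W i \<in> bounded_inputs (S i)" by metis
  have Weq: "W j t = W i t" if "i \<le> j" "t < T i" for i j t
    using that(1)
  proof (induction j rule: dec_induct)
    case (step j)
    then show ?case using that(2) Tmono[of i j] by (auto simp: WS)
  qed simp
  \<comment> \<open>All \<open>W j\<close> with \<open>t < T j\<close> have the same value at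
    \<open>t\<close>.\<close>
  define u where "u t = W (LEAST j. t < T j) t" for t
  have uW: "u t = W j t" if "t < T j" for t j
    unfolding u_def using Weq[of "LEAST j. t < T j" j t] LeastI[of "\<lambda>j. t < T j" j] that Least_le[of "\<lambda>j. t < T j" j] by auto
  have late: "\<exists>j. t < T j" for t
  proof -
    have "\<forall>\<^sub>F j in sequentially. t < T j"
      using part by (auto simp: time_partition_def filterlim_at_top_dense)
    then show ?thesis by (auto simp: eventually_sequentially)
  qed
  have um: "u \<in> borel_measurable lebesgue"
  proof (rule borel_measurable_LIMSEQ_metric)
    show "W i \<in> borel_measurable lebesgue" for i using S by (simp add: bounded_inputs_def)
    fix t
    obtain j where j: "t < T j" using late by blast
    have "\<forall>\<^sub>F i in sequentially. W i t = u t"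
      using eventually_ge_at_top[of j]
    proof eventually_elim
      case (elim i)
      show ?case using uW[OF j] Weq[OF elim j] by simp
    qed
    then show "(\<lambda>i. W i t) \<longlonglongrightarrow> u t" by (rule tendsto_eventually)
  qed
  have "locally_ess_bounded (\<lambda>t. u (t - \<tau>))"
    unfolding locally_ess_bounded_def
  proof (intro allI impI)
    fix b :: real
    obtain j where j: "b < T j" using late by blast
    have "norm (u (t - \<tau>)) \<le> S j" if "t \<in> {0..b}" for t
      using uW[of "t - \<tau>" j] that j \<open>\<tau> > 0\<close> S[of j] by (auto simp: bounded_inputs_def)
    then show "\<exists>B. AE t in lebesgue_on {0..b}. norm (u (t - \<tau>)) \<le> B"
      by (intro exI[of _ "S j"] AE_I2) auto
  qed
  moreover have "(\<lambda>t. u (t - \<tau>)) \<in> borel_measurable (lebesgue_on {0..})"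
    using borel_measurable_lebesgue_shift[OF um, of "-\<tau>"] by (intro measurable_restrict_space1) simp
  ultimately obtain x where x: "caratheodory_solution (\<lambda>t y. f (y, u (t - \<tau>))) x" "x 0 = x0"
    using complete[unfolded forward_complete_def, rule_format, of "\<lambda>t. u (t - \<tau>)" x0] by blast
  \<comment> \<open>\<open>start\<close> works with the flow for the preliminary input
    \<open>W i\<close>; up to time \<open>T i\<close> this flow is the actual state, as only earlier
    inputs enter.\<close>
  have xW: "flow (\<lambda>t. W i (t - \<tau>)) x0 (T i) = x (T i)" for i
  proof (rule flow_eqI[where S = "S i", OF _ caratheodory_integral_solution[OF x(1) order_refl]])
    show "(\<lambda>t. W i (t - \<tau>)) \<in> bounded_inputs (S i)" using bounded_inputs_shift[OF S, of i "-\<tau>"] by simp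
    show "u (t - \<tau>) = W i (t - \<tau>)" if "0 \<le> t" "t < T i" for t using uW that \<open>\<tau> > 0\<close> by simp
  qed (use x(2) time_partition_nonneg[OF part] in auto)
  define z where "z t = (let i = (LEAST j. t < T (Suc j)) in nom (start i (W i)) (t - T i))" for t
  have z: "z t = nom (start i (W i)) (t - T i)" if "t \<in> {T i..<T (Suc i)}" for t i
  proof -
    have "(LEAST j. t < T (Suc j)) = i"
    proof (rule Least_equality)
      fix j assume "t < T (Suc j)"
      then have "T i < T (Suc j)" using that by auto
      then show "i \<le> j" using Tmono[of "Suc j" i] by (meson leD leI not_less_eq_eq)
    qed (use that in auto)
    then show ?thesis by (simp add: z_def)
  qed
  have zT: "z (T i) = start i (W i)" for i using z[of "T i" i] Tless[of i] nom(2) by simp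
  have "closed_loop_solution f k \<tau> N T x0 u0 x z u"
    unfolding closed_loop_solution_def
  proof (intro conjI allI ballI)
    show "u s = u0 s" if "s \<in> {-\<tau>..<0}" for s using uW[of s 0] that by (simp add: T0 W0)
    show "u t = k (z t)" if "t \<in> {T i..<T (Suc i)}" for i t
      using uW[of t "Suc i"] that by (simp add: WS z)
    show "(z has_vector_derivative f (z t, k (z t))) (at t within {T i..<T (Suc i)})" if t: "t \<in> {T i..<T (Suc i)}" for i t
    proof (rule has_vector_derivative_transform[OF t])
      let ?y = "nom (start i (W i))"
      show "z s = ?y (s - T i)" if "s \<in> {T i..<T (Suc i)}" for s using z[OF that] by simp
      have "((\<lambda>s. s - T i) has_vector_derivative 1) (at t within {T i..<T (Suc i)})"
        by (auto intro!: derivative_eq_intros)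
      moreover have "(?y has_vector_derivative f (?y (t - T i), k (?y (t - T i)))) (at (t - T i) within {0..})"
        using nom(1)[of "start i (W i)"] t by (simp add: nominal_def autonomous_solution_def)
      then have "(?y has_vector_derivative f (?y (t - T i), k (?y (t - T i)))) (at (t - T i) within (\<lambda>s. s - T i) ` {T i..<T (Suc i)})"
        by (rule has_vector_derivative_within_subset) auto
      ultimately have "((?y \<circ> (\<lambda>s. s - T i)) has_vector_derivative 1 *\<^sub>R f (?y (t - T i), k (?y (t - T i)))) (at t within {T i..<T (Suc i)})"
        by (rule vector_diff_chain_within)
      then show "((\<lambda>s. ?y (s - T i)) has_vector_derivative f (z t, k (z t))) (at t within {T i..<T (Suc i)})"
        using z[OF t] by (simp add: o_def)
    qed
    fix i
    have sup: "sup_norm_on {T i - \<tau>..<T i} (W i) = sup_norm_on {T i - \<tau>..<T i} u"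
      unfolding sup_norm_on_def by (intro SUP_cong) (simp_all add: uW[of _ i])
    define n where "n = N (x (T i), sup_norm_on {T i - \<tau>..<T i} u)"
    have "z (T i) = predictor_seq f (\<lambda>s. W i (T i - \<tau> + s)) (\<tau> / real n) (x (T i)) n"
      by (simp add: zT start_def Let_def xW sup n_def)
    also have "\<dots> = predictor_seq f (\<lambda>s. u (T i - \<tau> + s)) (\<tau> / real n) (x (T i)) n"
    proof (rule predictor_seq_cong)
      fix s assume "0 \<le> s" "s < real n * (\<tau> / real n)"
      then have "s < \<tau>" using divide_nat_mult_le[OF \<open>\<tau> > 0\<close>, of n] by linarith
      then show "W i (T i - \<tau> + s) = u (T i - \<tau> + s)" by (simp add: uW[of _ i])
    qed (use \<open>\<tau> > 0\<close> in auto)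
    finally show "let n = N (x (T i), sup_norm_on {T i - \<tau>..<T i} u)
          in z (T i) = predictor_seq f (\<lambda>s. u (T i - \<tau> + s)) (\<tau> / real n) (x (T i)) n"
      by (simp add: n_def Let_def)
  qed (use x in auto)
  then show ?thesis by blast
qed

end

text \<open>\<open>D\<close> at a rounded size is a step function without any monotonicity. Adding
  up ramps repairs both defects: the ramp of index \<open>m\<close> vanishes for
  \<open>s \<le> m - 2\<close> and is at least 1 for \<open>s \<ge> m - 1\<close>, in particular
  when \<open>m = nat \<lceil>s\<rceil>\<close>. The factor \<open>s\<close> gives the value 0 at
  0.\<close>

lemma locally_lipschitz_majorant:
  fixes D :: "nat \<Rightarrow> real"
  assumes D: "\<And>m. D m \<ge> 0"
  obtains C :: "real \<Rightarrow> real" where "C \<in> {0..} \<rightarrow> {0..}"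
    "local_lipschitz (UNIV :: real set) {0..} (\<lambda>_. C)" "mono_on {0..} C" "C 0 = 0"
    "\<And>s. 0 \<le> s \<Longrightarrow> D (nat \<lceil>s\<rceil>) * s \<le> C s"
proof -
  define E where "E n s = (\<Sum>m\<le>n. D m * max 0 (s - real m + 2))" for n s
  \<comment> \<open>The summands with \<open>m \<ge> s + 2\<close> vanish, so the upper summation bound can be kept fixed locally.\<close>
  define C where "C s = s * E (nat \<lceil>s\<rceil> + 1) s" for s
  have E0: "0 \<le> E n s" for n s unfolding E_def using D by (intro sum_nonneg) auto
  have Emono: "E n s \<le> E n t" if "s \<le> t" for n s t
    unfolding E_def using D that by (intro sum_mono mult_left_mono) auto
  have En: "C s = s * E n s" if "0 \<le> s" "s + 1 \<le> real n" for s n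
  proof -
    have le: "nat \<lceil>s\<rceil> + 1 \<le> n" using that by linarith
    have "E (nat \<lceil>s\<rceil> + 1) s = E n s" unfolding E_def
    proof (rule sum.mono_neutral_left)
      show "\<forall>m\<in>{..n} - {..nat \<lceil>s\<rceil> + 1}. D m * max 0 (s - real m + 2) = 0"
      proof
        fix m assume "m \<in> {..n} - {..nat \<lceil>s\<rceil> + 1}"
        then have "nat \<lceil>s\<rceil> + 2 \<le> m" by auto
        then have "s + 2 \<le> real m" using that(1) by linarith
        then show "D m * max 0 (s - real m + 2) = 0" by simp
      qed
    qed (use le in auto)
    then show ?thesis by (simp add: C_def)
  qed
  show ?thesis
  proof (rule that[of C])
    show "C \<in> {0..} \<rightarrow> {0..}" using E0 by (auto simp: C_def)
    show "C 0 = 0" by (simp add: C_def)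
    show "mono_on {0..} C"
    proof (rule mono_onI)
      fix s t :: real assume st: "s \<in> {0..}" "t \<in> {0..}" "s \<le> t"
      obtain n :: nat where n: "t + 1 \<le> real n" using real_arch_simple by blast
      have "s * E n s \<le> t * E n t" using st E0 Emono by (intro mult_mono) auto
      then show "C s \<le> C t" using En[of s n] En[of t n] st n by auto
    qed
    show "D (nat \<lceil>s\<rceil>) * s \<le> C s" if s: "0 \<le> s" for s
    proof -
      define m where "m = nat \<lceil>s\<rceil>"
      have m1: "1 \<le> s - real m + 2" using s unfolding m_def by linarith
      then have "D m * 1 \<le> D m * max 0 (s - real m + 2)" using D by (intro mult_left_mono) auto
      also have "\<dots> \<le> E (m + 1) s"
        unfolding E_def using D by (intro member_le_sum[of m "{..m + 1}" "\<lambda>m. D m * max 0 (s - real m + 2)"]) auto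
      finally have "D m * s \<le> E (m + 1) s * s" using s by (intro mult_right_mono) auto
      then show ?thesis by (simp add: C_def m_def mult.commute)
    qed
    show "local_lipschitz (UNIV :: real set) {0..} (\<lambda>_. C)"
      unfolding local_lipschitz_def
    proof (intro ballI)
      fix s0 t0 :: real assume "s0 \<in> {0..}"
      obtain n :: nat where n: "s0 + 2 \<le> real n" using real_arch_simple by blast
      define L where "L = (\<Sum>m\<le>n. D m)"
      have L: "0 \<le> L" unfolding L_def using D by (intro sum_nonneg) auto
      have lipE: "\<bar>E n s - E n t\<bar> \<le> L * \<bar>s - t\<bar>" for s t
      proof -
        have "E n s - E n t = (\<Sum>m\<le>n. D m * (max 0 (s - real m + 2) - max 0 (t - real m + 2)))"
          by (simp add: E_def sum_subtractf right_diff_distrib)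
        also have "\<bar>\<dots>\<bar> \<le> (\<Sum>m\<le>n. D m * \<bar>s - t\<bar>)"
        proof (rule order_trans[OF sum_abs sum_mono])
          fix m
          have "\<bar>max 0 (s - real m + 2) - max 0 (t - real m + 2)\<bar> \<le> \<bar>s - t\<bar>" by (auto simp: max_def)
          then show "\<bar>D m * (max 0 (s - real m + 2) - max 0 (t - real m + 2))\<bar> \<le> D m * \<bar>s - t\<bar>"
            using D[of m] by (simp add: abs_mult mult_left_mono)
        qed
        also have "\<dots> = L * \<bar>s - t\<bar>" by (simp add: L_def sum_distrib_right)
        finally show ?thesis .
      qed
      have "(E n (s0 + 1) + (s0 + 1) * L)-lipschitz_on (cball s0 1 \<inter> {0..}) C"
      proof (rule lipschitz_onI)
        fix s t assume st: "s \<in> cball s0 1 \<inter> {0..}" "t \<in> cball s0 1 \<inter> {0..}"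
        then have b: "0 \<le> s" "s \<le> s0 + 1" "0 \<le> t" "t \<le> s0 + 1" by (auto simp: dist_real_def)
        have "C s - C t = (s - t) * E n s + t * (E n s - E n t)"
          using En[of s n] En[of t n] b n by (simp add: algebra_simps)
        also have "\<bar>\<dots>\<bar> \<le> \<bar>s - t\<bar> * \<bar>E n s\<bar> + \<bar>t\<bar> * \<bar>E n s - E n t\<bar>"
          using abs_triangle_ineq[of "(s - t) * E n s" "t * (E n s - E n t)"] by (simp add: abs_mult)
        also have "\<dots> \<le> \<bar>s - t\<bar> * E n (s0 + 1) + (s0 + 1) * (L * \<bar>s - t\<bar>)"
          using b E0[of n s] Emono[OF b(2), of n] lipE[of s t] by (intro add_mono mult_mono) auto
        finally show "dist (C s) (C t) \<le> (E n (s0 + 1) + (s0 + 1) * L) * dist s t"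
          by (simp add: dist_real_def algebra_simps)
      qed (use E0 L \<open>s0 \<in> {0..}\<close> in auto)
      then show "\<exists>u>0. \<exists>L. \<forall>t\<in>cball t0 u \<inter> UNIV. L-lipschitz_on (cball s0 u \<inter> {0..}) C"
        by (intro exI[of _ 1]) auto
    qed
  qed
qed

theorem theorem1p1:
  fixes f :: "(real^'n) \<times> (real^'m) \<Rightarrow> real^'n"
    and k :: "real^'n \<Rightarrow> real^'m"
    and \<tau> r :: real
  assumes f_C1: "continuously_differentiable f"
    and f_zero: "f (0, 0) = 0"
    and A1: "forward_complete f"
    and k_C1: "continuously_differentiable k"
    and k_zero: "k 0 = 0"
    and A2_gas: "globally_asymptotically_stable (\<lambda>x. f (x, k x))"
    and A2_les: "locally_exponentially_stable (\<lambda>x. f (x, k x))"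
    and tau_pos: "\<tau> > 0"
    and r_pos: "r > 0"
  shows "\<exists>(N :: (real^'n) \<times> real \<Rightarrow> nat) (\<omega> :: real) (C :: real \<Rightarrow> real).
    locally_bounded_on (UNIV \<times> {0..}) (\<lambda>p. real (N p)) \<and> (\<forall>p\<in>UNIV \<times> {0..}. N p \<ge> 1) \<and>
    \<omega> > 0 \<and>
    C \<in> {0..} \<rightarrow> {0..} \<and> local_lipschitz (UNIV :: real set) {0..} (\<lambda>_. C) \<and>
    mono_on {0..} C \<and> C 0 = 0 \<and>
    (\<forall>(T :: nat \<Rightarrow> real) (x0 :: real^'n) (u0 :: real \<Rightarrow> real^'m).
       time_partition T \<and> (\<forall>i. T (Suc i) - T i \<le> r) \<and>
       u0 \<in> borel_measurable (lebesgue_on {-\<tau>..<0}) \<and> bounded (u0 ` {-\<tau>..<0})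
       \<longrightarrow>
       (\<exists>x z u. closed_loop_solution f k \<tau> N T x0 u0 x z u) \<and>
       (\<forall>x z u. closed_loop_solution f k \<tau> N T x0 u0 x z u \<longrightarrow>
          (\<forall>t\<ge>0. bounded (u ` {t - \<tau>..<t}) \<and>
             norm (x t) + sup_norm_on {t - \<tau>..<t} u
               \<le> exp (- \<omega> * t) * C (norm x0 + sup_norm_on {-\<tau>..<0} u0))))"
proof -
  interpret stabilized_system f k
    by unfold_locales (use assms in auto)
  obtain \<epsilon> D :: "nat \<Rightarrow> real" and \<omega> where \<epsilon>: "\<And>m. \<epsilon> m > 0" and D: "\<And>m. D m \<ge> 0" and \<omega>: "\<omega> > 0"
    and decay: "\<And>T x z u m t. sampled_loop \<tau> r T x z u \<Longrightarrow> (\<And>j. bounded (u ` {T j - \<tau>..<T j})) \<Longrightarrow>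
       (\<And>j. norm (z (T j) - x (T j + \<tau>)) \<le> \<epsilon> (nat \<lceil>state_size \<tau> x u (T j)\<rceil>) * state_size \<tau> x u (T j)) \<Longrightarrow>
       state_size \<tau> x u 0 \<le> real m \<Longrightarrow> 0 \<le> t \<Longrightarrow>
       state_bounded \<tau> x u t (exp (- \<omega> * t) * (D m * state_size \<tau> x u 0))"
    using sampled_loop_decay[OF tau_pos r_pos] by blast
  obtain C where C: "C \<in> {0..} \<rightarrow> {0..}" "local_lipschitz (UNIV :: real set) {0..} (\<lambda>_. C)" "mono_on {0..} C" "C 0 = 0"
    and C_ge: "\<And>s. 0 \<le> s \<Longrightarrow> D (nat \<lceil>s\<rceil>) * s \<le> C s"
    using locally_lipschitz_majorant[of D] D by blast
  have "\<forall>m::nat. \<exists>N. N \<ge> 1 \<and> (\<forall>v \<sigma> \<xi>. v \<in> bounded_inputs \<sigma> \<longrightarrow> norm \<xi> + \<sigma> \<le> real m \<longrightarrow>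
       norm (predictor_seq f v (\<tau> / real N) \<xi> N - flow v \<xi> \<tau>) \<le> \<epsilon> m * (norm \<xi> + \<sigma>))"
    using predictor_accurate[OF tau_pos \<epsilon>] by metis
  then obtain M where M: "\<And>m. M m \<ge> 1" and accurate: "\<And>m v \<sigma> \<xi>. v \<in> bounded_inputs \<sigma> \<Longrightarrow> norm \<xi> + \<sigma> \<le> real m \<Longrightarrow>
       norm (predictor_seq f v (\<tau> / real (M m)) \<xi> (M m) - flow v \<xi> \<tau>) \<le> \<epsilon> m * (norm \<xi> + \<sigma>)"
    by metis
  \<comment> \<open>\<open>M m\<close> steps are accurate for all data of size at most
    \<open>m\<close>; rounding the size up leaves finitely many step numbers on each bounded
    set.\<close>
  define N where "N p = M (nat \<lceil>norm (fst p) + snd p\<rceil>)" for p :: "(real^'n) \<times> real"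
  have "locally_bounded_on (UNIV \<times> {0..}) (\<lambda>p. real (N p))"
    unfolding locally_bounded_on_def
  proof (intro allI impI)
    fix S :: "((real^'n) \<times> real) set" assume "bounded S"
    then obtain b where b: "\<And>p. p \<in> S \<Longrightarrow> norm p \<le> b" by (auto simp: bounded_iff)
    have "(\<lambda>p. real (N p)) ` S \<subseteq> (\<lambda>m. real (M m)) ` {..nat \<lceil>2 * b\<rceil>}"
    proof clarify
      fix x s assume "(x, s) \<in> S"
      then have "norm x + s \<le> 2 * b"
        using b[of "(x, s)"] norm_fst_le[of x s] norm_snd_le[of s x] by simp
      then have "nat \<lceil>norm x + s\<rceil> \<le> nat \<lceil>2 * b\<rceil>" by (intro nat_mono ceiling_mono)
      then show "real (N (x, s)) \<in> (\<lambda>m. real (M m)) ` {..nat \<lceil>2 * b\<rceil>}" by (auto simp: N_def)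
    qed
    then show "bounded ((\<lambda>p. real (N p)) ` S)" by (rule bounded_subset[rotated]) (simp add: finite_imp_bounded)
  qed
  moreover have "bounded (u ` {t - \<tau>..<t}) \<and>
       norm (x t) + sup_norm_on {t - \<tau>..<t} u \<le> exp (- \<omega> * t) * C (norm x0 + sup_norm_on {-\<tau>..<0} u0)"
    if part: "time_partition T" and gap: "\<forall>i. T (Suc i) - T i \<le> r"
      and u0: "u0 \<in> borel_measurable (lebesgue_on {-\<tau>..<0})" "bounded (u0 ` {-\<tau>..<0})"
      and CL: "closed_loop_solution f k \<tau> N T x0 u0 x z u" and t: "0 \<le> t" for T x0 u0 x z u t
  proof -
    have SL: "sampled_loop \<tau> r T x z u" using closed_loop_sampled[OF CL tau_pos part _ u0] gap by blast
    have ub: "bounded (u ` {t - \<tau>..<t})" if t: "0 \<le> t" for t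
    proof -
      have "T 0 \<le> t" using part t by (simp add: time_partition_def)
      then obtain j where "t < T (Suc j)" using time_partition_index[OF part] by blast
      then obtain i where "t \<le> T i" using less_imp_le by blast
      then show ?thesis
        using t by (intro bounded_subset[OF closed_loop_bounded[OF CL tau_pos part u0, of i]] image_mono) auto
    qed
    have ubT: "bounded (u ` {T j - \<tau>..<T j})" for j using ub time_partition_nonneg[OF part] by blast
    have err: "norm (z (T j) - x (T j + \<tau>)) \<le> \<epsilon> (nat \<lceil>state_size \<tau> x u (T j)\<rceil>) * state_size \<tau> x u (T j)" for j
    proof -
      define \<sigma> where "\<sigma> = sup_norm_on {T j - \<tau>..<T j} u"
      define m where "m = nat \<lceil>norm (x (T j)) + \<sigma>\<rceil>"
      have u\<sigma>: "norm (u s) \<le> \<sigma>" if "s \<in> {T j - \<tau>..<T j}" for s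
        unfolding \<sigma>_def by (rule sup_norm_on_upper[OF ubT that])
      have "z (T j) = predictor_seq f (history \<tau> u (T j)) (\<tau> / real (M m)) (x (T j)) (M m)"
        by (rule closed_loop_predictor[OF CL tau_pos]) (simp add: N_def m_def \<sigma>_def)
      moreover have "x (T j + \<tau>) = flow (history \<tau> u (T j)) (x (T j)) \<tau>"
        by (rule sampled_loop_flow[OF SL tau_pos u\<sigma>]) (use tau_pos in auto)
      moreover have "norm (x (T j)) + \<sigma> \<le> real m" unfolding m_def by linarith
      ultimately have "norm (z (T j) - x (T j + \<tau>)) \<le> \<epsilon> m * (norm (x (T j)) + \<sigma>)"
        using accurate[OF history_bounded_inputs[OF SL tau_pos u\<sigma>], of j "x (T j)" m] by simp
      then show ?thesis by (simp add: state_size_def m_def \<sigma>_def)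
    qed
    define s0 where "s0 = norm x0 + sup_norm_on {-\<tau>..<0} u0"
    have s0: "s0 = state_size \<tau> x u 0"
    proof -
      have "sup_norm_on {-\<tau>..<0} u = sup_norm_on {-\<tau>..<0} u0"
        unfolding sup_norm_on_def by (intro SUP_cong) (use CL in \<open>auto simp: closed_loop_solution_def\<close>)
      moreover have "x 0 = x0" using CL by (simp add: closed_loop_solution_def)
      ultimately show ?thesis by (simp add: s0_def state_size_def)
    qed
    have "0 \<le> s0" unfolding s0_def using sup_norm_on_nonneg[OF u0(2)] tau_pos by simp
    \<comment> \<open>\<open>D\<close> is taken at the rounded initial size and then dominated by
      the regular function \<open>C\<close>.\<close>
    have "state_size \<tau> x u 0 \<le> real (nat \<lceil>s0\<rceil>)" unfolding s0 by linarith
    from decay[OF SL ubT err this t]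
    have "state_size \<tau> x u t \<le> exp (- \<omega> * t) * (D (nat \<lceil>s0\<rceil>) * s0)"
      by (simp add: state_bounded_iff[OF tau_pos ub[OF t]] s0)
    also have "\<dots> \<le> exp (- \<omega> * t) * C s0" using C_ge[OF \<open>0 \<le> s0\<close>] by simp
    finally show ?thesis using ub[OF t] by (simp add: state_size_def s0_def)
  qed
  moreover have "\<forall>p\<in>UNIV \<times> {0..}. N p \<ge> 1" using M by (simp add: N_def)
  ultimately show ?thesis
    using \<omega> C closed_loop_exists[OF tau_pos]
    by (intro exI[of _ N] exI[of _ \<omega>] exI[of _ C]) blast
qed

end
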